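(* The online algorithm \textsc{Divide \& Explore} (described in the context) is $3$-competitive for the collaborative tree exploration problem with energy-bounded agents, i.e. for every instance $I=\langle T,r,k,B\rangle$ we have $|\textsc{Opt}(I)| \le 3\,|\textsc{Alg}(I)|$, where $\textsc{Alg}$ denotes \textsc{Divide \& Explore}.
   Context: Problem. An instance is $I=\langle T,r,k,B\rangle$: $T$ is a finite undirected tree, initially unknown, rooted at $r$; $k$ agents start at $r$; each agent can traverse at most $B$ edges in total (energy budget $B$, one unit per edge traversal). At every vertex $v$ the incident edges carry locally distinct labels (port numbers) $0,\dots,\delta_v-1$, $\delta_v$ the degree of $v$; w.l.o.g. for $v\ne r$ the edge towards $r$ has label $0$. When an agent arrives at a new vertex it learns the port number of the edge through which it arrived and the degree of the vertex. Agents communicate globally: the current map of the explored part of the tree and all agent positions are instantly known to all agents. A vertex is explored once some agent has visited it. The goal is to maximize the number of distinct vertices visited by the agents. For an algorithm $\textsc{Alg}$, $|\textsc{Alg}(I)|$ is the number of distinct vertices it visits on $I$, and $|\textsc{Opt}(I)|$ is the maximum number of distinct vertices that $k$ agents with budget $B$ starting at $r$ can visit when $T$ is known in advance. $\textsc{Alg}$ is $\rho$-competitive if $\sup_I |\textsc{Opt}(I)|/|\textsc{Alg}(I)|\le\rho$. Notation. $d(v)$ is the depth of $v$ in $T$; $T(v)$ is the subtree of $T$ induced by $v$ and all vertices below $v$; for a subtree $S$, $r_S$ is its vertex of smallest depth. L-DFS$(S,u)$: an agent moves along a shortest path to $u$, and then, while it has energy and $S$ is not completely explored: if the part of $S$ below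 its current vertex is completely explored it traverses the edge with label $0$, otherwise it traverses the edge of $S$ to an unexplored vertex with the smallest label $l>0$. R-DFS$(S,u)$ is the same with the largest label $l>0$. The L-DFS sequence of a subtree $S$ is the sequence of directed edges obtained by performing a complete depth-first traversal of $S$ from $r_S$ always choosing the smallest label $l>0$, directing each edge in the direction it is traversed (each edge appears once in each direction); the R-DFS sequence is defined analogously with the largest label. The leftmost (resp. rightmost) unexplored vertex of $S$ is the unexplored vertex incident to the first edge of the L-DFS (resp. R-DFS) sequence of $S$ that leads to an unexplored vertex. Algorithm \textsc{Divide \& Explore}. Agents are used one after another. Maintain a set $\mathcal T$ of edge-disjoint subtrees, initially $\mathcal T=\{T\}$. The first agent performs L-DFS$(T,r)$, the second R-DFS$(T,r)$. Then, while $T$ contains an unexplored vertex and an unused agent is at $r$: (1) for every $S\in\mathcal T$ containing an unexplored vertex, set $r_0:=r_S$ and, while $r_0$ has exactly one child leading to an unexplored vertex and $r_0$ has no unexplored child, replace $r_0$ by that child; then replace $S$ in $\mathcal T$ by $T(r_0)$. (2) Let $S\in\mathcal T$ be a subtree containing an unexplored vertex minimizing $d(r_S)$, and $v_L,v_R$ its leftmost and rightmost unexplored vertices. If $d(v_L)-d(r_S)\le\max\{1,(B-d(r_S))/3\}$, one agent performs L-DFS$(S,v_L)$; else if $d(v_R)-d(r_S)\le\max\{1,(B-d(r_S))/3\}$, one agent performs R-DFS$(S,v_R)$; otherwise let $v$ be the child of $r_S$ leading to $v_R$, $S^{(1)}$ the subtree of $S$ induced by all vertices not in $T(v)$, $S^{(2)}$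 the subtree of $S$ induced by the vertices of $T(v)$ and $r_S$; replace $S$ in $\mathcal T$ by $S^{(1)},S^{(2)}$, and one agent performs R-DFS$(S^{(1)},r_S)$ and another agent L-DFS$(S^{(2)},r_S)$. *)

theory Defs
  imports Complex_Main "HOL-Library.While_Combinator"
begin

section \<open>Instances\<close>

text \<open>
  \<open>port I v l\<close> is the other endpoint of the edge carrying label \<open>l\<close> at vertex \<open>v\<close>.
\<close>

record 'v exploration =
  verts :: "'v set"
  edges :: "'v set set"
  root :: 'v
  port :: "'v \<Rightarrow> nat \<Rightarrow> 'v"
  agents :: nat
  budget :: nat

definition nbrs :: "'v exploration \<Rightarrow> 'v \<Rightarrow> 'v set" where
  "nbrs I v = {w. {v, w} \<in> edges I}"

definition deg :: "'v exploration \<Rightarrow> 'v \<Rightarrow> nat" where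
  "deg I v = card (nbrs I v)"

definition walk :: "'v exploration \<Rightarrow> 'v list \<Rightarrow> bool" where
  "walk I p \<longleftrightarrow> p \<noteq> [] \<and> set p \<subseteq> verts I \<and> successively (\<lambda>v w. {v, w} \<in> edges I) p"

definition simple_path :: "'v exploration \<Rightarrow> 'v \<Rightarrow> 'v \<Rightarrow> 'v list \<Rightarrow> bool" where
  "simple_path I u v p \<longleftrightarrow> walk I p \<and> distinct p \<and> hd p = u \<and> last p = v"

definition finite_tree :: "'v exploration \<Rightarrow> bool" where
  "finite_tree I \<longleftrightarrow>
     finite (verts I) \<and> verts I \<noteq> {} \<and>
     (\<forall>e\<in>edges I. \<exists>u\<in>verts I. \<exists>v\<in>verts I. u \<noteq> v \<and> e = {u, v}) \<and>
     (\<forall>u\<in>verts I. \<forall>v\<in>verts I. \<exists>!p. simple_path I u v p)"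

definition path_to :: "'v exploration \<Rightarrow> 'v \<Rightarrow> 'v list" where
  "path_to I v = (THE p. simple_path I (root I) v p)"

definition depth :: "'v exploration \<Rightarrow> 'v \<Rightarrow> nat" where
  "depth I v = length (path_to I v) - 1"

definition exploration_instance :: "'v exploration \<Rightarrow> bool" where
  "exploration_instance I \<longleftrightarrow>
     finite_tree I \<and> root I \<in> verts I \<and>
     (\<forall>v\<in>verts I. bij_betw (port I v) {..<deg I v} (nbrs I v)) \<and>
     (\<forall>v\<in>verts I. v \<noteq> root I \<longrightarrow> depth I (port I v 0) < depth I v)"

section \<open>Offline optimum and competitiveness\<close>

text \<open>A walk with vertex list \<open>p\<close> traverses \<open>length p - 1\<close> edges.\<close>

definition feasible_walks :: "'v exploration \<Rightarrow> (nat \<Rightarrow> 'v list) \<Rightarrow> bool" where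
  "feasible_walks I w \<longleftrightarrow>
     (\<forall>i<agents I. walk I (w i) \<and> hd (w i) = root I \<and> length (w i) - 1 \<le> budget I)"

definition opt :: "'v exploration \<Rightarrow> nat" where
  "opt I = Max {card (\<Union>i<agents I. set (w i)) | w. feasible_walks I w}"

text \<open>
  An algorithm is represented by the set of vertices that its agents visit on each instance.
  The ratio bound is stated in multiplied form.
\<close>

definition competitive :: "real \<Rightarrow> ('v exploration \<Rightarrow> 'v set) \<Rightarrow> bool" where
  "competitive \<rho> alg \<longleftrightarrow>
     (\<forall>I. exploration_instance I \<longrightarrow> real (opt I) \<le> \<rho> * real (card (alg I)))"

section \<open>Subtrees and depth-first search\<close>

text \<open>
  A subtree is represented by its vertex set (it is the subgraph induced by that set), and
  \<open>X\<close> always denotes the set of explored vertices.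
\<close>

definition below :: "'v exploration \<Rightarrow> 'v \<Rightarrow> 'v set" where
  "below I v = {w \<in> verts I. v \<in> set (path_to I w)}"

definition top_of :: "'v exploration \<Rightarrow> 'v set \<Rightarrow> 'v" where
  "top_of I S = arg_min_on (depth I) S"

definition complete_below :: "'v exploration \<Rightarrow> 'v set \<Rightarrow> 'v set \<Rightarrow> 'v \<Rightarrow> bool" where
  "complete_below I X S v \<longleftrightarrow> S \<inter> below I v \<subseteq> X"

datatype direction = L | R

text \<open>
  The children of \<open>v\<close> in \<open>S\<close>, by increasing label for \<open>L\<close> and by decreasing label for \<open>R\<close>.
  For \<open>v \<noteq> root I\<close> these are behind the labels \<open>l > 0\<close>. At the root of the tree there is no
  edge towards the root, so there label \<open>0\<close> leads to a child as well and takes part in the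
  order.
\<close>

definition children :: "'v exploration \<Rightarrow> direction \<Rightarrow> 'v set \<Rightarrow> 'v \<Rightarrow> 'v list" where
  "children I D S v =
     (let cs = filter (\<lambda>w. w \<in> S \<and> depth I v < depth I w) (map (port I v) [0..<deg I v])
      in case D of L \<Rightarrow> cs | R \<Rightarrow> rev cs)"

text \<open>
  The vertices entered, one per edge traversal, by an agent that is at \<open>v\<close> with remaining
  energy \<open>e\<close>. An edge downwards is eligible if the part of \<open>S\<close> behind it contains an
  unexplored vertex; its lower endpoint itself may already be explored.
\<close>

fun dfs_steps ::
  "'v exploration \<Rightarrow> direction \<Rightarrow> 'v set \<Rightarrow> nat \<Rightarrow> 'v \<Rightarrow> 'v set \<Rightarrow> 'v list" where
  "dfs_steps I D S 0 v X = []"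
| "dfs_steps I D S (Suc e) v X =
     (if S \<subseteq> X then []
      else let w = (if complete_below I X S v then port I v 0
                    else hd (filter (\<lambda>c. \<not> complete_below I X S c) (children I D S v)))
           in w # dfs_steps I D S e w (insert w X))"

text \<open>
  The vertices visited in L-DFS(S,u) and R-DFS(S,u), by an agent that starts at the root of the
  tree with full budget. If \<open>u\<close> is too deep, the agent runs out of energy on the way to \<open>u\<close>.
\<close>

definition dfs_agent ::
  "'v exploration \<Rightarrow> direction \<Rightarrow> 'v set \<Rightarrow> 'v \<Rightarrow> 'v set \<Rightarrow> 'v list" where
  "dfs_agent I D S u X =
     (let p = take (Suc (budget I)) (path_to I u)
      in p @ dfs_steps I D S (budget I - depth I u) u (X \<union> set p))"

text \<open>
  The L-DFS and R-DFS sequences. The first argument of \<open>dfs_edges\<close> bounds the recursion depth;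
  \<open>card S\<close> exceeds the height of \<open>S\<close>.
\<close>

fun dfs_edges ::
  "nat \<Rightarrow> 'v exploration \<Rightarrow> direction \<Rightarrow> 'v set \<Rightarrow> 'v \<Rightarrow> ('v \<times> 'v) list" where
  "dfs_edges 0 I D S v = []"
| "dfs_edges (Suc n) I D S v =
     concat (map (\<lambda>c. (v, c) # dfs_edges n I D S c @ [(c, v)]) (children I D S v))"

definition dfs_sequence :: "'v exploration \<Rightarrow> direction \<Rightarrow> 'v set \<Rightarrow> ('v \<times> 'v) list" where
  "dfs_sequence I D S = dfs_edges (card S) I D S (top_of I S)"

definition outermost_unexplored ::
  "'v exploration \<Rightarrow> direction \<Rightarrow> 'v set \<Rightarrow> 'v set \<Rightarrow> 'v" where
  "outermost_unexplored I D X S =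
     snd (hd (filter (\<lambda>e. snd e \<notin> X) (dfs_sequence I D S)))"

section \<open>Divide and Explore\<close>

text \<open>
  Step (1). Children are taken within \<open>S\<close>, and \<open>S\<close> is replaced by its part below the new root
  vertex. Once the root vertex has moved this part is the full subtree below the new root vertex;
  if it has not moved, \<open>S\<close> is kept, which keeps the subtrees edge-disjoint.
\<close>

definition descend_cond :: "'v exploration \<Rightarrow> 'v set \<Rightarrow> 'v set \<Rightarrow> 'v \<Rightarrow> bool" where
  "descend_cond I X S v \<longleftrightarrow>
     (\<exists>!c. c \<in> set (children I L S v) \<and> \<not> complete_below I X S c) \<and>
     set (children I L S v) \<subseteq> X"

definition descend :: "'v exploration \<Rightarrow> 'v set \<Rightarrow> 'v set \<Rightarrow> 'v" where
  "descend I X S =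
     while (descend_cond I X S)
       (\<lambda>v. THE c. c \<in> set (children I L S v) \<and> \<not> complete_below I X S c)
       (top_of I S)"

definition shrink :: "'v exploration \<Rightarrow> 'v set \<Rightarrow> 'v set \<Rightarrow> 'v set" where
  "shrink I X S = (if S \<subseteq> X then S else S \<inter> below I (descend I X S))"

text \<open>
  A state consists of the number of unused agents, the current set of subtrees and the
  explored vertices.
\<close>

type_synonym 'v state = "nat \<times> 'v set set \<times> 'v set"

text \<open>
  Several subtrees may attain the minimum in step (2). Ties are broken by an arbitrary rule,
  which may depend on the whole state.
\<close>

type_synonym 'v tie_rule = "'v state \<Rightarrow> 'v set set \<Rightarrow> 'v set"

definition tie_breaking :: "'v tie_rule \<Rightarrow> bool" where
  "tie_breaking pick \<longleftrightarrow> (\<forall>s C. C \<noteq> {} \<longrightarrow> pick s C \<in> C)"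

definition candidates :: "'v exploration \<Rightarrow> 'v set set \<Rightarrow> 'v set \<Rightarrow> 'v set set" where
  "candidates I \<T> X =
     {S \<in> \<T>. \<not> S \<subseteq> X \<and>
        (\<forall>S'\<in>\<T>. \<not> S' \<subseteq> X \<longrightarrow> depth I (top_of I S) \<le> depth I (top_of I S'))}"

text \<open>
  Sends an unused agent on a search, or has no effect if no agent is left. The latter occurs
  for the second agent of the divide step if only one unused agent remains, and in the first two
  searches if there are fewer than two agents.
\<close>

fun send :: "'v exploration \<Rightarrow> direction \<Rightarrow> 'v set \<Rightarrow> 'v \<Rightarrow> 'v state \<Rightarrow> 'v state" where
  "send I D S u (0, \<T>, X) = (0, \<T>, X)"
| "send I D S u (Suc n, \<T>, X) = (n, \<T>, X \<union> set (dfs_agent I D S u X))"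

definition close_enough :: "'v exploration \<Rightarrow> 'v set \<Rightarrow> 'v \<Rightarrow> bool" where
  "close_enough I S v \<longleftrightarrow>
     real (depth I v) - real (depth I (top_of I S))
       \<le> max 1 ((real (budget I) - real (depth I (top_of I S))) / 3)"

fun explore_step :: "'v exploration \<Rightarrow> 'v tie_rule \<Rightarrow> 'v state \<Rightarrow> 'v state" where
  "explore_step I pick (n, \<T>, X) =
     (let \<T>' = shrink I X ` \<T>;
          S = pick (n, \<T>', X) (candidates I \<T>' X);
          rS = top_of I S;
          vL = outermost_unexplored I L X S;
          vR = outermost_unexplored I R X S
      in if close_enough I S vL then send I L S vL (n, \<T>', X)
         else if close_enough I S vR then send I R S vR (n, \<T>', X)
         else let v = (THE c. c \<in> set (children I L S rS) \<and> vR \<in> below I c);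
                  S1 = S - below I v;
                  S2 = insert rS (S \<inter> below I v)
              in send I L S2 rS (send I R S1 rS (n, (\<T>' - {S}) \<union> {S1, S2}, X)))"

definition divide_explore :: "'v exploration \<Rightarrow> 'v tie_rule \<Rightarrow> 'v set" where
  "divide_explore I pick =
     (case while (\<lambda>(n, \<T>, X). \<not> verts I \<subseteq> X \<and> n > 0) (explore_step I pick)
             (send I R (verts I) (root I)
               (send I L (verts I) (root I) (agents I, {verts I}, {})))
      of (n, \<T>, X) \<Rightarrow> X)"

end

theory Submission
  imports Defs "HOL-Library.List_Lexorder" "HOL-Library.Sublist"
begin

text \<open>
  Let \<open>d\<^sub>j\<close> be the depth of the top of the subtree that the \<open>j\<close>-th agent is sent to; these depths
  do not decrease. Both \<open>|Opt| \<le> 1 + \<Sum>\<^sub>j (B - d\<^sub>j) + \<Sum>\<^sub>h a\<^sub>h\<close> and \<open>3 |Alg| \<ge> 3 + \<Sum>\<^sub>j (B - d\<^sub>j) + \<Sum>\<^sub>h a\<^sub>h\<close>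
  hold unless the algorithm explores the whole tree, where \<open>a\<^sub>h\<close> counts the unfinished subtrees
  at the time when all their tops have reached depth \<open>h\<close>.

  For the lower bound, let \<open>\<delta>(S)\<close> be the distance between the parents of the leftmost and of the
  rightmost unexplored vertex of \<open>S\<close>. Every move of an L-DFS either discovers a vertex or
  approaches the parent of the rightmost unexplored vertex (symmetrically for R-DFS), so an agent
  that explores with energy \<open>e\<close> discovers at least \<open>(e + \<delta>(S') - \<delta>(S)) / 2\<close> vertices, where \<open>S'\<close> is
  \<open>S\<close> after the search, unless it finishes \<open>S\<close>. Hence the potential \<open>\<Sum>\<^sub>S ((B - d) / 3 + \<delta>(S) / 2)\<close>
  over the unfinished subtrees, with \<open>d\<close> the current minimum depth of a top, pays for the agents.

  For the upper bound, a walk that leaves the set of vertices that were explored when the minimum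
  depth reached \<open>h\<close> passes one of the \<open>a\<^sub>h\<close> ancestors at depth \<open>h\<close> of the tops. Let \<open>h\<close> be maximal such
  that at most as many walks leave that set as agents are sent off later. The set has at most
  \<open>1 + \<Sum> (B - d\<^sub>j)\<close> elements, summed over the earlier agents, and the walks that leave it take the
  place of the later agents.
\<close>

text \<open>The constants come from the threshold in step (2). A close target leaves at least two
  thirds of the energy \<open>E = B - d\<close>, so a search discovers \<open>E / 3\<close> vertices
  up to half the change of \<open>\<delta>\<close>: the share of one agent. In a divide step both
  agents start at the top with energy \<open>E\<close>. Each discovers \<open>E / 2\<close> instead,
  and the two surpluses \<open>E / 6\<close> pay the term \<open>E / 3\<close> of the additional
  subtree. If a new subtree is finished at once, its agent may discover little; in exchange the part
  of \<open>\<delta>\<close> from the top towards its outermost target, more than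
  \<open>E / 3 - 1\<close>, is released.

  Distances are taken between parents of unexplored vertices because an unexplored vertex may be out
  of reach for the budget, whereas its parent is explored. Within a search the outermost unexplored
  vertices move, so the distance of the agent to a fixed anchor is followed and compared with
  \<open>\<delta>\<close> only at the end.

  Both traversals are encoded as lexicographic orders of label sequences. Subtrees are intervals
  there, and vertices without an ancestor relation are compared oppositely in the two orders; most
  geometric steps use one of these facts.\<close>

section \<open>Lexicographic order of lists and a summation identity\<close>

lemma list_le_prefix_convex:
  fixes c :: "'a :: linorder list"
  assumes "prefix c a" "prefix c b" "a \<le> m" "m \<le> b"
  shows "prefix c m"
  using assms
proof (induction c arbitrary: a b m)
  case (Cons x c)
  obtain a' where a: "a = x # a'" "prefix c a'"
    using Cons.prems(1) by (cases a) auto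
  obtain b' where b: "b = x # b'" "prefix c b'"
    using Cons.prems(2) by (cases b) auto
  obtain y m' where m: "m = y # m'"
    using Cons.prems(3) a by (cases m) auto
  have "y = x" "a' \<le> m'" "m' \<le> b'"
    using Cons.prems(3,4) unfolding a b m by auto
  then show ?case
    using Cons.IH[OF a(2) b(2)] m by simp
qed simp

text \<open>Negating the entries reverses the comparison at the first position where the lists
  differ, so there is no such position before one of them ends; the one that ends first is
  \<open>a\<close>.\<close>

lemma list_le_both_prefix:
  fixes a b :: "'a :: {linordered_ab_group_add} list"
  assumes "a \<le> b" "map uminus a \<le> map uminus b"
  shows "prefix a b"
  using assms
proof (induction a arbitrary: b)
  case (Cons x a)
  obtain y b' where b: "b = y # b'"
    using Cons.prems(1) by (cases b) auto
  have "y = x" "a \<le> b'" "map uminus a \<le> map uminus b'"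
    using Cons.prems unfolding b by auto
  then show ?case
    using Cons.IH b by simp
qed simp

lemma prefix_imp_le: "prefix a b \<Longrightarrow> a \<le> (b :: 'a :: linorder list)"
proof (induction a arbitrary: b)
  case (Cons x a)
  obtain b' where "b = x # b'" "prefix a b'"
    using Cons.prems by (cases b) auto
  then show ?case
    using Cons.IH by simp
qed simp

lemma hd_filter_sorted:
  assumes "sorted_wrt Q xs" "w \<in> set xs" "P w" "\<And>c. c \<in> set xs \<Longrightarrow> Q c w \<Longrightarrow> \<not> P c"
  shows "hd (filter P xs) = w"
  using assms
proof (induction xs)
  case (Cons x xs)
  show ?case
  proof (cases "x = w")
    case True
    then show ?thesis
      using Cons.prems by simp
  next
    case False
    then have "w \<in> set xs" "\<not> P x"
      using Cons.prems by auto
    then show ?thesis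
      using Cons by simp
  qed
qed simp

text \<open>An entry \<open>d \<ge> h0\<close> is counted once for each level of
  \<open>{h0<..d}\<close> in the third sum, so its total is
  \<open>(B - d) + h0 + (d - h0) = B\<close>.\<close>

lemma sum_list_tail_depths:
  fixes B g h0 :: nat
  assumes "\<And>d. d \<in> set ds \<Longrightarrow> d \<le> g" "g \<le> B"
  shows "(\<Sum>d\<leftarrow>filter (\<lambda>d. h0 \<le> d) ds. B - d) + length (filter (\<lambda>d. h0 \<le> d) ds) * h0 +
      (\<Sum>h\<in>{h0<..g}. length (filter (\<lambda>d. h \<le> d) ds)) = length (filter (\<lambda>d. h0 \<le> d) ds) * B"
  using assms(1)
proof (induction ds)
  case (Cons d ds)
  have "d \<le> g"
    using Cons.prems by simp
  then have d: "d \<le> g" "d \<le> B"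
    using assms(2) by auto
  have "(\<Sum>h\<in>{h0<..g}. length (filter (\<lambda>d. h \<le> d) (d # ds))) =
      (\<Sum>h\<in>{h0<..g}. (if h \<le> d then 1 else 0) + length (filter (\<lambda>d. h \<le> d) ds))"
    by (intro sum.cong) auto
  also have "\<dots> = card ({h0<..g} \<inter> {h. h \<le> d}) + (\<Sum>h\<in>{h0<..g}. length (filter (\<lambda>d. h \<le> d) ds))"
    by (simp add: sum.distrib sum.If_cases)
  also have "{h0<..g} \<inter> {h. h \<le> d} = {h0<..d}"
    using d by auto
  finally have *: "(\<Sum>h\<in>{h0<..g}. length (filter (\<lambda>d. h \<le> d) (d # ds))) =
      (d - h0) + (\<Sum>h\<in>{h0<..g}. length (filter (\<lambda>d. h \<le> d) ds))"
    by simp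
  have IH: "(\<Sum>d\<leftarrow>filter (\<lambda>d. h0 \<le> d) ds. B - d) + length (filter (\<lambda>d. h0 \<le> d) ds) * h0 +
      (\<Sum>h\<in>{h0<..g}. length (filter (\<lambda>d. h \<le> d) ds)) = length (filter (\<lambda>d. h0 \<le> d) ds) * B"
    using Cons by simp
  show ?case
    unfolding * using IH d by (cases "h0 \<le> d") (simp_all add: algebra_simps)
qed simp

section \<open>Paths, ancestors and depth-first orders\<close>

locale exploration_tree =
  fixes I :: "'v exploration"
  assumes inst: "exploration_instance I"
begin

abbreviation ancestors :: "'v \<Rightarrow> 'v set" where
  "ancestors v \<equiv> set (path_to I v)"

definition parent :: "'v \<Rightarrow> 'v" where
  "parent v = last (butlast (path_to I v))"

lemma tree: "finite_tree I"
  using inst by (simp add: exploration_instance_def)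

lemma finite_verts [simp]: "finite (verts I)"
  using tree by (simp add: finite_tree_def)

lemma root_in_verts [simp]: "root I \<in> verts I"
  using inst by (simp add: exploration_instance_def)

lemma edgeD:
  assumes "{u, v} \<in> edges I"
  shows "u \<in> verts I" "v \<in> verts I" "u \<noteq> v"
proof -
  obtain a b where "a \<in> verts I" "b \<in> verts I" "a \<noteq> b" "{u, v} = {a, b}"
    using assms tree unfolding finite_tree_def by meson
  then show "u \<in> verts I" "v \<in> verts I" "u \<noteq> v"
    by (auto simp: doubleton_eq_iff)
qed

lemma simple_path_ex1: "u \<in> verts I \<Longrightarrow> v \<in> verts I \<Longrightarrow> \<exists>!p. simple_path I u v p"
  using tree by (auto simp: finite_tree_def)

lemma simple_path_unique:
  assumes "simple_path I u v p" "simple_path I u v q"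
  shows "p = q"
proof -
  have "u \<in> verts I" "v \<in> verts I"
    using assms(1) list.set_sel(1)[of p] last_in_set[of p] by (auto simp: simple_path_def walk_def)
  then show ?thesis
    using simple_path_ex1 assms by blast
qed

lemma simple_path_path_to: "v \<in> verts I \<Longrightarrow> simple_path I (root I) v (path_to I v)"
  unfolding path_to_def by (rule theI') (simp add: simple_path_ex1)

lemma path_to_eqI: "simple_path I (root I) v p \<Longrightarrow> path_to I v = p"
  unfolding path_to_def using simple_path_unique by blast

lemma path_to_props:
  assumes "v \<in> verts I"
  shows "path_to I v \<noteq> []" "ancestors v \<subseteq> verts I" "distinct (path_to I v)"
    "hd (path_to I v) = root I" "last (path_to I v) = v"
    "successively (\<lambda>v w. {v, w} \<in> edges I) (path_to I v)"
  using simple_path_path_to[OF assms] by (auto simp: simple_path_def walk_def)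

lemma path_to_prefix:
  assumes "v \<in> verts I" "path_to I v = xs @ u # ys"
  shows "path_to I u = xs @ [u]"
proof (rule path_to_eqI)
  show "simple_path I (root I) u (xs @ [u])"
    using path_to_props[OF assms(1)] unfolding assms(2) simple_path_def walk_def
    by (auto simp: successively_append_iff hd_append split: if_splits)
qed

lemma path_to_root: "path_to I (root I) = [root I]"
  by (rule path_to_eqI) (simp add: simple_path_def walk_def)

text \<open>If the path to \<open>u\<close> avoids \<open>v\<close>, it can be prolonged by
  \<open>v\<close>. Otherwise its final piece from \<open>v\<close> to \<open>u\<close> and the edge
  itself are simple paths with the same ends, hence equal.\<close>

lemma path_to_edge:
  assumes "{u, v} \<in> edges I"
  shows "path_to I v = path_to I u @ [v] \<or> path_to I u = path_to I v @ [u]"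
proof (cases "v \<in> ancestors u")
  case False
  have "simple_path I (root I) v (path_to I u @ [v])"
    using path_to_props[of u] edgeD[OF assms] False assms
    by (auto simp: simple_path_def walk_def successively_append_iff)
  then show ?thesis
    using path_to_eqI by blast
next
  case True
  then obtain xs ys where *: "path_to I u = xs @ v # ys"
    by (meson split_list)
  have u: "u \<in> verts I" "v \<in> verts I" "u \<noteq> v"
    using edgeD[OF assms] by auto
  have "simple_path I v u (v # ys)"
    using path_to_props[OF u(1)] unfolding * simple_path_def walk_def
    by (auto simp: successively_append_iff)
  moreover have "simple_path I v u [v, u]"
    using u assms by (auto simp: simple_path_def walk_def insert_commute)
  ultimately have "v # ys = [v, u]"
    by (rule simple_path_unique)
  then show ?thesis
    using * path_to_prefix[OF u(1) *] by simp
qed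

lemma parent_props:
  assumes "v \<in> verts I" "v \<noteq> root I"
  shows "path_to I v = path_to I (parent v) @ [v]" "parent v \<in> verts I" "{parent v, v} \<in> edges I"
proof -
  note p = path_to_props[OF assms(1)]
  obtain ys where ys: "path_to I v = ys @ [v]"
    using p by (metis append_butlast_last_id)
  have "ys \<noteq> []"
    using p assms(2) ys by auto
  then obtain zs where zs: "ys = zs @ [parent v]"
    unfolding parent_def ys by (metis append_butlast_last_id butlast_snoc)
  have pv: "path_to I v = zs @ parent v # [v]"
    using ys zs by simp
  show "path_to I v = path_to I (parent v) @ [v]"
    using path_to_prefix[OF assms(1) pv] pv by simp
  show "parent v \<in> verts I"
    using p(2) pv by auto
  show "{parent v, v} \<in> edges I"
    using p(6) pv by (simp add: successively_append_iff)
qed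

lemma parent_eqI:
  assumes "path_to I v = path_to I u @ [v]" "u \<in> verts I"
  shows "parent v = u"
  using assms path_to_props[OF assms(2)] unfolding parent_def by simp

lemma self_ancestor [simp]: "v \<in> verts I \<Longrightarrow> v \<in> ancestors v"
  using path_to_props by (metis last_in_set)

lemma ancestor_vertsD: "u \<in> ancestors v \<Longrightarrow> v \<in> verts I \<Longrightarrow> u \<in> verts I"
  using path_to_props by blast

lemma root_ancestor: "v \<in> verts I \<Longrightarrow> root I \<in> ancestors v"
  using path_to_props by (metis hd_in_set)

lemma card_ancestors: "v \<in> verts I \<Longrightarrow> card (ancestors v) = Suc (depth I v)"
  using path_to_props[of v] by (simp add: distinct_card depth_def)

lemma length_path_to: "v \<in> verts I \<Longrightarrow> length (path_to I v) = Suc (depth I v)"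
  using path_to_props[of v] by (simp add: depth_def)

lemma ancestors_root [simp]: "ancestors (root I) = {root I}"
  by (simp add: path_to_root)

lemma depth_root [simp]: "depth I (root I) = 0"
  by (simp add: depth_def path_to_root)

lemma ancestors_parent:
  assumes "v \<in> verts I" "v \<noteq> root I"
  shows "ancestors v = insert v (ancestors (parent v))" "v \<notin> ancestors (parent v)"
    "depth I v = Suc (depth I (parent v))"
  using parent_props[OF assms] path_to_props(3)[OF assms(1)]
    length_path_to[OF assms(1)] length_path_to[of "parent v"] by auto

lemma ancestors_trans:
  assumes "v \<in> verts I" "u \<in> ancestors v" shows "ancestors u \<subseteq> ancestors v"
proof -
  obtain xs ys where *: "path_to I v = xs @ u # ys"
    using assms by (meson split_list)
  show ?thesis
    using path_to_prefix[OF assms(1) *] * by auto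
qed

lemma ancestor_depth:
  assumes "v \<in> verts I" "u \<in> ancestors v"
  shows "depth I u \<le> depth I v" "depth I u = depth I v \<Longrightarrow> u = v"
proof -
  have u: "u \<in> verts I"
    using assms ancestor_vertsD by blast
  have sub: "ancestors u \<subseteq> ancestors v"
    using ancestors_trans assms by blast
  show "depth I u \<le> depth I v"
    using card_mono[OF _ sub] card_ancestors u assms(1) by simp
  assume "depth I u = depth I v"
  then have "ancestors u = ancestors v"
    using sub card_ancestors u assms(1) by (simp add: card_subset_eq)
  then have "v \<in> ancestors u"
    using assms(1) by simp
  then obtain xs ys where *: "path_to I u = xs @ v # ys"
    by (meson split_list)
  have "ys = []"
    using path_to_prefix[OF u *] * length_path_to[OF u] length_path_to[OF assms(1)]
      \<open>depth I u = depth I v\<close> by auto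
  then show "u = v"
    using * path_to_props(5)[OF u] by simp
qed

lemma ancestor_antisym: "u \<in> verts I \<Longrightarrow> v \<in> verts I \<Longrightarrow> u \<in> ancestors v \<Longrightarrow> v \<in> ancestors u \<Longrightarrow> u = v"
  using ancestor_depth by (metis dual_order.antisym)

lemma parent_ancestor: "v \<in> verts I \<Longrightarrow> v \<noteq> root I \<Longrightarrow> parent v \<in> ancestors v"
  using ancestors_parent parent_props by auto

lemma path_to_nth:
  assumes "v \<in> verts I" "i < length (path_to I v)"
  shows "path_to I (path_to I v ! i) = take (Suc i) (path_to I v)" "depth I (path_to I v ! i) = i"
proof -
  have *: "path_to I v = take i (path_to I v) @ (path_to I v ! i) # drop (Suc i) (path_to I v)"
    using assms(2) by (simp add: id_take_nth_drop)
  show "path_to I (path_to I v ! i) = take (Suc i) (path_to I v)"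
    using path_to_prefix[OF assms(1) *] assms(2) by (simp add: take_Suc_conv_app_nth)
  then show "depth I (path_to I v ! i) = i"
    using assms(2) by (simp add: depth_def)
qed

lemma ancestor_at_depth:
  assumes "v \<in> verts I" "h \<le> depth I v"
  obtains a where "a \<in> ancestors v" "depth I a = h"
  using path_to_nth[OF assms(1), of h] assms length_path_to[OF assms(1)]
  by (metis le_imp_less_Suc nth_mem)

lemma ancestor_at_depth_unique:
  assumes "v \<in> verts I" "a \<in> ancestors v" "b \<in> ancestors v" "depth I a = depth I b"
  shows "a = b"
  using path_to_nth(2)[OF assms(1)] assms by (metis in_set_conv_nth)

lemma ancestors_linear:
  assumes "v \<in> verts I" "a \<in> ancestors v" "b \<in> ancestors v" "depth I a \<le> depth I b"
  shows "a \<in> ancestors b"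
proof -
  obtain i where i: "i < length (path_to I v)" "a = path_to I v ! i"
    using assms by (metis in_set_conv_nth)
  obtain j where j: "j < length (path_to I v)" "b = path_to I v ! j"
    using assms by (metis in_set_conv_nth)
  have "i \<le> j"
    using assms(4) i j path_to_nth(2)[OF assms(1)] by auto
  then have "path_to I v ! i \<in> set (take (Suc j) (path_to I v))"
    using i j by (metis in_set_conv_nth le_imp_less_Suc length_take min_less_iff_conj nth_take)
  then show ?thesis
    using path_to_nth(1)[OF assms(1) j(1)] i j by simp
qed

section \<open>Ports, labels and children\<close>

lemma nbrs_subset: "nbrs I v \<subseteq> verts I"
  using edgeD by (auto simp: nbrs_def)

lemma port_bij: "v \<in> verts I \<Longrightarrow> bij_betw (port I v) {..<deg I v} (nbrs I v)"
  using inst by (simp add: exploration_instance_def)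

lemma port_0:
  assumes "v \<in> verts I" "v \<noteq> root I"
  shows "port I v 0 = parent v"
proof -
  have "parent v \<in> nbrs I v"
    using parent_props[OF assms] by (simp add: nbrs_def insert_commute)
  then have "deg I v > 0"
    unfolding deg_def using finite_subset[OF nbrs_subset] by (auto simp: card_gt_0_iff)
  then have "port I v 0 \<in> nbrs I v"
    using port_bij[OF assms(1)] by (auto simp: bij_betw_def)
  then have e: "{v, port I v 0} \<in> edges I"
    by (simp add: nbrs_def)
  have "depth I (port I v 0) < depth I v"
    using inst assms by (auto simp: exploration_instance_def)
  then have "path_to I v = path_to I (port I v 0) @ [v]"
    using path_to_edge[OF e] by (auto simp: depth_def)
  then show ?thesis
    using parent_eqI edgeD[OF e] by metis
qed

text \<open>The label of the edge above \<open>c\<close>, read at the parent. The root has no such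
  edge, which is why \<open>key\<close> drops the head of the path.\<close>

definition label :: "'v \<Rightarrow> nat" where
  "label c = inv_into {..<deg I (parent c)} (port I (parent c)) c"

lemma label:
  assumes "c \<in> verts I" "c \<noteq> root I"
  shows "label c < deg I (parent c)" "port I (parent c) (label c) = c"
proof -
  have "c \<in> nbrs I (parent c)"
    using parent_props[OF assms] by (simp add: nbrs_def)
  then have c: "c \<in> port I (parent c) ` {..<deg I (parent c)}"
    using port_bij[OF parent_props(2)[OF assms]] by (simp add: bij_betw_def)
  show "label c < deg I (parent c)" "port I (parent c) (label c) = c"
    unfolding label_def using inv_into_into[OF c] f_inv_into_f[OF c] by auto
qed

lemma child_iff:
  assumes "v \<in> verts I"
  shows "w \<in> nbrs I v \<and> depth I v < depth I w \<longleftrightarrow> w \<in> verts I \<and> w \<noteq> root I \<and> parent w = v"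
proof
  assume *: "w \<in> nbrs I v \<and> depth I v < depth I w"
  then have e: "{v, w} \<in> edges I"
    by (simp add: nbrs_def)
  have "path_to I w = path_to I v @ [w]"
    using path_to_edge[OF e] * by (auto simp: depth_def)
  then show "w \<in> verts I \<and> w \<noteq> root I \<and> parent w = v"
    using parent_eqI assms edgeD[OF e] * by auto
next
  assume "w \<in> verts I \<and> w \<noteq> root I \<and> parent w = v"
  then show "w \<in> nbrs I v \<and> depth I v < depth I w"
    using parent_props[of w] ancestors_parent[of w] by (auto simp: nbrs_def)
qed

lemma set_children:
  assumes "v \<in> verts I" "S \<subseteq> verts I"
  shows "set (children I D S v) = {c \<in> S. c \<noteq> root I \<and> parent c = v}"
proof -
  have "port I v ` {0..<deg I v} = nbrs I v"
    using port_bij[OF assms(1)] by (simp add: bij_betw_def atLeast0LessThan)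
  then have "set (children I D S v) = {c \<in> nbrs I v. c \<in> S \<and> depth I v < depth I c}"
    by (auto simp: children_def Let_def split: direction.splits)
  then show ?thesis
    using child_iff[OF assms(1)] assms(2) by blast
qed

section \<open>Preorder keys\<close>

text \<open>Negation turns "largest label first" into "smallest first", so that one lexicographic
  order serves both traversals.\<close>

fun orient :: "direction \<Rightarrow> nat \<Rightarrow> int" where
  "orient L l = int l"
| "orient R l = - int l"

text \<open>
  Comparing keys lexicographically is comparing vertices in the preorder of the L-DFS or
  R-DFS: a proper ancestor has a shorter prefix as its key and therefore comes first.
\<close>

definition key :: "direction \<Rightarrow> 'v \<Rightarrow> int list" where
  "key D v = map (\<lambda>u. orient D (label u)) (tl (path_to I v))"

lemma key_root [simp]: "key D (root I) = []"
  by (simp add: key_def path_to_root)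

lemma key_parent:
  assumes "v \<in> verts I" "v \<noteq> root I"
  shows "key D v = key D (parent v) @ [orient D (label v)]"
  using parent_props[OF assms] path_to_props(1)[OF parent_props(2)[OF assms]]
  by (simp add: key_def)

lemma length_key: "v \<in> verts I \<Longrightarrow> length (key D v) = depth I v"
  by (simp add: key_def length_path_to)

lemma orient_inj: "orient D a = orient D b \<longleftrightarrow> a = b"
  by (cases D) auto

text \<open>Keys of equal length belong to vertices of equal depth; dropping the last entry passes
  to the parents, and siblings are told apart by their labels.\<close>

lemma key_inj:
  assumes "u \<in> verts I" "v \<in> verts I" "key D u = key D v"
  shows "u = v"
  using assms
proof (induction "depth I u" arbitrary: u v)
  case 0
  then have "depth I v = 0"
    by (metis length_key)
  then have "u = root I" "v = root I"
    using 0 ancestors_parent(3)[of u] ancestors_parent(3)[of v] by fastforce+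
  then show ?case
    by simp
next
  case (Suc n)
  then have v: "depth I v = Suc n"
    by (metis length_key)
  have nr: "u \<noteq> root I" "v \<noteq> root I"
    using Suc.hyps(2) v by auto
  then have "key D (parent u) = key D (parent v)" "label u = label v"
    using Suc.prems(3) key_parent[OF Suc.prems(1) nr(1)] key_parent[OF Suc.prems(2) nr(2)]
    by (simp_all add: orient_inj)
  moreover have "n = depth I (parent u)"
    using ancestors_parent(3)[of u] Suc.prems Suc.hyps(2) nr by simp
  ultimately have "parent u = parent v"
    by (intro Suc.hyps(1)) (use Suc.prems nr parent_props(2) in auto)
  then show ?case
    using label(2)[OF Suc.prems(1) nr(1)] label(2)[OF Suc.prems(2) nr(2)] \<open>label u = label v\<close>
    by metis
qed

text \<open>For the direction from prefixes to ancestors: the ancestor of \<open>v\<close> at the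
  depth of \<open>u\<close> also has a prefix of \<open>key D v\<close> as its key, of the same
  length, and \<open>key_inj\<close> identifies it with \<open>u\<close>.\<close>

lemma key_prefix_iff:
  assumes "u \<in> verts I" "v \<in> verts I"
  shows "prefix (key D u) (key D v) \<longleftrightarrow> u \<in> ancestors v"
proof
  assume "u \<in> ancestors v"
  then obtain xs ys where *: "path_to I v = xs @ u # ys"
    by (meson split_list)
  then show "prefix (key D u) (key D v)"
    using path_to_prefix[OF assms(2) *]
    by (cases xs) (auto simp: key_def prefix_def)
next
  assume p: "prefix (key D u) (key D v)"
  then have "depth I u \<le> depth I v"
    using prefix_length_le length_key assms by metis
  then obtain a where a: "a \<in> ancestors v" "depth I a = depth I u"
    using ancestor_at_depth assms by metis
  then obtain xs ys where *: "path_to I v = xs @ a # ys"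
    by (meson split_list)
  have av: "a \<in> verts I"
    using a assms ancestor_vertsD by blast
  have "prefix (key D a) (key D v)"
    using path_to_prefix[OF assms(2) *] *
    by (cases xs) (auto simp: key_def prefix_def)
  moreover have "length (key D a) = length (key D u)"
    using a(2) length_key[OF av] length_key[OF assms(1)] by simp
  ultimately have "key D a = key D u"
    using p prefix_length_prefix prefix_order.antisym by (metis order_refl)
  then show "u \<in> ancestors v"
    using key_inj[OF av assms(1), of D] a(1) by simp
qed

lemma key_mono: "v \<in> verts I \<Longrightarrow> u \<in> ancestors v \<Longrightarrow> key D u \<le> key D v"
  by (intro prefix_imp_le) (simp add: key_prefix_iff[OF ancestor_vertsD])

text \<open>The vertices below \<open>c\<close> form an interval of the preorder, since their keys
  are those that begin with the key of \<open>c\<close>.\<close>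

lemma key_convex:
  assumes "a \<in> verts I" "b \<in> verts I" "m \<in> verts I" "c \<in> ancestors a" "c \<in> ancestors b"
    "key D a \<le> key D m" "key D m \<le> key D b"
  shows "c \<in> ancestors m"
proof -
  have c: "c \<in> verts I"
    using ancestor_vertsD assms by blast
  show ?thesis
    using list_le_prefix_convex[of "key D c" "key D a" "key D b" "key D m"] assms
    by (simp add: key_prefix_iff[OF c])
qed

fun opposite :: "direction \<Rightarrow> direction" where
  "opposite L = R"
| "opposite R = L"

lemma key_opposite: "key (opposite D) v = map uminus (key D v)"
  by (cases D) (auto simp: key_def)

text \<open>Vertices without an ancestor relation branch at some label, and the two traversals take
  the branches in opposite orders.\<close>

lemma key_both_le:
  assumes "u \<in> verts I" "v \<in> verts I" "key D u \<le> key D v" "key (opposite D) u \<le> key (opposite D) v"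
  shows "u \<in> ancestors v"
  using list_le_both_prefix[of "key D u" "key D v"] assms
  by (simp add: key_prefix_iff key_opposite)

lemma children_sorted:
  assumes "v \<in> verts I" "S \<subseteq> verts I"
  shows "sorted_wrt (\<lambda>a b. key D a < key D b) (children I D S v)"
proof -
  have lab: "label (port I v i) = i" if "i < deg I v" "depth I v < depth I (port I v i)" for i
  proof -
    have "port I v i \<in> nbrs I v"
      using port_bij[OF assms(1)] that by (auto simp: bij_betw_def)
    then have *: "port I v i \<in> verts I" "port I v i \<noteq> root I" "parent (port I v i) = v"
      using child_iff[OF assms(1)] that by blast+
    show ?thesis
      using label[OF *(1,2)] * port_bij[OF assms(1)] that
      by (auto simp: bij_betw_def inj_on_def)
  qed
  let ?P = "\<lambda>w. w \<in> S \<and> depth I v < depth I w"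
  have key: "key D (port I v i) = key D v @ [orient D i]"
    if "i < deg I v" "depth I v < depth I (port I v i)" for i D
  proof -
    have "port I v i \<in> nbrs I v"
      using port_bij[OF assms(1)] that by (auto simp: bij_betw_def)
    then have *: "port I v i \<in> verts I" "port I v i \<noteq> root I" "parent (port I v i) = v"
      using child_iff[OF assms(1)] that by blast+
    show ?thesis
      using key_parent[OF *(1,2)] * lab[OF that] by simp
  qed
  have less: "xs @ [a] < xs @ [b] \<longleftrightarrow> a < b" for a b and xs :: "int list"
    by (induction xs) auto
  have L: "sorted_wrt (\<lambda>a b. key L a < key L b) (filter ?P (map (port I v) [0..<deg I v]))"
    and R: "sorted_wrt (\<lambda>a b. key R b < key R a) (filter ?P (map (port I v) [0..<deg I v]))"
    unfolding filter_map sorted_wrt_map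
    by (rule sorted_wrt_mono_rel[of _ "(<)"];
        auto simp: key less intro: sorted_wrt_filter sorted_wrt_upt)+
  show ?thesis
    using L R by (cases D) (auto simp: children_def sorted_wrt_rev)
qed

section \<open>A single search\<close>

text \<open>The distance in the tree: its path consists of the edges above the unshared ancestors.\<close>

definition tdist :: "'v \<Rightarrow> 'v \<Rightarrow> nat" where
  "tdist u v = card ((ancestors u - ancestors v) \<union> (ancestors v - ancestors u))"

text \<open>For the unexplored part of a subtree this is the vertex that the algorithm reads off its
  traversal sequence, as lemma \<open>outermost_unexplored\<close> shows.\<close>

definition front :: "direction \<Rightarrow> 'v set \<Rightarrow> 'v" where
  "front D U = (THE m. m \<in> U \<and> (\<forall>u\<in>U. key D m \<le> key D u))"

definition gap :: "'v set \<Rightarrow> nat" where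
  "gap U = tdist (parent (front L U)) (parent (front R U))"

text \<open>A connected set with topmost vertex \<open>t\<close>, expressed through ancestors
  instead of walks: on the way from \<open>t\<close> down to a member no vertex is missing.\<close>

definition subtree :: "'v set \<Rightarrow> 'v \<Rightarrow> bool" where
  "subtree S t \<longleftrightarrow> S \<subseteq> verts I \<and> t \<in> S \<and>
     (\<forall>x\<in>S. t \<in> ancestors x \<and> (\<forall>y\<in>ancestors x. t \<in> ancestors y \<longrightarrow> y \<in> S))"

lemma tdist_sym: "tdist u v = tdist v u"
  by (simp add: tdist_def Un_commute)

text \<open>The premises say that \<open>w\<close> is a child of \<open>x\<close>. Crossing the edge
  between them changes the distance to \<open>z\<close> by one, and the sign depends on whether
  \<open>z\<close> lies below \<open>w\<close>.\<close>

lemma tdist_step: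
  assumes "ancestors w = insert w (ancestors x)" "w \<notin> ancestors x"
  shows "w \<in> ancestors z \<Longrightarrow> tdist x z = Suc (tdist w z)"
    "w \<notin> ancestors z \<Longrightarrow> tdist w z = Suc (tdist x z)"
proof -
  assume "w \<in> ancestors z"
  then have "(ancestors x - ancestors z) \<union> (ancestors z - ancestors x) =
      insert w ((ancestors w - ancestors z) \<union> (ancestors z - ancestors w))"
    using assms by auto
  moreover have "w \<notin> (ancestors w - ancestors z) \<union> (ancestors z - ancestors w)"
    using assms \<open>w \<in> ancestors z\<close> by simp
  ultimately show "tdist x z = Suc (tdist w z)"
    unfolding tdist_def by simp
next
  assume "w \<notin> ancestors z"
  then have "(ancestors w - ancestors z) \<union> (ancestors z - ancestors w) =
      insert w ((ancestors x - ancestors z) \<union> (ancestors z - ancestors x))"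
    using assms by auto
  then show "tdist w z = Suc (tdist x z)"
    using assms \<open>w \<notin> ancestors z\<close> by (simp add: tdist_def)
qed

lemma front_eqI:
  assumes "U \<subseteq> verts I" "m \<in> U" "\<And>u. u \<in> U \<Longrightarrow> key D m \<le> key D u"
  shows "front D U = m"
  unfolding front_def
proof (rule the_equality)
  show "m \<in> U \<and> (\<forall>u\<in>U. key D m \<le> key D u)"
    using assms by blast
next
  fix n assume n: "n \<in> U \<and> (\<forall>u\<in>U. key D n \<le> key D u)"
  then have "key D n = key D m"
    using assms by (intro antisym) auto
  then show "n = m"
    using n assms by (intro key_inj[of n m D]) auto
qed

lemma front:
  assumes "U \<subseteq> verts I" "U \<noteq> {}"
  shows "front D U \<in> U" "\<And>u. u \<in> U \<Longrightarrow> key D (front D U) \<le> key D u"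
proof -
  have fin: "finite U"
    using assms finite_subset finite_verts by blast
  have "Min (key D ` U) \<in> key D ` U"
    using fin assms by (intro Min_in) auto
  then obtain m where m: "m \<in> U" "key D m = Min (key D ` U)"
    by auto
  then have le: "key D m \<le> key D u" if "u \<in> U" for u
    using fin that by simp
  have "front D U = m"
    using front_eqI[OF assms(1) m(1) le] by simp
  then show "front D U \<in> U" "\<And>u. u \<in> U \<Longrightarrow> key D (front D U) \<le> key D u"
    using m(1) le by auto
qed

lemma last_exists:
  assumes "U \<subseteq> verts I" "U \<noteq> {}"
  obtains y where "y \<in> U" "\<And>u. u \<in> U \<Longrightarrow> key D u \<le> key D y"
proof -
  have fin: "finite U"
    using assms finite_subset finite_verts by blast
  have "Max (key D ` U) \<in> key D ` U"
    using fin assms by (intro Max_in) auto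
  then obtain m where m: "m \<in> U" "key D m = Max (key D ` U)"
    by auto
  then show thesis
    using fin by (intro that[of m]) auto
qed

lemma child_toward:
  assumes "m \<in> verts I" "x \<in> ancestors m" "x \<noteq> m"
  obtains c where "c \<in> ancestors m" "c \<in> verts I" "c \<noteq> root I" "parent c = x"
proof -
  obtain xs ys where *: "path_to I m = xs @ x # ys"
    using assms(2) by (meson split_list)
  have "ys \<noteq> []"
    using * path_to_props(5)[OF assms(1)] assms(3) by auto
  then obtain c zs where ys: "ys = c # zs"
    by (cases ys) auto
  have c: "c \<in> ancestors m"
    using * ys by simp
  have pc: "path_to I c = path_to I x @ [c]"
    using path_to_prefix[OF assms(1), of "xs @ [x]" c zs] path_to_prefix[OF assms(1) *] * ys
    by simp
  have "c \<noteq> root I"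
    using pc path_to_props(1)[OF ancestor_vertsD[OF assms(2,1)]] path_to_root by auto
  then show thesis
    using that c ancestor_vertsD[OF c assms(1)] parent_eqI[OF pc ancestor_vertsD[OF assms(2,1)]]
    by blast
qed

lemma subtreeD:
  assumes "subtree S t"
  shows "S \<subseteq> verts I" "t \<in> S" "\<And>x. x \<in> S \<Longrightarrow> t \<in> ancestors x"
    "\<And>x y. x \<in> S \<Longrightarrow> y \<in> ancestors x \<Longrightarrow> t \<in> ancestors y \<Longrightarrow> y \<in> S" "t \<in> verts I"
  using assms unfolding subtree_def by blast+

lemma subtree_top:
  assumes "subtree S t"
  shows "top_of I S = t"
proof -
  have S: "S \<subseteq> verts I" "finite S" "S \<noteq> {}"
    using subtreeD[OF assms] finite_subset finite_verts by blast+
  have "top_of I S \<in> S" "\<not> (\<exists>x\<in>S. depth I x < depth I (top_of I S))"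
    unfolding top_of_def using arg_min_if_finite[OF S(2,3)] by blast+
  then have "depth I (top_of I S) \<le> depth I t" "top_of I S \<in> S"
    using subtreeD(2)[OF assms] by auto
  then show ?thesis
    using ancestor_depth[of "top_of I S" t] subtreeD[OF assms] by (metis antisym subsetD)
qed

section \<open>Moves of a depth-first search\<close>

definition next_vertex :: "direction \<Rightarrow> 'v set \<Rightarrow> 'v set \<Rightarrow> 'v \<Rightarrow> 'v" where
  "next_vertex D S X v =
     (if complete_below I X S v then port I v 0
      else hd (filter (\<lambda>c. \<not> complete_below I X S c) (children I D S v)))"

lemma dfs_steps_Suc:
  "dfs_steps I D S (Suc e) v X =
     (if S \<subseteq> X then [] else next_vertex D S X v # dfs_steps I D S e (next_vertex D S X v) (insert (next_vertex D S X v) X))"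
  by (simp add: next_vertex_def Let_def)

lemma complete_below_iff:
  "S \<subseteq> verts I \<Longrightarrow> complete_below I X S c \<longleftrightarrow> (\<forall>u\<in>S - X. c \<notin> ancestors u)"
  by (auto simp: complete_below_def below_def)

text \<open>Every unexplored vertex of \<open>S\<close> lies below \<open>t\<close>, so a vertex
  with nothing unexplored below it cannot be \<open>t\<close>. Hence a search never leaves
  \<open>S\<close> through its top, and label \<open>0\<close> is not followed upwards at the
  root.\<close>

lemma next_up:
  assumes "subtree S t" "x \<in> S" "\<not> S \<subseteq> X" "\<And>u. u \<in> S - X \<Longrightarrow> x \<notin> ancestors u"
  shows "next_vertex D S X x = parent x" "x \<noteq> t" "x \<noteq> root I" "parent x \<in> S"
proof -
  note S = subtreeD[OF assms(1)]
  obtain u where u: "u \<in> S - X"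
    using assms by blast
  show "x \<noteq> t"
    using assms(4)[OF u] S(3) u by blast
  show nr: "x \<noteq> root I"
    using assms(4)[OF u] S(1) u root_ancestor by blast
  have x: "x \<in> verts I"
    using assms S by blast
  show "next_vertex D S X x = parent x"
    using assms complete_below_iff[OF S(1)] port_0[OF x nr] by (simp add: next_vertex_def)
  have "t \<in> ancestors (parent x)"
    using S(3)[OF assms(2)] ancestors_parent[OF x nr] \<open>x \<noteq> t\<close> by auto
  then show "parent x \<in> S"
    using S(4)[OF assms(2)] parent_ancestor[OF x nr] by blast
qed

text \<open>If \<open>u\<close> were below \<open>b\<close>, then \<open>c\<close>, whose key is
  between those of \<open>b\<close> and \<open>u\<close>, would be below its sibling
  \<open>b\<close> by convexity.\<close>

lemma earlier_sibling_complete: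
  assumes V: "b \<in> verts I" "c \<in> verts I" "b \<noteq> root I" "c \<noteq> root I" "parent b = parent c"
    and m: "m \<in> verts I" "c \<in> ancestors m" "key D b < key D c"
    and u: "u \<in> verts I" "key D m \<le> key D u"
  shows "b \<notin> ancestors u"
proof
  assume bu: "b \<in> ancestors u"
  have "key D c \<le> key D u"
    using key_mono[OF m(1,2)] u(2) by (rule order_trans)
  then have "b \<in> ancestors c"
    using key_convex[OF V(1) u(1) V(2) _ bu, of D] V(1) m(3) by simp
  then have "b \<in> ancestors (parent b)"
    using m(3) ancestors_parent(1)[OF V(2,4)] V(5) by auto
  then show False
    using ancestors_parent(2)[OF V(1,3)] by simp
qed

text \<open>The first unexplored vertex lies below exactly one child of \<open>x\<close>, and the
  siblings traversed before that child have nothing left. If the child is itself unexplored, it is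
  an ancestor of the first unexplored vertex and does not come later, so the two coincide.\<close>

lemma next_down:
  assumes "subtree S t" "x \<in> S" "x \<in> X" "\<not> S \<subseteq> X" "x \<in> ancestors (front D (S - X))"
  defines "w \<equiv> next_vertex D S X x"
  shows "w \<in> ancestors (front D (S - X))" "w \<in> S" "w \<noteq> root I" "parent w = x"
    "w \<notin> X \<Longrightarrow> w = front D (S - X)"
proof -
  note S = subtreeD[OF assms(1)]
  have U: "S - X \<subseteq> verts I" "S - X \<noteq> {}"
    using S assms by auto
  define m where "m = front D (S - X)"
  have m: "m \<in> S - X" "\<And>u. u \<in> S - X \<Longrightarrow> key D m \<le> key D u"
    unfolding m_def using front[OF U] by auto
  have mV: "m \<in> verts I"
    using m S by blast
  have xm: "x \<in> ancestors m"
    using assms m_def by simp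
  obtain c where c: "c \<in> ancestors m" "c \<in> verts I" "c \<noteq> root I" "parent c = x"
    using child_toward[OF mV xm] m assms(3) by blast
  have "t \<in> ancestors c"
    using ancestors_parent(1)[OF c(2,3)] c(4) S(3)[OF assms(2)] by simp
  then have cS: "c \<in> S"
    using S(4)[of m c] m c by blast
  have xV: "x \<in> verts I"
    using S assms by blast
  have "hd (filter (\<lambda>c. \<not> complete_below I X S c) (children I D S x)) = c"
  proof (rule hd_filter_sorted[OF children_sorted[OF xV S(1)]])
    show "c \<in> set (children I D S x)"
      using set_children[OF xV S(1)] cS c by simp
    show "\<not> complete_below I X S c"
      using complete_below_iff[OF S(1)] m(1) c(1) by blast
    fix b assume b: "b \<in> set (children I D S x)" "key D b < key D c"
    then have b': "b \<in> S" "b \<noteq> root I" "parent b = x" "b \<in> verts I"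
      using set_children[OF xV S(1)] S(1) by auto
    show "\<not> \<not> complete_below I X S b"
    proof
      assume "\<not> complete_below I X S b"
      then obtain u where u: "u \<in> S - X" "b \<in> ancestors u"
        using complete_below_iff[OF S(1)] by blast
      show False
        using earlier_sibling_complete[OF b'(4) c(2) b'(2) c(3) _ mV c(1) b(2) _ m(2)[OF u(1)]]
          b'(3) c(4) u S(1) by auto
    qed
  qed
  moreover have "\<not> complete_below I X S x"
    using complete_below_iff[OF S(1)] m(1) xm by blast
  ultimately have "w = c"
    by (simp add: w_def next_vertex_def)
  then show "w \<in> ancestors (front D (S - X))" "w \<in> S" "w \<noteq> root I" "parent w = x"
    using c cS m_def by auto
  assume "w \<notin> X"
  then have "key D m \<le> key D c"
    using m(2)[of c] cS \<open>w = c\<close> by simp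
  then have "key D m = key D c"
    using key_mono[OF mV c(1), of D] by simp
  then show "w = front D (S - X)"
    using key_inj[OF mV c(2), of D] \<open>w = c\<close> m_def by simp
qed

text \<open>
  The state of an agent at \<open>x\<close> during its search. The anchor \<open>z\<close> does not change, and below it
  lies the unexplored vertex that the search will reach last. Every explored vertex that the
  search has to enter again is above \<open>z\<close>, so every move along explored edges approaches \<open>z\<close>.
\<close>

definition searching :: "direction \<Rightarrow> 'v set \<Rightarrow> 'v \<Rightarrow> 'v set \<Rightarrow> 'v \<Rightarrow> bool" where
  "searching D S z X x \<longleftrightarrow>
     x \<in> S \<and> ancestors x \<subseteq> X \<and> z \<in> verts I \<and>
     (\<forall>y\<in>ancestors x \<inter> S. \<forall>u\<in>S - X. y \<in> ancestors u \<longrightarrow> y \<in> ancestors (front D (S - X))) \<and>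
     (\<forall>c\<in>S \<inter> X. \<forall>u\<in>S - X. c \<in> ancestors u \<longrightarrow> c \<in> ancestors x \<or> c \<in> ancestors z) \<and>
     (\<forall>y\<in>S - X. (\<forall>u\<in>S - X. key D u \<le> key D y) \<longrightarrow> z \<in> ancestors y)"

lemma searchingD:
  assumes "searching D S z X x"
  shows "x \<in> S" "ancestors x \<subseteq> X" "z \<in> verts I"
    "\<And>y u. y \<in> ancestors x \<Longrightarrow> y \<in> S \<Longrightarrow> u \<in> S - X \<Longrightarrow> y \<in> ancestors u \<Longrightarrow> y \<in> ancestors (front D (S - X))"
    "\<And>c u. c \<in> S \<Longrightarrow> c \<in> X \<Longrightarrow> u \<in> S - X \<Longrightarrow> c \<in> ancestors u \<Longrightarrow> c \<in> ancestors x \<or> c \<in> ancestors z"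
    "\<And>y. y \<in> S - X \<Longrightarrow> (\<And>u. u \<in> S - X \<Longrightarrow> key D u \<le> key D y) \<Longrightarrow> z \<in> ancestors y"
  using assms unfolding searching_def by blast+

lemma searchingI:
  assumes "x \<in> S" "ancestors x \<subseteq> X" "z \<in> verts I"
    "\<And>y u. y \<in> ancestors x \<Longrightarrow> y \<in> S \<Longrightarrow> u \<in> S - X \<Longrightarrow> y \<in> ancestors u \<Longrightarrow> y \<in> ancestors (front D (S - X))"
    "\<And>c u. c \<in> S \<Longrightarrow> c \<in> X \<Longrightarrow> u \<in> S - X \<Longrightarrow> c \<in> ancestors u \<Longrightarrow> c \<in> ancestors x \<or> c \<in> ancestors z"
    "\<And>y. y \<in> S - X \<Longrightarrow> (\<And>u. u \<in> S - X \<Longrightarrow> key D u \<le> key D y) \<Longrightarrow> z \<in> ancestors y"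
  shows "searching D S z X x"
  using assms unfolding searching_def by blast

text \<open>Amortization of one move: a discovery is worth 2 and changes the distance to
  \<open>z\<close> by at most one, so the other moves must approach \<open>z\<close>. When the agent
  moves up from \<open>x\<close>, nothing unexplored is below \<open>x\<close>, whereas the last
  unexplored vertex is below \<open>z\<close>; so \<open>z\<close> is not below \<open>x\<close>.
  When it enters an explored child \<open>w\<close>, that child is above an unexplored vertex and
  not above \<open>x\<close>, so the clause on explored vertices puts it above
  \<open>z\<close>.\<close>

lemma searching_step:
  assumes S: "subtree S t" and s: "searching D S z X x" and inc: "\<not> S \<subseteq> X"
  defines "w \<equiv> next_vertex D S X x"
  shows "searching D S z (insert w X) w" (is ?A)
    and "1 + tdist w z \<le> (if w \<in> X then 0 else 2) + tdist x z" (is ?B)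
    and "w \<notin> X \<Longrightarrow> w = front D (S - X)" "depth I w \<le> Suc (depth I x)"
    and "ancestors w \<subseteq> insert w (ancestors x)"
proof -
  note S' = subtreeD[OF S] and s' = searchingD[OF s]
  have xV: "x \<in> verts I"
    using S' s' by blast
  have xX: "x \<in> X"
    using s'(2) xV by auto
  have U: "S - X \<subseteq> verts I" "S - X \<noteq> {}"
    using S' inc by auto
  define m where "m = front D (S - X)"
  have m: "m \<in> S - X" "\<And>u. u \<in> S - X \<Longrightarrow> key D m \<le> key D u"
    unfolding m_def using front[OF U] by auto
  have mV: "m \<in> verts I"
    using m U by blast
  obtain y where y: "y \<in> S - X" "\<And>u. u \<in> S - X \<Longrightarrow> key D u \<le> key D y"
    using last_exists[OF U] by blast
  have zy: "z \<in> ancestors y"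
    using s'(6)[OF y] by simp
  have yV: "y \<in> verts I"
    using y U by blast
  have "?A \<and> ?B \<and> (w \<notin> X \<longrightarrow> w = m) \<and> depth I w \<le> Suc (depth I x) \<and>
      ancestors w \<subseteq> insert w (ancestors x)"
  proof (cases "x \<in> ancestors m")
    case False
    then have comp: "x \<notin> ancestors u" if "u \<in> S - X" for u
      using s'(4)[of x u] that s'(1) xV m_def by auto
    note up = next_up(1)[OF S s'(1) inc comp, of D, folded w_def] next_up(2-4)[OF S s'(1) inc comp]
    have px: "parent x = w"
      using up(1) by simp
    note anc = ancestors_parent[OF xV up(3), unfolded px]
    have wX: "w \<in> X"
      using anc(1) s'(2) parent_ancestor[OF xV up(3)] up(1) by auto
    have "x \<notin> ancestors z"
      using comp[OF y(1)] zy ancestors_trans[OF yV zy] by blast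
    then have "tdist x z = Suc (tdist w z)"
      using tdist_step(2)[OF anc(1,2)] by simp
    moreover have "searching D S z X w"
    proof (rule searchingI)
      show "w \<in> S" "ancestors w \<subseteq> X" "z \<in> verts I"
        using up anc s' by auto
      show "v \<in> ancestors (front D (S - X))"
        if "v \<in> ancestors w" "v \<in> S" "u \<in> S - X" "v \<in> ancestors u" for v u
        using s'(4)[of v u] that anc(1) by blast
      show "c \<in> ancestors w \<or> c \<in> ancestors z"
        if "c \<in> S" "c \<in> X" "u \<in> S - X" "c \<in> ancestors u" for c u
        using s'(5)[OF that] comp[OF that(3)] that(4) anc(1) by auto
      show "z \<in> ancestors v" if "v \<in> S - X" "\<And>u. u \<in> S - X \<Longrightarrow> key D u \<le> key D v" for v
        using s'(6) that by blast
    qed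
    ultimately show ?thesis
      using wX anc by (simp add: insert_absorb subset_insertI2 le_SucI)
  next
    case True
    note down = next_down[OF S s'(1) xX inc True[unfolded m_def], folded w_def, folded m_def]
    have wV: "w \<in> verts I"
      using down(2) S'(1) by blast
    note anc = ancestors_parent[OF wV down(3), unfolded down(4)]
    show ?thesis
    proof (cases "w \<in> X")
      case wX: True
      have "w \<in> ancestors z"
        using s'(5)[OF down(2) wX m(1) down(1)] anc(2) by blast
      then have "tdist x z = Suc (tdist w z)"
        using tdist_step(1)[OF anc(1,2)] by simp
      moreover have "searching D S z X w"
      proof (rule searchingI)
        show "w \<in> S" "ancestors w \<subseteq> X" "z \<in> verts I"
          using down anc s' wX by auto
        show "v \<in> ancestors (front D (S - X))"
          if "v \<in> ancestors w" "v \<in> S" "u \<in> S - X" "v \<in> ancestors u" for v u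
          using s'(4)[of v u] that anc(1) down(1) m_def by auto
        show "c \<in> ancestors w \<or> c \<in> ancestors z"
          if "c \<in> S" "c \<in> X" "u \<in> S - X" "c \<in> ancestors u" for c u
          using s'(5)[OF that] anc(1) by auto
        show "z \<in> ancestors v" if "v \<in> S - X" "\<And>u. u \<in> S - X \<Longrightarrow> key D u \<le> key D v" for v
          using s'(6) that by blast
      qed
      ultimately show ?thesis
        using wX anc by (simp add: insert_absorb)
    next
      case wX: False
      then have wm: "w = m"
        using down by blast
      have "tdist w z \<le> Suc (tdist x z)"
        using tdist_step[OF anc(1,2), of z] by (cases "w \<in> ancestors z") auto
      moreover have "searching D S z (insert w X) w"
      proof (rule searchingI)
        show "w \<in> S" "ancestors w \<subseteq> insert w X" "z \<in> verts I"
          using down anc s' by auto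
        \<comment> \<open>The new front lies in preorder between \<open>w\<close>, the old front,
          and \<open>u\<close>. Both are below \<open>v\<close>, so convexity applies.\<close>
        show "v \<in> ancestors (front D (S - insert w X))"
          if v: "v \<in> ancestors w" "v \<in> S" "u \<in> S - insert w X" "v \<in> ancestors u" for v u
        proof -
          have U': "S - insert w X \<subseteq> verts I" "S - insert w X \<noteq> {}"
            using that U by auto
          note f = front[OF U', where D = D]
          show ?thesis
            using key_convex[OF wV _ _ v(1) v(4), of "front D (S - insert w X)" D]
              m(2) wm f(1) f(2)[OF v(3)] v(3) U' by blast
        qed
        show "c \<in> ancestors w \<or> c \<in> ancestors z"
          if "c \<in> S" "c \<in> insert w X" "u \<in> S - insert w X" "c \<in> ancestors u" for c u
          using s'(5)[of c u] that anc(1) by auto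
        show "z \<in> ancestors v"
          if v: "v \<in> S - insert w X" "\<And>u. u \<in> S - insert w X \<Longrightarrow> key D u \<le> key D v" for v
        proof -
          \<comment> \<open>The removed vertex \<open>w\<close> was the first one, so the last
            vertex of the remainder is also last in the old set.\<close>
          have "key D u \<le> key D v" if "u \<in> S - X" for u
            using v m(2)[of v] wm that by (cases "u = w") auto
          then show ?thesis
            using s'(6)[of v] v(1) by blast
        qed
      qed
      ultimately show ?thesis
        using wX anc wm by simp
    qed
  qed
  then show ?A ?B "w \<notin> X \<Longrightarrow> w = front D (S - X)" "depth I w \<le> Suc (depth I x)"
    "ancestors w \<subseteq> insert w (ancestors x)"
    unfolding m_def by blast+
qed

text \<open>The sum of \<open>searching_step\<close> over all moves. The energy bound is claimed
  only for an unfinished \<open>S\<close>, because otherwise the agent may stop with energy left.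
  The ordering of discovered before undiscovered vertices holds because each discovery is the
  current front; it is what keeps \<open>ordered\<close> invariant.\<close>

lemma searching_run:
  fixes e :: nat
  assumes S: "subtree S t" and "searching D S z X x" "X \<subseteq> verts I"
  defines "X' \<equiv> X \<union> set (dfs_steps I D S e x X)"
  shows "X' - X \<subseteq> S"
    and "\<And>v. v \<in> X' - X \<Longrightarrow> ancestors v \<subseteq> X'"
    and "\<And>v. v \<in> X' - X \<Longrightarrow> depth I v \<le> depth I x + e"
    and "card (X' - X) \<le> e"
    and "\<And>c u. c \<in> X' - X \<Longrightarrow> u \<in> S - X' \<Longrightarrow> key D c \<le> key D u"
    and "\<not> S \<subseteq> X' \<Longrightarrow> \<exists>x'. searching D S z X' x' \<and> e + tdist x' z \<le> 2 * card (X' - X) + tdist x z"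
proof -
  have "X' - X \<subseteq> S \<and> (\<forall>v\<in>X' - X. ancestors v \<subseteq> X') \<and>
     (\<forall>v\<in>X' - X. depth I v \<le> depth I x + e) \<and> card (X' - X) \<le> e \<and>
     (\<forall>c\<in>X' - X. \<forall>u\<in>S - X'. key D c \<le> key D u) \<and>
     (\<not> S \<subseteq> X' \<longrightarrow> (\<exists>x'. searching D S z X' x' \<and> e + tdist x' z \<le> 2 * card (X' - X) + tdist x z))"
    using assms(2,3) unfolding X'_def
  proof (induction e arbitrary: x X)
    case 0
    then show ?case
      by auto
  next
    case (Suc e)
    show ?case
    proof (cases "S \<subseteq> X")
      case True
      then show ?thesis
        by simp
    next
      case False
      define w where "w = next_vertex D S X x"
      define Y where "Y = insert w X"
      note step = searching_step[OF S Suc.prems(1) False, folded w_def, folded Y_def]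
      have wS: "w \<in> S"
        using searchingD(1)[OF step(1)] .
      have YV: "Y \<subseteq> verts I"
        using Suc.prems(2) wS subtreeD(1)[OF S] by (auto simp: Y_def)
      define Z where "Z = Y \<union> set (dfs_steps I D S e w Y)"
      have IH: "Z - Y \<subseteq> S" "\<forall>v\<in>Z - Y. ancestors v \<subseteq> Z"
        "\<forall>v\<in>Z - Y. depth I v \<le> depth I w + e" "card (Z - Y) \<le> e"
        "\<forall>c\<in>Z - Y. \<forall>u\<in>S - Z. key D c \<le> key D u"
        "\<not> S \<subseteq> Z \<longrightarrow> (\<exists>x'. searching D S z Z x' \<and> e + tdist x' z \<le> 2 * card (Z - Y) + tdist w z)"
        using Suc.IH[OF step(1) YV] unfolding Z_def by blast+
      have Z: "X \<union> set (dfs_steps I D S (Suc e) x X) = Z"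
        using False unfolding dfs_steps_Suc w_def[symmetric] Y_def[symmetric] Z_def
        by (auto simp: Y_def)
      have XY: "X \<subseteq> Z" "w \<in> Z" "Z - X \<subseteq> insert w (Z - Y)"
        by (auto simp: Y_def Z_def)
      have fin: "finite (Z - Y)"
        using IH(1) subtreeD(1)[OF S] finite_subset[OF _ finite_verts] by (meson subset_trans)
      have card: "card (Z - X) = (if w \<in> X then 0 else 1) + card (Z - Y)"
      proof (cases "w \<in> X")
        case True
        then show ?thesis
          by (simp add: Y_def insert_absorb)
      next
        case False
        then have "Z - X = insert w (Z - Y)"
          using XY by (auto simp: Y_def)
        moreover have "w \<notin> Z - Y"
          by (simp add: Y_def)
        ultimately have "card (Z - X) = Suc (card (Z - Y))"
          using card_insert_disjoint[OF fin] by presburger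
        then show ?thesis
          using False by presburger
      qed
      have ancw: "ancestors w \<subseteq> Z"
        using step(5) searchingD(2)[OF Suc.prems(1)] XY(1,2) by (meson insert_subset order_trans)
      have keyw: "key D w \<le> key D u" if "w \<notin> X" "u \<in> S - Z" for u
      proof -
        have "u \<in> S - X" "S - X \<subseteq> verts I"
          using that(2) XY(1) subtreeD(1)[OF S] by auto
        then show ?thesis
          using front(2)[of "S - X" u D] step(3)[OF that(1)] by auto
      qed
      have last: "\<exists>x'. searching D S z Z x' \<and> Suc e + tdist x' z \<le> 2 * card (Z - X) + tdist x z"
        if nS: "\<not> S \<subseteq> Z"
      proof -
        obtain x' where "searching D S z Z x'" "e + tdist x' z \<le> 2 * card (Z - Y) + tdist w z"
          using IH(6) nS by blast
        then show ?thesis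
          using step(2) card by (intro exI[of _ x']) (auto split: if_splits)
      qed
      have dep: "depth I v \<le> depth I x + Suc e" if "v \<in> Z - X" for v
      proof -
        have "v = w \<or> v \<in> Z - Y"
          using that XY(3) by blast
        then have "depth I v \<le> depth I w + e"
          using IH(3) by auto
        then show ?thesis
          using step(4) by simp
      qed
      show ?thesis
        unfolding Z
      proof (intro conjI)
        show "Z - X \<subseteq> S"
          using XY IH(1) wS by auto
        show "\<forall>v\<in>Z - X. ancestors v \<subseteq> Z"
          using XY(3) IH(2) ancw by auto
        show "\<forall>v\<in>Z - X. depth I v \<le> depth I x + Suc e"
          using dep by blast
        show "card (Z - X) \<le> Suc e"
          using card IH(4) by simp
        show "\<forall>c\<in>Z - X. \<forall>u\<in>S - Z. key D c \<le> key D u"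
          using XY(3) IH(5) keyw by auto
        show "\<not> S \<subseteq> Z \<longrightarrow> (\<exists>x'. searching D S z Z x' \<and> Suc e + tdist x' z \<le> 2 * card (Z - X) + tdist x z)"
          using last by blast
      qed
    qed
  qed
  then show "X' - X \<subseteq> S"
    and "\<And>v. v \<in> X' - X \<Longrightarrow> ancestors v \<subseteq> X'"
    and "\<And>v. v \<in> X' - X \<Longrightarrow> depth I v \<le> depth I x + e"
    and "card (X' - X) \<le> e"
    and "\<And>c u. c \<in> X' - X \<Longrightarrow> u \<in> S - X' \<Longrightarrow> key D c \<le> key D u"
    and "\<not> S \<subseteq> X' \<Longrightarrow> \<exists>x'. searching D S z X' x' \<and> e + tdist x' z \<le> 2 * card (X' - X) + tdist x z"
    by blast+
qed

section \<open>Fronts, the gap and the start of a search\<close>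

definition ancestor_closed :: "'v set \<Rightarrow> bool" where
  "ancestor_closed X \<longleftrightarrow> (\<forall>v\<in>X. ancestors v \<subseteq> X)"

text \<open>The shape that the searches leave behind: each explored vertex belongs to a part swept
  from the left or to one swept from the right, so the direction may depend on the vertex.\<close>

definition ordered :: "'v set \<Rightarrow> 'v set \<Rightarrow> bool" where
  "ordered S X \<longleftrightarrow> (\<forall>c\<in>S \<inter> X. \<exists>D. \<forall>u\<in>S - X. key D c \<le> key D u)"

lemma direction_cases: "D' = D \<or> D' = opposite D"
  by (cases D; cases D') auto

lemma gap_alt: "gap U = tdist (parent (front D U)) (parent (front (opposite D) U))"
  by (cases D) (auto simp: gap_def tdist_sym)

lemma tdist_mono:
  assumes "ancestors p \<subseteq> ancestors x \<union> ancestors z" "ancestors x \<inter> ancestors z \<subseteq> ancestors p"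
    "ancestors q \<subseteq> ancestors x \<union> ancestors z" "ancestors x \<inter> ancestors z \<subseteq> ancestors q"
  shows "tdist p q \<le> tdist x z"
  unfolding tdist_def by (rule card_mono) (use assms in auto)

lemma ancestor_closedD: "ancestor_closed X \<Longrightarrow> v \<in> X \<Longrightarrow> ancestors v \<subseteq> X"
  by (simp add: ancestor_closed_def)

text \<open>A parent precedes its children in both orders, so the parent of the first unexplored
  vertex of \<open>S\<close> cannot be unexplored.\<close>

lemma parent_front:
  fixes D :: direction
  assumes "subtree S t" "t \<in> X" "ancestor_closed X" "\<not> S \<subseteq> X"
  defines "m \<equiv> front D (S - X)"
  shows "m \<in> S - X" "m \<in> verts I" "m \<noteq> root I" "parent m \<in> S" "parent m \<in> X" "t \<in> ancestors (parent m)"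
    "ancestors (parent m) \<subseteq> X" "ancestors m = insert m (ancestors (parent m))"
proof -
  note S = subtreeD[OF assms(1)]
  have U: "S - X \<subseteq> verts I" "S - X \<noteq> {}"
    using S assms by auto
  show m: "m \<in> S - X" and mV: "m \<in> verts I"
    using front(1)[OF U, of D] U m_def by auto
  have "m \<noteq> t"
    using m assms by auto
  show nr: "m \<noteq> root I"
    using S(3)[of m] m \<open>m \<noteq> t\<close> by auto
  show anc: "ancestors m = insert m (ancestors (parent m))"
    using ancestors_parent(1)[OF mV nr] .
  show t: "t \<in> ancestors (parent m)"
    using S(3)[of m] m \<open>m \<noteq> t\<close> anc by auto
  show pS: "parent m \<in> S"
    using S(4)[of m, OF _ parent_ancestor[OF mV nr] t] m by simp
  show "parent m \<in> X"
  proof (rule ccontr)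
    assume "parent m \<notin> X"
    then have "key D m \<le> key D (parent m)"
      using front(2)[OF U, of "parent m" D] pS m_def by simp
    then show False
      using key_parent[OF mV nr, of D] prefix_imp_le[of "key D (parent m)" "key D m"]
      by (metis antisym append_self_conv not_Cons_self2 prefixI)
  qed
  then show "ancestors (parent m) \<subseteq> X"
    using ancestor_closedD[OF assms(3)] by blast
qed

text \<open>The front lies in preorder between \<open>c\<close> and \<open>u\<close>, hence below
  \<open>c\<close> by convexity, and it differs from the explored \<open>c\<close>.\<close>

lemma parent_front_below:
  assumes "subtree S t" "t \<in> X" "ancestor_closed X" "c \<in> S" "c \<in> X" "u \<in> S - X" "c \<in> ancestors u"
    and "\<And>u. u \<in> S - X \<Longrightarrow> key D c \<le> key D u"
  shows "c \<in> ancestors (parent (front D (S - X)))"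
proof -
  have inc: "\<not> S \<subseteq> X"
    using assms by auto
  note p = parent_front[OF assms(1-3) inc, of D]
  have V: "c \<in> verts I" "u \<in> verts I" "S - X \<subseteq> verts I" "S - X \<noteq> {}"
    using assms subtreeD(1)[OF assms(1)] by auto
  have "c \<in> ancestors (front D (S - X))"
    using key_convex[OF V(1,2) p(2) self_ancestor[OF V(1)] assms(7), of D]
      assms(8)[OF p(1)] front(2)[OF V(3,4) assms(6), of D] by blast
  then show ?thesis
    using p(1,8) assms(5) by auto
qed

text \<open>The parents of both fronts lie on the tree path between \<open>x\<close> and
  \<open>z\<close>: each is explored with an unexplored child, so the invariant puts it above
  \<open>x\<close> or above \<open>z\<close>, and everything above both \<open>x\<close> and
  \<open>z\<close> is above it.\<close>

lemma gap_le_tdist: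
  assumes "subtree S t" "t \<in> X" "ancestor_closed X" "\<not> S \<subseteq> X" "searching D S z X x"
  shows "gap (S - X) \<le> tdist x z"
proof -
  note S = subtreeD[OF assms(1)] and s = searchingD[OF assms(5)]
  note p = parent_front[OF assms(1-4)]
  have U: "S - X \<subseteq> verts I" "S - X \<noteq> {}"
    using S assms by auto
  obtain y where y: "y \<in> S - X" "\<And>u. u \<in> S - X \<Longrightarrow> key D u \<le> key D y"
    using last_exists[OF U] by blast
  have yV: "y \<in> verts I"
    using y U by blast
  have zy: "z \<in> ancestors y"
    using s(6)[OF y] by simp
  have xV: "x \<in> verts I"
    using S s by blast
  have upper: "ancestors (parent (front D' (S - X))) \<subseteq> ancestors x \<union> ancestors z" for D'
  proof -
    have "parent (front D' (S - X)) \<in> ancestors x \<or> parent (front D' (S - X)) \<in> ancestors z"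
      using s(5)[OF p(4,5) p(1)[of D'] parent_ancestor[OF p(2,3)]] .
    then show ?thesis
      using ancestors_trans[OF xV] ancestors_trans[OF s(3)] by blast
  qed
  \<comment> \<open>Inside \<open>S\<close> such a \<open>c\<close> is above the last unexplored
    vertex because \<open>z\<close> is, and above the first one by the invariant, hence by convexity
    above all in between. Outside \<open>S\<close> it is above the top.\<close>
  have lower: "ancestors x \<inter> ancestors z \<subseteq> ancestors (parent (front D' (S - X)))" for D'
  proof
    fix c assume c: "c \<in> ancestors x \<inter> ancestors z"
    have cV: "c \<in> verts I"
      using c ancestor_vertsD[OF _ xV] by blast
    have tx: "t \<in> ancestors x"
      using S(3) s(1) by blast
    show "c \<in> ancestors (parent (front D' (S - X)))"
    proof (cases "t \<in> ancestors c")
      case True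
      then have cS: "c \<in> S"
        using S(4)[OF s(1)] c by blast
      have cy: "c \<in> ancestors y"
        using ancestors_trans[OF yV zy] c by blast
      then have cm: "c \<in> ancestors (front D (S - X))"
        using s(4)[OF _ cS y(1)] c by blast
      have "c \<in> ancestors (front D' (S - X))"
        using key_convex[OF p(2)[of D] yV p(2)[of D'] cm cy, of D]
          front(2)[OF U p(1)[of D'], of D] y(2)[OF p(1)[of D']] by blast
      then show ?thesis
        using p(8)[of D'] p(1)[of D'] c s(2) by auto
    next
      case False
      then have "c \<in> ancestors t"
        using ancestors_linear[OF xV _ tx, of c] ancestors_linear[OF xV tx, of c] c by (meson IntD1 linear)
      then show ?thesis
        using ancestors_trans[OF parent_props(2)[OF p(2,3)] p(6)] by blast
    qed
  qed
  show ?thesis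
    unfolding gap_alt[of _ D] by (rule tdist_mono) (use upper lower in blast)+
qed

text \<open>By \<open>ordered\<close>, an explored vertex with something unexplored below it is
  above the parent of the front of one direction. The anchor is correct because the front of the
  opposite direction precedes the last unexplored vertex in both orders and is therefore its
  ancestor.\<close>

lemma searching_parent_front:
  assumes "subtree S t" "t \<in> X" "ancestor_closed X" "ordered S X" "\<not> S \<subseteq> X"
  shows "searching D S (parent (front (opposite D) (S - X))) X (parent (front D (S - X)))"
proof (rule searchingI)
  note S = subtreeD[OF assms(1)]
  note p = parent_front[OF assms(1-3,5)]
  have U: "S - X \<subseteq> verts I" "S - X \<noteq> {}"
    using S assms by auto
  show "parent (front D (S - X)) \<in> S" "ancestors (parent (front D (S - X))) \<subseteq> X"
    "parent (front (opposite D) (S - X)) \<in> verts I"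
    using p parent_props(2) by auto
  show "y \<in> ancestors (front D (S - X))" if "y \<in> ancestors (parent (front D (S - X)))" for y
    using that p(8)[of D] by blast
  show "c \<in> ancestors (parent (front D (S - X))) \<or> c \<in> ancestors (parent (front (opposite D) (S - X)))"
    if c: "c \<in> S" "c \<in> X" "u \<in> S - X" "c \<in> ancestors u" for c u
  proof -
    obtain D' where "\<And>u. u \<in> S - X \<Longrightarrow> key D' c \<le> key D' u"
      using assms(4) c unfolding ordered_def by blast
    then have "c \<in> ancestors (parent (front D' (S - X)))"
      using parent_front_below[OF assms(1-3) c] by blast
    then show ?thesis
      using direction_cases[of D' D] by auto
  qed
  show "parent (front (opposite D) (S - X)) \<in> ancestors y"
    if y: "y \<in> S - X" "\<And>u. u \<in> S - X \<Longrightarrow> key D u \<le> key D y" for y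
  proof -
    have yV: "y \<in> verts I"
      using y U by blast
    have "front (opposite D) (S - X) \<in> ancestors y"
      using key_both_le[OF p(2)[of "opposite D"] yV, of D] y(2)[OF p(1)]
        front(2)[OF U y(1), of "opposite D"] by blast
    then show ?thesis
      using ancestors_trans[OF yV] p(8)[of "opposite D"] parent_ancestor[OF p(2,3)] by blast
  qed
qed

section \<open>The traversal sequence meets the front first\<close>

lemma snd_dfs_edges:
  assumes "S \<subseteq> verts I" "v \<in> verts I" "e \<in> set (dfs_edges n I D S v)"
  shows "snd e = v \<or> snd e \<in> S \<and> v \<in> ancestors (snd e)"
  using assms(2,3)
proof (induction n arbitrary: v e)
  case (Suc n)
  then obtain c where c: "c \<in> set (children I D S v)"
    "e = (v, c) \<or> e \<in> set (dfs_edges n I D S c) \<or> e = (c, v)"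
    by auto
  then have c': "c \<in> S" "c \<noteq> root I" "parent c = v" "c \<in> verts I"
    using set_children[OF Suc.prems(1) assms(1)] assms(1) by auto
  then have vc: "v \<in> ancestors c"
    using parent_ancestor by blast
  show ?case
  proof (cases "e \<in> set (dfs_edges n I D S c)")
    case True
    then have "snd e = c \<or> snd e \<in> S \<and> c \<in> ancestors (snd e)"
      using Suc.IH c' by blast
    then show ?thesis
      using c' vc ancestors_trans[of "snd e" c] assms(1) by auto
  next
    case False
    then show ?thesis
      using c(2) c' vc by auto
  qed
qed simp

text \<open>The blocks of the sequence for the children before the one towards the front contain
  only explored heads, so the search for the first unexplored head continues in that child's block.
  The number of vertices of \<open>S\<close> below \<open>v\<close> drops on the way and bounds the
  recursion depth.\<close>

lemma dfs_edges_front: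
  assumes "subtree S t" "v \<in> S" "v \<in> X" "{u \<in> S - X. v \<in> ancestors u} \<noteq> {}"
    "card {x \<in> S. v \<in> ancestors x} \<le> n"
  shows "filter (\<lambda>e. snd e \<notin> X) (dfs_edges n I D S v) \<noteq> [] \<and>
     snd (hd (filter (\<lambda>e. snd e \<notin> X) (dfs_edges n I D S v))) = front D {u \<in> S - X. v \<in> ancestors u}"
  using assms(2-5)
proof (induction n arbitrary: v)
  case 0
  have "finite {x \<in> S. v \<in> ancestors x}"
    using subtreeD(1)[OF assms(1)] finite_subset[OF _ finite_verts] by (metis (no_types, lifting) mem_Collect_eq subset_eq)
  then show ?case
    using 0 by auto
next
  case (Suc n)
  note S = subtreeD[OF assms(1)]
  let ?F = "filter (\<lambda>e. snd e \<notin> X)"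
  define U where "U = {u \<in> S - X. v \<in> ancestors u}"
  define m where "m = front D U"
  have vV: "v \<in> verts I"
    using Suc.prems S by blast
  have UV: "U \<subseteq> verts I" "U \<noteq> {}"
    using S Suc.prems by (auto simp: U_def)
  have m: "m \<in> U" "\<And>u. u \<in> U \<Longrightarrow> key D m \<le> key D u"
    using front[OF UV, where D = D] by (auto simp: m_def)
  have mV: "m \<in> verts I" "m \<in> S - X" "v \<in> ancestors m"
    using m(1) UV by (auto simp: U_def)
  obtain c where c: "c \<in> ancestors m" "c \<in> verts I" "c \<noteq> root I" "parent c = v"
    using child_toward[OF mV(1,3)] mV Suc.prems by blast
  have vc: "v \<in> ancestors c"
    using parent_ancestor[OF c(2,3)] c(4) by simp
  have "t \<in> ancestors c"
    using ancestors_trans[OF c(2) vc] S(3)[OF Suc.prems(1)] by blast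
  then have cS: "c \<in> S"
    using S(4)[of m c] mV c by blast
  note ch = set_children[OF vV S(1), of D]
  define block where "block = (\<lambda>c. (v, c) # dfs_edges n I D S c @ [(c, v)])"
  have "c \<in> set (children I D S v)"
    using ch cS c by simp
  then obtain ys zs where split: "children I D S v = ys @ c # zs"
    by (meson split_list)
  have "sorted_wrt (\<lambda>a b. key D a < key D b) (ys @ c # zs)"
    using children_sorted[OF vV S(1), of D] split by simp
  then have less: "key D b < key D c" if "b \<in> set ys" for b
    using that by (auto simp: sorted_wrt_append)
  have empty: "?F (block b) = []" if b: "b \<in> set ys" for b
  proof -
    have b': "b \<in> S" "b \<noteq> root I" "parent b = v" "b \<in> verts I"
      using ch split b S(1) by auto
    have vb: "v \<in> ancestors b"
      using parent_ancestor[OF b'(4,2)] b'(3) by simp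
    have comp: "w \<in> X" if w: "w \<in> S" "b \<in> ancestors w" for w
    proof (rule ccontr)
      assume "w \<notin> X"
      have wV: "w \<in> verts I"
        using w S by blast
      then have "w \<in> U"
        using ancestors_trans[OF wV w(2)] vb w(1) \<open>w \<notin> X\<close> by (auto simp: U_def)
      then show False
        using earlier_sibling_complete[OF b'(4) c(2) b'(2) c(3) _ mV(1) c(1) less[OF b] wV m(2)]
          b'(3) c(4) w(2) by simp
    qed
    have "snd e \<in> X" if "e \<in> set (block b)" for e
    proof -
      have "snd e = v \<or> snd e = b \<or> snd e \<in> S \<and> b \<in> ancestors (snd e)"
        using that snd_dfs_edges[OF S(1) b'(4), of e n D] unfolding block_def by auto
      then show ?thesis
        using comp[of "snd e"] comp[OF b'(1) self_ancestor[OF b'(4)]] Suc.prems(2) by metis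
    qed
    then show ?thesis
      by (simp add: filter_empty_conv)
  qed
  have "?F (dfs_edges (Suc n) I D S v) = concat (map (\<lambda>c. ?F (block c)) (ys @ c # zs))"
    unfolding split[symmetric] by (simp add: block_def filter_concat comp_def del: filter.simps)
  also have "\<dots> = ?F (block c) @ concat (map (\<lambda>c. ?F (block c)) zs)"
    using empty by simp
  finally have eq: "?F (dfs_edges (Suc n) I D S v) = ?F (block c) @ concat (map (\<lambda>c. ?F (block c)) zs)" .
  have "?F (block c) \<noteq> [] \<and> snd (hd (?F (block c))) = m"
  proof (cases "c \<in> X")
    case False
    have "c \<in> U"
      using False cS vc by (simp add: U_def)
    then have "key D c = key D m"
      using m(2) key_mono[OF mV(1) c(1), of D] by (simp add: order.antisym)
    then have "c = m"
      using key_inj[OF c(2) mV(1), of D] by simp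
    then show ?thesis
      using False by (simp add: block_def)
  next
    case True
    have U': "{u \<in> S - X. c \<in> ancestors u} \<subseteq> U"
    proof
      fix u assume "u \<in> {u \<in> S - X. c \<in> ancestors u}"
      then show "u \<in> U"
        using ancestors_trans[of u c] vc S(1) by (auto simp: U_def)
    qed
    have "front D {u \<in> S - X. c \<in> ancestors u} = m"
      using U' UV(1) m c mV by (intro front_eqI) auto
    moreover have "card {x \<in> S. c \<in> ancestors x} < card {x \<in> S. v \<in> ancestors x}"
    proof (rule psubset_card_mono)
      show "finite {x \<in> S. v \<in> ancestors x}"
        using S(1) by (rule_tac finite_subset[OF _ finite_verts]) auto
      have "{x \<in> S. c \<in> ancestors x} \<subseteq> {x \<in> S. v \<in> ancestors x}"
      proof
        fix u assume "u \<in> {x \<in> S. c \<in> ancestors x}"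
        then show "u \<in> {x \<in> S. v \<in> ancestors x}"
          using ancestors_trans[of u c] vc S(1) by auto
      qed
      moreover have "v \<notin> {x \<in> S. c \<in> ancestors x}"
        using ancestors_parent(2)[OF c(2,3)] c(4) by simp
      ultimately show "{x \<in> S. c \<in> ancestors x} \<subset> {x \<in> S. v \<in> ancestors x}"
        using Suc.prems(1) vV by auto
    qed
    moreover have "{u \<in> S - X. c \<in> ancestors u} \<noteq> {}"
      using mV(2) c(1) by blast
    ultimately have IH: "?F (dfs_edges n I D S c) \<noteq> []" "snd (hd (?F (dfs_edges n I D S c))) = m"
      using Suc.IH[OF cS True] Suc.prems(4) by simp_all
    have "?F (block c) = ?F (dfs_edges n I D S c) @ ?F [(c, v)]"
      using True by (simp add: block_def)
    then show ?thesis
      using IH by simp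
  qed
  then show ?case
    unfolding eq m_def U_def by simp
qed

lemma outermost_unexplored:
  assumes "subtree S t" "t \<in> X" "\<not> S \<subseteq> X"
  shows "outermost_unexplored I D X S = front D (S - X)"
proof -
  note S = subtreeD[OF assms(1)]
  have "{u \<in> S - X. t \<in> ancestors u} = S - X" "{x \<in> S. t \<in> ancestors x} = S"
    using S(3) by auto
  then show ?thesis
    using dfs_edges_front[OF assms(1) S(2) assms(2), of "card S" D] assms(3)
    by (auto simp: outermost_unexplored_def dfs_sequence_def subtree_top[OF assms(1)])
qed

lemma agent_from_explored:
  assumes "ancestors x \<subseteq> X"
  shows "X \<union> set (dfs_agent I D S x X) = X \<union> set (dfs_steps I D S (budget I - depth I x) x X)"
proof -
  have "set (take (Suc (budget I)) (path_to I x)) \<subseteq> X"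
    using set_take_subset assms by (rule order_trans)
  then show ?thesis
    by (auto simp: dfs_agent_def Let_def Un_absorb2)
qed

text \<open>Starting at the unexplored \<open>m\<close> amounts to starting at its explored parent
  with one more unit of energy, since the first move goes to \<open>m\<close>. If \<open>m\<close>
  is beyond the budget, the parent is reached with energy \<open>0\<close> and neither search
  discovers anything.\<close>

lemma agent_to_front:
  fixes D :: direction
  assumes "subtree S t" "t \<in> X" "ancestor_closed X" "\<not> S \<subseteq> X"
  defines "m \<equiv> front D (S - X)"
  shows "X \<union> set (dfs_agent I D S m X) =
     X \<union> set (dfs_steps I D S (budget I - depth I (parent m)) (parent m) X)"
proof -
  note p = parent_front[OF assms(1-4), where D = D, folded m_def]
  have path: "path_to I m = path_to I (parent m) @ [m]"
    using parent_props(1)[OF p(2,3)] .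
  have dep: "depth I m = Suc (depth I (parent m))"
    using ancestors_parent(3)[OF p(2,3)] .
  show ?thesis
  proof (cases "depth I m \<le> budget I")
    case True
    define w where "w = next_vertex D S X (parent m)"
    have "parent m \<in> ancestors (front D (S - X))"
      using parent_ancestor[OF p(2,3)] m_def by simp
    note w = next_down[OF assms(1) p(4,5) assms(4) this, folded w_def m_def]
    have "w \<in> verts I"
      using w(2) subtreeD(1)[OF assms(1)] by blast
    then have "depth I w = depth I m"
      using ancestors_parent(3)[of w] w dep by simp
    then have wm: "w = m"
      using ancestor_depth(2)[OF p(2) w(1)] by simp
    have "Suc (budget I - depth I m) = budget I - depth I (parent m)"
      using True dep by simp
    then have steps: "dfs_steps I D S (budget I - depth I (parent m)) (parent m) X =
        m # dfs_steps I D S (budget I - depth I m) m (insert m X)"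
      using dfs_steps_Suc[of D S "budget I - depth I m" "parent m" X] assms(4) wm w_def by simp
    have "take (Suc (budget I)) (path_to I m) = path_to I m"
      using True length_path_to[OF p(2)] by simp
    moreover have "X \<union> ancestors m = insert m X"
      using p(7,8) by auto
    ultimately show ?thesis
      using p(7,8) by (auto simp: dfs_agent_def Let_def steps)
  next
    case False
    then have "set (take (Suc (budget I)) (path_to I m)) \<subseteq> ancestors (parent m)"
      unfolding path using length_path_to[OF parent_props(2)[OF p(2,3)]] dep set_take_subset by simp
    then show ?thesis
      using False dep p(7) by (auto simp: dfs_agent_def Let_def)
  qed
qed

section \<open>Moving the top of a subtree down\<close>

text \<open>Loop invariant: the current vertex is explored, and all unexplored vertices of
  \<open>S\<close> lie below it. Each of them is reached through a child, and only one child
  qualifies.\<close>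

lemma descend:
  assumes "subtree S t" "t \<in> X" "\<not> S \<subseteq> X"
  defines "v \<equiv> descend I X S"
  shows "v \<in> S" "v \<in> X" "\<And>u. u \<in> S - X \<Longrightarrow> v \<in> ancestors u" "\<not> descend_cond I X S v"
proof -
  note S = subtreeD[OF assms(1)]
  define f where "f = (\<lambda>v. THE c. c \<in> set (children I L S v) \<and> \<not> complete_below I X S c)"
  have step: "f v \<in> S \<inter> X \<and> parent (f v) = v \<and> f v \<noteq> root I \<and> (\<forall>u\<in>S - X. f v \<in> ancestors u)"
    if v: "v \<in> S \<inter> X" "\<forall>u\<in>S - X. v \<in> ancestors u" and c: "descend_cond I X S v" for v
  proof -
    have vV: "v \<in> verts I"
      using v S by blast
    note ch = set_children[OF vV S(1), of L]
    have ex: "\<exists>!c. c \<in> set (children I L S v) \<and> \<not> complete_below I X S c"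
      and chX: "set (children I L S v) \<subseteq> X"
      using c by (auto simp: descend_cond_def)
    have fv: "f v \<in> set (children I L S v) \<and> \<not> complete_below I X S (f v)"
      unfolding f_def using theI'[OF ex] .
    have "f v \<in> ancestors u" if u: "u \<in> S - X" for u
    proof -
      have uV: "u \<in> verts I"
        using u S by blast
      obtain c where c: "c \<in> ancestors u" "c \<in> verts I" "c \<noteq> root I" "parent c = v"
        using child_toward[OF uV, of v] v u by blast
      have "v \<in> ancestors c"
        using parent_ancestor[OF c(2,3)] c(4) by simp
      then have "t \<in> ancestors c"
        using ancestors_trans[OF c(2)] S(3)[of v] v(1) by blast
      then have "c \<in> S"
        using S(4)[of u c] u c by blast
      then have "c \<in> set (children I L S v) \<and> \<not> complete_below I X S c"
        using ch c u complete_below_iff[OF S(1)] by blast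
      then have "c = f v"
        using ex fv by blast
      then show ?thesis
        using c by simp
    qed
    then show ?thesis
      using fv ch chX by auto
  qed
  have "(v \<in> S \<inter> X \<and> (\<forall>u\<in>S - X. v \<in> ancestors u)) \<and> \<not> descend_cond I X S v"
    unfolding v_def descend_def subtree_top[OF assms(1)] f_def[symmetric]
  proof (rule while_rule[where P = "\<lambda>v. v \<in> S \<inter> X \<and> (\<forall>u\<in>S - X. v \<in> ancestors u)"
        and r = "measure (\<lambda>v. card (below I v))"])
    show "t \<in> S \<inter> X \<and> (\<forall>u\<in>S - X. t \<in> ancestors u)"
      using S assms(2) by blast
    fix v assume v: "v \<in> S \<inter> X \<and> (\<forall>u\<in>S - X. v \<in> ancestors u)" and c: "descend_cond I X S v"
    show "f v \<in> S \<inter> X \<and> (\<forall>u\<in>S - X. f v \<in> ancestors u)"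
      using step[of v] v c by blast
    have f: "f v \<in> verts I" "parent (f v) = v" "f v \<noteq> root I"
      using step[of v] v c S(1) by blast+
    have "below I (f v) \<subseteq> below I v"
      using parent_ancestor[OF f(1,3)] f(2) ancestors_trans by (auto simp: below_def)
    moreover have "v \<in> below I v" "v \<notin> below I (f v)"
      using v S(1) ancestors_parent(2)[OF f(1,3)] f(2) by (auto simp: below_def)
    ultimately have "below I (f v) \<subset> below I v"
      by blast
    then show "(f v, v) \<in> measure (\<lambda>v. card (below I v))"
      using psubset_card_mono[of "below I v"] finite_subset[OF _ finite_verts, of "below I v"]
      by (auto simp: below_def)
  qed auto
  then show "v \<in> S" "v \<in> X" "\<And>u. u \<in> S - X \<Longrightarrow> v \<in> ancestors u" "\<not> descend_cond I X S v"
    by blast+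
qed

text \<open>Only explored vertices are cut off, so the unexplored part, its fronts and its gap stay
  the same; so do the children of the new top and their completeness.\<close>

lemma shrink_incomplete:
  assumes "subtree S t" "t \<in> X" "\<not> S \<subseteq> X"
  obtains v where "v \<in> X" "subtree (shrink I X S) v" "shrink I X S - X = S - X" "shrink I X S \<subseteq> S"
    "\<not> descend_cond I X (shrink I X S) v"
proof -
  note S = subtreeD[OF assms(1)]
  define v where "v = descend I X S"
  note d = descend[OF assms, folded v_def]
  have sh: "shrink I X S = S \<inter> below I v"
    using assms(3) by (simp add: shrink_def v_def)
  have vV: "v \<in> verts I"
    using d S by blast
  have sub: "subtree (S \<inter> below I v) v"
    unfolding subtree_def
  proof (intro conjI ballI impI)
    show "S \<inter> below I v \<subseteq> verts I" "v \<in> S \<inter> below I v"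
      using S(1) d(1) vV by (auto simp: below_def)
    fix x assume x: "x \<in> S \<inter> below I v"
    then show "v \<in> ancestors x"
      by (simp add: below_def)
    fix y assume y: "y \<in> ancestors x" "v \<in> ancestors y"
    have yV: "y \<in> verts I"
      using ancestor_vertsD[OF y(1)] x S(1) by blast
    have "t \<in> ancestors y"
      using S(3)[OF d(1)] ancestors_trans[OF yV y(2)] by blast
    then show "y \<in> S \<inter> below I v"
      using S(4)[of x y] x y yV by (auto simp: below_def)
  qed
  have rest: "S \<inter> below I v - X = S - X"
    using d(3) S(1) by (auto simp: below_def)
  have ch: "set (children I L (S \<inter> below I v) v) = set (children I L S v)"
    unfolding set_children[OF vV S(1)] set_children[OF vV subtreeD(1)[OF sub]]
    using parent_ancestor S(1) by (auto simp: below_def)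
  have comp: "complete_below I X (S \<inter> below I v) c \<longleftrightarrow> complete_below I X S c" for c
    using rest by (simp add: complete_below_iff[OF S(1)] complete_below_iff[OF subtreeD(1)[OF sub]])
  have "\<not> descend_cond I X (S \<inter> below I v) v"
    using d(4) by (simp add: descend_cond_def ch comp)
  then show thesis
    using that[of v] d(2) sub rest sh by auto
qed

section \<open>Amortized analysis\<close>

text \<open>Serves the second agent of a divide step: the first one has enlarged the explored set,
  but not within the second subtree.\<close>

lemma searching_cong:
  assumes "searching D S z X x" "X \<subseteq> X'" "S \<inter> X' = S \<inter> X"
  shows "searching D S z X' x"
proof -
  have "S - X' = S - X"
    using assms(3) by blast
  then show ?thesis
    using assms unfolding searching_def by (auto simp: assms(3))
qed

lemma tdist_below:
  assumes "p \<in> verts I" "t \<in> ancestors p"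
  shows "tdist t p = depth I p - depth I t"
proof -
  have sub: "ancestors t \<subseteq> ancestors p"
    using ancestors_trans assms by blast
  then have "ancestors t - ancestors p \<union> (ancestors p - ancestors t) = ancestors p - ancestors t"
    by auto
  then show ?thesis
    using card_Diff_subset[OF _ sub] card_ancestors[OF assms(1)]
      card_ancestors[OF ancestor_vertsD[OF assms(2,1)]] by (simp add: tdist_def)
qed

section \<open>Geometry of the divide step\<close>

text \<open>The point is that the two fronts lie below different children of \<open>t\<close>; then
  the ways from \<open>t\<close> to their parents share no edge, and their lengths add up to at most
  the gap. Each half is searched from the cut outwards, from \<open>t\<close> towards the old front,
  so the parent of that front is the anchor.\<close>

lemma split_subtree:
  assumes S: "subtree S t" and t: "t \<in> X" and cl: "ancestor_closed X" and ord: "ordered S X"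
    and inc: "\<not> S \<subseteq> X" and nd: "\<not> descend_cond I X S t"
    and far: "depth I (front L (S - X)) \<noteq> Suc (depth I t)"
  defines "vL \<equiv> front L (S - X)" and "vR \<equiv> front R (S - X)"
  defines "v \<equiv> (THE c. c \<in> set (children I L S t) \<and> vR \<in> below I c)"
  defines "S1 \<equiv> S - below I v" and "S2 \<equiv> insert t (S \<inter> below I v)"
  shows "subtree S1 t" "subtree S2 t" "ordered S1 X" "ordered S2 X" "S1 \<inter> S2 = {t}" "S1 \<union> S2 = S"
    "\<not> S1 \<subseteq> X" "\<not> S2 \<subseteq> X"
    "searching R S1 (parent vL) X t" "searching L S2 (parent vR) X t"
    "tdist t (parent vL) + tdist t (parent vR) \<le> gap (S - X)"
proof -
  note S' = subtreeD[OF S]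
  have U: "S - X \<subseteq> verts I" "S - X \<noteq> {}"
    using S' inc by auto
  note pL = parent_front[OF S t cl inc, of L, folded vL_def]
  note pR = parent_front[OF S t cl inc, of R, folded vR_def]
  note fL = front(2)[OF U, where D = L, folded vL_def]
  note fR = front(2)[OF U, where D = R, folded vR_def]
  have tR: "t \<in> ancestors vR" "t \<noteq> vR"
    using S'(3)[of vR] pR(1) t by auto
  have tL: "t \<in> ancestors vL" "t \<noteq> vL"
    using S'(3)[of vL] pL(1) t by auto
  obtain w where w: "w \<in> ancestors vR" "w \<in> verts I" "w \<noteq> root I" "parent w = t"
    using child_toward[OF pR(2) tR] .
  note ch = set_children[OF S'(5) S'(1), of L]
  have tw: "t \<in> ancestors w" "ancestors w = insert w (ancestors t)" "w \<notin> ancestors t"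
    "depth I w = Suc (depth I t)"
    using ancestors_parent[OF w(2,3)] parent_ancestor[OF w(2,3)] w(4) by auto
  have wS: "w \<in> S"
    using S'(4)[of vR w] pR(1) w(1) tw(1) by blast
  have sib: "c = w" if c: "c \<in> S" "c \<noteq> root I" "parent c = t" "u \<in> verts I" "c \<in> ancestors u" "w \<in> ancestors u" for c u
  proof -
    have cV: "c \<in> verts I"
      using c S'(1) by blast
    have "depth I c = depth I w"
      using ancestors_parent(3)[OF cV c(2)] c(3) tw(4) by simp
    then show ?thesis
      using ancestor_at_depth_unique[OF c(4-6)] by blast
  qed
  have vw: "v = w"
    unfolding v_def
  proof (rule the_equality)
    show "w \<in> set (children I L S t) \<and> vR \<in> below I w"
      using ch wS w pR(2) by (simp add: below_def)
    show "c = w" if "c \<in> set (children I L S t) \<and> vR \<in> below I c" for c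
      using that sib[of c vR] ch w(1) pR(2) by (simp add: below_def)
  qed
  have vLw: "w \<notin> ancestors vL"
  proof
    assume wL: "w \<in> ancestors vL"
    \<comment> \<open>Being above both fronts, \<open>w\<close> precedes all unexplored vertices in
      both orders.\<close>
    have all: "w \<in> ancestors u" if u: "u \<in> S - X" for u
    proof -
      have "key L w \<le> key L u" "key R w \<le> key R u"
        using key_mono[OF pL(2) wL, of L] key_mono[OF pR(2) w(1), of R] fL[OF u] fR[OF u] by auto
      then show ?thesis
        using key_both_le[OF w(2), of u L] u U(1) by auto
    qed
    have "\<exists>!c. c \<in> set (children I L S t) \<and> \<not> complete_below I X S c"
    proof (rule ex1I[of _ w])
      show "w \<in> set (children I L S t) \<and> \<not> complete_below I X S w"
        using ch wS w complete_below_iff[OF S'(1)] pL(1) wL by blast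
      show "c = w" if c: "c \<in> set (children I L S t) \<and> \<not> complete_below I X S c" for c
      proof -
        obtain u where "u \<in> S - X" "c \<in> ancestors u"
          using complete_below_iff[OF S'(1)] c by blast
        then show ?thesis
          using sib[of c u] ch c all U(1) by auto
      qed
    qed
    \<comment> \<open>Only \<open>w\<close> leads to unexplored vertices, so step (1) can have
      stopped at \<open>t\<close> only because of an unexplored child. This child is
      \<open>w\<close> itself, hence the left front, at a distance excluded by
      \<open>far\<close>.\<close>
    then obtain c where c: "c \<in> set (children I L S t)" "c \<notin> X"
      using nd by (auto simp: descend_cond_def)
    then have cU: "c \<in> S - X" "c \<in> verts I"
      using ch U(1) by auto
    then have "c = w"
      using sib[of c c] all[of c] ch c by auto
    then have "key L w = key L vL"
      using fL[OF cU(1)] key_mono[OF pL(2) wL, of L] by simp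
    then have "w = vL"
      using key_inj[OF w(2) pL(2), of L] by simp
    then show False
      using tw(4) far vL_def by simp
  qed
  have anc_of: "c \<in> ancestors t" if c: "c \<in> ancestors vR" "w \<notin> ancestors c" for c
  proof (rule ccontr)
    assume nt: "c \<notin> ancestors t"
    have cV: "c \<in> verts I"
      using ancestor_vertsD[OF c(1) pR(2)] .
    show False
    proof (cases "depth I w \<le> depth I c")
      case True
      then show False
        using ancestors_linear[OF pR(2) w(1) c(1)] c(2) by blast
    next
      case False
      then have "c \<in> ancestors w"
        using ancestors_linear[OF pR(2) c(1) w(1)] by simp
      then show False
        using tw(2) nt c(2) w(2) by auto
    qed
  qed
  show s1: "subtree S1 t"
    unfolding subtree_def S1_def vw
  proof (intro conjI ballI impI)
    show "S - below I w \<subseteq> verts I" "t \<in> S - below I w"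
      using S' tw(3) by (auto simp: below_def)
    fix x assume x: "x \<in> S - below I w"
    then show "t \<in> ancestors x"
      using S'(3) by blast
    fix y assume y: "y \<in> ancestors x" "t \<in> ancestors y"
    have "w \<notin> ancestors y"
      using x y(1) ancestors_trans[of x y] S'(1) by (auto simp: below_def)
    then show "y \<in> S - below I w"
      using S'(4)[of x y] x y by (auto simp: below_def)
  qed
  show s2: "subtree S2 t"
    unfolding subtree_def S2_def vw
  proof (intro conjI ballI impI)
    show "insert t (S \<inter> below I w) \<subseteq> verts I" "t \<in> insert t (S \<inter> below I w)"
      using S' by auto
    fix x assume x: "x \<in> insert t (S \<inter> below I w)"
    then have xS: "x \<in> S" "x \<in> verts I"
      using S' by auto
    then show "t \<in> ancestors x"
      using S'(3) by blast
    fix y assume y: "y \<in> ancestors x" "t \<in> ancestors y"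
    have yS: "y \<in> S" "y \<in> verts I"
      using S'(4)[OF xS(1) y] S'(1) by auto
    show "y \<in> insert t (S \<inter> below I w)"
    proof (cases "x = t")
      case True
      then show ?thesis
        using ancestor_antisym[OF yS(2) S'(5)] y by simp
    next
      case False
      then have wx: "w \<in> ancestors x"
        using x by (auto simp: below_def)
      show ?thesis
      proof (cases "depth I w \<le> depth I y")
        case True
        then show ?thesis
          using ancestors_linear[OF xS(2) wx y(1)] yS by (simp add: below_def)
      next
        case False
        then have "y \<in> ancestors w" "y \<noteq> w"
          using ancestors_linear[OF xS(2) y(1) wx] by auto
        then have "y \<in> ancestors t"
          using tw(2) by simp
        then show ?thesis
          using ancestor_antisym[OF yS(2) S'(5)] y by simp
      qed
    qed
  qed
  show "ordered S1 X" "ordered S2 X"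
    using ord S'(2) unfolding ordered_def S1_def S2_def by blast+
  show "S1 \<inter> S2 = {t}" "S1 \<union> S2 = S"
    using S'(2,5) tw(3) by (auto simp: S1_def S2_def vw below_def)
  have vL1: "vL \<in> S1 - X" and vR2: "vR \<in> S2 - X"
    using pL(1) pR(1,2) vLw w(1) by (auto simp: S1_def S2_def vw below_def)
  then show "\<not> S1 \<subseteq> X" "\<not> S2 \<subseteq> X"
    by auto
  have top: "y = t" if "y \<in> ancestors t" "y \<in> S" for y
    using ancestor_antisym[OF _ S'(5) that(1)] S'(3)[OF that(2)] that(2) S'(1) by blast
  have sub1: "S1 \<subseteq> S" and sub2: "S2 \<subseteq> S"
    using S'(2) by (auto simp: S1_def S2_def)
  have start: "y \<in> ancestors (front D (S'' - X))"
    if y: "y \<in> ancestors t" "y \<in> S''" and s: "subtree S'' t" "S'' \<subseteq> S" "\<not> S'' \<subseteq> X" for y S'' D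
  proof -
    have "y = t"
      using top y s(2) by blast
    moreover have "front D (S'' - X) \<in> S''"
      using front(1)[of "S'' - X" D] subtreeD(1)[OF s(1)] s(3) by auto
    ultimately show ?thesis
      using subtreeD(3)[OF s(1)] by blast
  qed
  have below: "c \<in> ancestors (parent vL) \<or> c \<in> ancestors (parent vR)"
    if c: "c \<in> S" "c \<in> X" "u \<in> S - X" "c \<in> ancestors u" for c u
  proof -
    obtain D' where "\<And>u. u \<in> S - X \<Longrightarrow> key D' c \<le> key D' u"
      using ord c unfolding ordered_def by blast
    then have "c \<in> ancestors (parent (front D' (S - X)))"
      using parent_front_below[OF S t cl c] by blast
    then show ?thesis
      unfolding vL_def vR_def by (cases D') auto
  qed
  have ancR: "parent vR \<in> ancestors vR" and ancL: "parent vL \<in> ancestors vL"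
    using parent_ancestor pR(2,3) pL(2,3) by blast+
  have t_anc: "ancestors t \<subseteq> X"
    using ancestor_closedD[OF cl t] .
  show "searching R S1 (parent vL) X t"
  proof (rule searchingI)
    show "t \<in> S1" "ancestors t \<subseteq> X" "parent vL \<in> verts I"
      using subtreeD(2)[OF s1] t_anc parent_props(2)[OF pL(2,3)] by auto
    show "y \<in> ancestors (front R (S1 - X))" if "y \<in> ancestors t" "y \<in> S1" for y
      using start[OF that s1 sub1 \<open>\<not> S1 \<subseteq> X\<close>] .
    \<comment> \<open>An explored vertex of \<open>S1\<close> above the right front is not below
      \<open>w\<close>, so it is above \<open>t\<close>.\<close>
    show "c \<in> ancestors t \<or> c \<in> ancestors (parent vL)"
      if c: "c \<in> S1" "c \<in> X" "u \<in> S1 - X" "c \<in> ancestors u" for c u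
    proof -
      have "w \<notin> ancestors c"
        using c(1) S'(1) by (auto simp: S1_def vw below_def)
      moreover have "c \<in> ancestors vR" if "c \<in> ancestors (parent vR)"
        using that pR(8) by simp
      ultimately show ?thesis
        using below[of c u] c sub1 anc_of by blast
    qed
    show "parent vL \<in> ancestors y"
      if y: "y \<in> S1 - X" "\<And>u. u \<in> S1 - X \<Longrightarrow> key R u \<le> key R y" for y
    proof -
      have yV: "y \<in> verts I" "y \<in> S - X"
        using y sub1 U by auto
      have "vL \<in> ancestors y"
        using key_both_le[OF pL(2) yV(1), of L] y(2)[OF vL1] fL[OF yV(2)] by simp
      then show ?thesis
        using ancestors_trans[OF yV(1)] ancL by blast
    qed
  qed
  show "searching L S2 (parent vR) X t"
  proof (rule searchingI)
    show "t \<in> S2" "ancestors t \<subseteq> X" "parent vR \<in> verts I"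
      using subtreeD(2)[OF s2] t_anc parent_props(2)[OF pR(2,3)] by auto
    show "y \<in> ancestors (front L (S2 - X))" if "y \<in> ancestors t" "y \<in> S2" for y
      using start[OF that s2 sub2 \<open>\<not> S2 \<subseteq> X\<close>] .
    show "c \<in> ancestors t \<or> c \<in> ancestors (parent vR)"
      if c: "c \<in> S2" "c \<in> X" "u \<in> S2 - X" "c \<in> ancestors u" for c u
    proof (cases "c = t")
      case True
      then show ?thesis
        using S'(5) by simp
    next
      case False
      then have wc: "w \<in> ancestors c"
        using c(1) by (auto simp: S2_def vw below_def)
      have "c \<notin> ancestors (parent vL)"
      proof
        assume "c \<in> ancestors (parent vL)"
        then have "c \<in> ancestors vL"
          using pL(8) by simp
        then show False
          using ancestors_trans[OF pL(2)] wc vLw by blast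
      qed
      then show ?thesis
        using below[of c u] c sub2 by blast
    qed
    show "parent vR \<in> ancestors y"
      if y: "y \<in> S2 - X" "\<And>u. u \<in> S2 - X \<Longrightarrow> key L u \<le> key L y" for y
    proof -
      have yV: "y \<in> verts I" "y \<in> S - X"
        using y sub2 U by auto
      have "vR \<in> ancestors y"
        using key_both_le[OF pR(2) yV(1), of L] y(2)[OF vR2] fR[OF yV(2)] by simp
      then show ?thesis
        using ancestors_trans[OF yV(1)] ancR by blast
    qed
  qed
  have common: "ancestors (parent vL) \<inter> ancestors (parent vR) \<subseteq> ancestors t"
  proof
    fix c assume c: "c \<in> ancestors (parent vL) \<inter> ancestors (parent vR)"
    then have "c \<in> ancestors vL" "c \<in> ancestors vR"
      using pL(8) pR(8) by auto
    moreover have "w \<notin> ancestors c"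
      using ancestors_trans[OF pL(2) \<open>c \<in> ancestors vL\<close>] vLw by blast
    ultimately show "c \<in> ancestors t"
      using anc_of by blast
  qed
  have diff: "tdist t p = card (ancestors p - ancestors t)" if "t \<in> ancestors p" "p \<in> verts I" for p
  proof -
    have "ancestors t - ancestors p \<union> (ancestors p - ancestors t) = ancestors p - ancestors t"
      using ancestors_trans[OF that(2,1)] by auto
    then show ?thesis
      by (simp add: tdist_def)
  qed
  have "tdist t (parent vL) + tdist t (parent vR) =
      card ((ancestors (parent vL) - ancestors t) \<union> (ancestors (parent vR) - ancestors t))"
    using common diff[OF pL(6) parent_props(2)[OF pL(2,3)]] diff[OF pR(6) parent_props(2)[OF pR(2,3)]]
    by (subst card_Un_disjoint) auto
  also have "\<dots> \<le> gap (S - X)"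
    unfolding gap_def tdist_def vL_def[symmetric] vR_def[symmetric]
    by (rule card_mono) (use common in auto)
  finally show "tdist t (parent vL) + tdist t (parent vR) \<le> gap (S - X)" .
qed

section \<open>Forests of subtrees and the balance of a step\<close>

text \<open>Distinct subtrees may share explored vertices, such as a common top after a split, so
  disjointness is demanded of the unexplored vertices only.\<close>

definition forest :: "'v set set \<Rightarrow> 'v set \<Rightarrow> bool" where
  "forest \<T> X \<longleftrightarrow> finite \<T> \<and> X \<subseteq> verts I \<and> root I \<in> X \<and> ancestor_closed X \<and>
     (\<forall>v\<in>X. depth I v \<le> budget I) \<and>
     (\<forall>S\<in>\<T>. \<exists>t\<in>X. subtree S t \<and> ordered S X) \<and>
     (\<forall>S\<in>\<T>. \<forall>S'\<in>\<T>. S \<noteq> S' \<longrightarrow> S \<inter> S' \<subseteq> X) \<and> verts I - X \<subseteq> \<Union> \<T>"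

lemma forestD:
  assumes "forest \<T> X"
  shows "finite \<T>" "X \<subseteq> verts I" "root I \<in> X" "ancestor_closed X"
    "\<And>v. v \<in> X \<Longrightarrow> depth I v \<le> budget I"
    "\<And>S S'. S \<in> \<T> \<Longrightarrow> S' \<in> \<T> \<Longrightarrow> S \<noteq> S' \<Longrightarrow> S \<inter> S' \<subseteq> X"
    "verts I - X \<subseteq> \<Union> \<T>"
  using assms by (simp_all add: forest_def)

lemma forest_subtree:
  assumes "forest \<T> X" "S \<in> \<T>"
  shows "subtree S (top_of I S)" "top_of I S \<in> X" "ordered S X"
proof -
  obtain t where "t \<in> X" "subtree S t" "ordered S X"
    using assms by (auto simp: forest_def)
  then show "subtree S (top_of I S)" "top_of I S \<in> X" "ordered S X"
    by (simp_all add: subtree_top)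
qed

text \<open>The agent discovers vertices of \<open>S\<close> only, and these belong to no other
  subtree, so the other subtrees keep their unexplored parts. The strict increase for a finished
  \<open>S\<close> later absorbs rounding.\<close>

lemma agent_run:
  fixes D :: direction
  assumes F: "forest \<T> X" and S: "S \<in> \<T>" and s: "searching D S z X x" and inc: "\<not> S \<subseteq> X"
  defines "e \<equiv> budget I - depth I x"
  defines "X' \<equiv> X \<union> set (dfs_steps I D S e x X)"
  shows "forest \<T> X'" "X \<subseteq> X'" "card X' \<le> card X + e"
    "S \<subseteq> X' \<or> e + gap (S - X') \<le> 2 * (card X' - card X) + tdist x z"
    "S \<subseteq> X' \<longrightarrow> card X < card X'"
    "\<And>S'. S' \<in> \<T> \<Longrightarrow> S' \<noteq> S \<Longrightarrow> S' - X' = S' - X \<and> S' \<inter> X' = S' \<inter> X"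
proof -
  note F' = forestD[OF F] and sub = forest_subtree[OF F S]
  note run = searching_run[OF sub(1) s F'(2), where e = e, folded X'_def]
  show XX: "X \<subseteq> X'"
    by (simp add: X'_def)
  have fin: "finite X"
    using F'(2) finite_subset finite_verts by blast
  have V: "X' \<subseteq> verts I"
    using run(1) F'(2) subtreeD(1)[OF sub(1)] by blast
  then have fin': "finite X'"
    using finite_subset finite_verts by blast
  have card: "card (X' - X) = card X' - card X" "card X \<le> card X'"
    using card_Diff_subset[OF fin XX] card_mono[OF fin' XX] by auto
  show "card X' \<le> card X + e"
    using run(4) card by simp
  show other: "S' - X' = S' - X \<and> S' \<inter> X' = S' \<inter> X" if "S' \<in> \<T>" "S' \<noteq> S" for S'
    using F'(6)[OF that(1) S that(2)] run(1) XX by blast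
  show "S \<subseteq> X' \<longrightarrow> card X < card X'"
    using inc XX fin' by (metis psubset_card_mono psubsetI)
  have cl: "ancestor_closed X'"
    using run(2) F'(4) XX unfolding ancestor_closed_def by blast
  show "S \<subseteq> X' \<or> e + gap (S - X') \<le> 2 * (card X' - card X) + tdist x z"
  proof (cases "S \<subseteq> X'")
    case False
    then obtain x' where x': "searching D S z X' x'" "e + tdist x' z \<le> 2 * card (X' - X) + tdist x z"
      using run(6) by blast
    have "gap (S - X') \<le> tdist x' z"
      using gap_le_tdist[OF sub(1) _ cl False x'(1)] sub(2) XX by blast
    then show ?thesis
      using x'(2) card by simp
  qed simp
  have xX: "x \<in> X"
    using searchingD(1,2)[OF s] subtreeD(1)[OF sub(1)] self_ancestor[of x] by blast
  have dep: "depth I v \<le> budget I" if "v \<in> X'" for v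
  proof (cases "v \<in> X")
    case True
    then show ?thesis
      using F'(5) by blast
  next
    case False
    then have "depth I v \<le> depth I x + e"
      using run(3) that by blast
    then show ?thesis
      using F'(5)[OF xX] by (simp add: e_def)
  qed
  have ord: "ordered S X'"
    unfolding ordered_def
  proof
    fix c assume c: "c \<in> S \<inter> X'"
    show "\<exists>D. \<forall>u\<in>S - X'. key D c \<le> key D u"
    proof (cases "c \<in> X")
      case True
      then show ?thesis
        using sub(3) c XX unfolding ordered_def by blast
    next
      case False
      then show ?thesis
        using run(5) c by blast
    qed
  qed
  show "forest \<T> X'"
    unfolding forest_def
  proof (intro conjI)
    show "\<forall>S'\<in>\<T>. \<exists>t\<in>X'. subtree S' t \<and> ordered S' X'"
    proof
      fix S' assume S': "S' \<in> \<T>"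
      have "ordered S' X'"
      proof (cases "S' = S")
        case False
        then show ?thesis
          using forest_subtree(3)[OF F S'] other[OF S'] by (simp add: ordered_def)
      qed (use ord in simp)
      then show "\<exists>t\<in>X'. subtree S' t \<and> ordered S' X'"
        using forest_subtree(1,2)[OF F S'] XX by blast
    qed
    show "\<forall>S\<in>\<T>. \<forall>S'\<in>\<T>. S \<noteq> S' \<longrightarrow> S \<inter> S' \<subseteq> X'"
      using F'(6) XX by blast
  qed (use F' V cl dep XX in auto)
qed

text \<open>Six times the summand of the potential, which keeps it a natural number;
  \<open>U\<close> is the unexplored part of a subtree, empty when the subtree is finished.\<close>

definition cost :: "nat \<Rightarrow> 'v set \<Rightarrow> nat" where
  "cost g U = (if U = {} then 0 else 2 * (budget I - g) + 3 * gap U)"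

definition potential :: "nat \<Rightarrow> 'v set set \<Rightarrow> 'v set \<Rightarrow> nat" where
  "potential g \<T> X = (\<Sum>S\<in>\<T>. cost g (S - X))"

lemma potential_change:
  assumes "finite \<T>" "S \<in> \<T>" "\<And>S'. S' \<in> \<T> \<Longrightarrow> S' \<noteq> S \<Longrightarrow> S' - X' = S' - X"
  shows "potential g \<T> X' + cost g (S - X) = potential g \<T> X + cost g (S - X')"
proof -
  have "(\<Sum>S\<in>\<T> - {S}. cost g (S - X')) = (\<Sum>S\<in>\<T> - {S}. cost g (S - X))"
    using assms(3) by (intro sum.cong) auto
  then show ?thesis
    unfolding potential_def sum.remove[OF assms(1,2)] by simp
qed

text \<open>With \<open>3 * e \<ge> 2 * (budget I - g)\<close>, three times the bound of
  \<open>agent_run\<close> is the claim. If \<open>S\<close> gets finished, its released cost, at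
  least \<open>2 * (budget I - g)\<close>, pays for the agent.\<close>

lemma search_step:
  fixes D :: direction
  assumes F: "forest \<T> X" and S: "S \<in> \<T>" and inc: "\<not> S \<subseteq> X"
    and g: "depth I (top_of I S) = g"
    and close: "close_enough I S (front D (S - X))"
  defines "X' \<equiv> X \<union> set (dfs_agent I D S (front D (S - X)) X)"
  shows "forest \<T> X'" "X \<subseteq> X'" "card X' \<le> card X + (budget I - g)"
    "6 * card X + 2 * (budget I - g) + potential g \<T> X' \<le> 6 * card X' + potential g \<T> X"
    "\<And>S'. S' \<in> \<T> \<Longrightarrow> S' - X' \<subseteq> S' - X"
proof -
  note F' = forestD[OF F] and sub = forest_subtree[OF F S]
  define p where "p = parent (front D (S - X))"
  define e where "e = budget I - depth I p"
  have X': "X' = X \<union> set (dfs_steps I D S e p X)"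
    unfolding X'_def e_def p_def using agent_to_front[OF sub(1,2) F'(4) inc] .
  note pf = parent_front[OF sub(1,2) F'(4) inc, where D = D, folded p_def]
  note run = agent_run[OF F S searching_parent_front[OF sub(1,2) F'(4) sub(3) inc, of D] inc,
      folded p_def, folded e_def, folded X']
  show "forest \<T> X'" "X \<subseteq> X'"
    using run by auto
  show "S' - X' \<subseteq> S' - X" for S'
    using run(2) by blast
  have gp: "g \<le> depth I p" "p \<in> verts I"
    using ancestor_depth(1)[OF _ pf(6)] parent_props(2)[OF pf(2,3)] g p_def by auto
  have gB: "depth I p \<le> budget I"
    using F'(5) pf(5) by blast
  show "card X' \<le> card X + (budget I - g)"
    using run(3) gp e_def by simp
  have dm: "depth I (front D (S - X)) = Suc (depth I p)"
    using ancestors_parent(3)[OF pf(2,3)] p_def by simp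
  have "real (Suc (depth I p)) - real g \<le> max 1 ((real (budget I) - real g) / 3)"
    using close unfolding close_enough_def g dm .
  \<comment> \<open>The alternative \<open>1\<close> of the threshold means that the target is a
    child of the top; its parent is then the top and no energy is lost on the way.\<close>
  then have "depth I p = g \<or> 3 * (Suc (depth I p) - g) \<le> budget I - g"
    using gp gB by (auto simp: max_def field_simps of_nat_diff split: if_splits)
  then have e: "2 * (budget I - g) \<le> 3 * e"
    using gp gB unfolding e_def by auto
  have fin: "finite X'"
    using forestD(2)[OF run(1)] finite_subset finite_verts by blast
  have le: "card X \<le> card X'"
    using card_mono[OF fin run(2)] .
  have gap: "gap (S - X) = tdist p (parent (front (opposite D) (S - X)))"
    unfolding p_def by (rule gap_alt)
  have "2 * (budget I - g) + cost g (S - X') \<le> 6 * (card X' - card X) + cost g (S - X)"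
  proof (cases "S \<subseteq> X'")
    case True
    then show ?thesis
      using inc by (auto simp: cost_def)
  next
    case False
    then have "e + gap (S - X') \<le> 2 * (card X' - card X) + gap (S - X)"
      using run(4) gap by simp
    then show ?thesis
      using False inc e by (simp add: cost_def)
  qed
  then show "6 * card X + 2 * (budget I - g) + potential g \<T> X' \<le> 6 * card X' + potential g \<T> X"
    using potential_change[OF F'(1) S, of X' X g] run(6) le by simp
qed

text \<open>Three times the sum of both run bounds yields \<open>6 * E\<close>: \<open>4 * E\<close>
  for the two agents and \<open>2 * E\<close> for the additional subtree. If only the first agent
  exists, the old cost of \<open>S\<close>, at least \<open>2 * E\<close>, already pays for
  it.\<close>

lemma split_step:
  assumes F: "forest \<T> X" and S: "S \<in> \<T>" and inc: "\<not> S \<subseteq> X"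
    and g: "depth I (top_of I S) = g" and nd: "\<not> descend_cond I X S (top_of I S)"
    and far: "\<not> close_enough I S (front L (S - X))" "\<not> close_enough I S (front R (S - X))"
  defines "t \<equiv> top_of I S"
  defines "v \<equiv> (THE c. c \<in> set (children I L S t) \<and> front R (S - X) \<in> below I c)"
  defines "S1 \<equiv> S - below I v" and "S2 \<equiv> insert t (S \<inter> below I v)"
  defines "\<T>' \<equiv> (\<T> - {S}) \<union> {S1, S2}"
  defines "X1 \<equiv> X \<union> set (dfs_agent I R S1 t X)"
  defines "X2 \<equiv> X1 \<union> set (dfs_agent I L S2 t X1)"
  shows "forest \<T>' X1" "X \<subseteq> X1" "card X1 \<le> card X + (budget I - g)"
    "6 * card X + 2 * (budget I - g) \<le> 6 * card X1 + potential g \<T> X"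
    "forest \<T>' X2" "X1 \<subseteq> X2" "card X2 \<le> card X + 2 * (budget I - g)"
    "6 * card X + 4 * (budget I - g) + potential g \<T>' X2 \<le> 6 * card X2 + potential g \<T> X"
    "\<And>S'. S' \<in> \<T>' \<Longrightarrow> S' \<in> \<T> \<or> depth I (top_of I S') = g"
proof -
  note F' = forestD[OF F] and sub = forest_subtree[OF F S, folded t_def]
  define pL where "pL = parent (front L (S - X))"
  define pR where "pR = parent (front R (S - X))"
  note pfL = parent_front[OF sub(1,2) F'(4) inc, where D = L, folded pL_def]
  note pfR = parent_front[OF sub(1,2) F'(4) inc, where D = R, folded pR_def]
  define E where "E = budget I - g"
  have far': "1 < Suc (depth I p) - g" "E < 3 * (Suc (depth I p) - g)"
    if "\<not> close_enough I S (front D (S - X))" "p = parent (front D (S - X))" for D p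
  proof -
    note pf = parent_front[OF sub(1,2) F'(4) inc, where D = D]
    have gp: "g \<le> depth I p"
      using ancestor_depth(1)[OF _ pf(6)] parent_props(2)[OF pf(2,3)] g t_def that(2) by auto
    have gB: "depth I p \<le> budget I"
      using F'(5) pf(5) that(2) by blast
    have dm: "depth I (front D (S - X)) = Suc (depth I p)"
      using ancestors_parent(3)[OF pf(2,3)] that(2) by simp
    have "\<not> real (Suc (depth I p)) - real g \<le> max 1 ((real (budget I) - real g) / 3)"
      using that(1) unfolding close_enough_def g dm .
    then show "1 < Suc (depth I p) - g" "E < 3 * (Suc (depth I p) - g)"
      using gp gB unfolding E_def by (auto simp: max_def field_simps of_nat_diff split: if_splits)
  qed
  have farL: "depth I (front L (S - X)) \<noteq> Suc (depth I t)"
    using far'(1)[OF far(1) pL_def] ancestors_parent(3)[OF pfL(2,3)] g by (auto simp: t_def pL_def)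
  note sp = split_subtree[OF sub(1,2) F'(4) sub(3) inc nd[folded t_def] farL, folded v_def,
      folded S1_def S2_def, folded pL_def pR_def]
  have pLV: "pL \<in> verts I" "pR \<in> verts I"
    using parent_props(2)[OF pfL(2,3)] parent_props(2)[OF pfR(2,3)] by (simp_all add: pL_def pR_def)
  define a where "a = tdist t pL"
  define b where "b = tdist t pR"
  \<comment> \<open>The front is farther than \<open>E / 3\<close> from the top, and its parent is
    one edge closer.\<close>
  have a: "E < 3 * a + 3"
    using far'(2)[OF far(1) pL_def] tdist_below[OF pLV(1) pfL(6)] g ancestor_depth(1)[OF pLV(1) pfL(6)]
    by (simp add: a_def t_def)
  have b: "E < 3 * b + 3"
    using far'(2)[OF far(2) pR_def] tdist_below[OF pLV(2) pfR(6)] g ancestor_depth(1)[OF pLV(2) pfR(6)]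
    by (simp add: b_def t_def)
  have ab: "a + b \<le> gap (S - X)"
    using sp(11) by (simp add: a_def b_def)
  have top: "top_of I S1 = t" "top_of I S2 = t"
    using sp(1,2) subtree_top by blast+
  have sS: "S1 \<subseteq> S" "S2 \<subseteq> S"
    using sp(6) by auto
  have tX: "t \<in> X"
    using sub(2) .
  have disj: "S1 \<inter> S2 \<subseteq> X"
    using sp(5) tX by simp
  \<comment> \<open>\<open>\<T>\<close> is a set, so a part that coincided with another subtree
    would be counted only once in the potential; disjointness excludes this.\<close>
  have new: "S'' \<notin> \<T> - {S}" if "S'' \<subseteq> S" "\<not> S'' \<subseteq> X" for S''
    using F'(6)[of S'' S] S that by blast
  have n1: "S1 \<notin> \<T> - {S}" and n2: "S2 \<notin> \<T> - {S}" and n12: "S1 \<noteq> S2"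
    using new[OF sS(1) sp(7)] new[OF sS(2) sp(8)] sp(7) disj by auto
  have F1: "forest \<T>' X"
    unfolding forest_def
  proof (intro conjI)
    show "finite \<T>'"
      using F'(1) by (simp add: \<T>'_def)
    show "\<forall>S\<in>\<T>'. \<exists>t\<in>X. subtree S t \<and> ordered S X"
    proof
      fix S' assume "S' \<in> \<T>'"
      then consider "S' \<in> \<T>" | "S' = S1" | "S' = S2"
        by (auto simp: \<T>'_def)
      then show "\<exists>t\<in>X. subtree S' t \<and> ordered S' X"
        using forest_subtree[OF F, of S'] sp(1-4) tX by cases blast+
    qed
    show "\<forall>A\<in>\<T>'. \<forall>B\<in>\<T>'. A \<noteq> B \<longrightarrow> A \<inter> B \<subseteq> X"
    proof (intro ballI impI)
      fix A B assume AB: "A \<in> \<T>'" "B \<in> \<T>'" "A \<noteq> B"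
      have o: "C \<inter> S'' \<subseteq> X" if "C \<in> \<T> - {S}" "S'' \<subseteq> S" for C S''
        using F'(6)[of C S] S that by blast
      show "A \<inter> B \<subseteq> X"
      proof (cases "A \<in> \<T> - {S}")
        case A: True
        show ?thesis
        proof (cases "B \<in> \<T> - {S}")
          case True
          then show ?thesis
            using A F'(6) AB(3) by blast
        next
          case False
          then have "B \<subseteq> S"
            using AB(2) sS by (auto simp: \<T>'_def)
          then show ?thesis
            using o[OF A] by blast
        qed
      next
        case A: False
        then have AS: "A = S1 \<or> A = S2"
          using AB(1) by (auto simp: \<T>'_def)
        show ?thesis
        proof (cases "B \<in> \<T> - {S}")
          case True
          then have "B \<inter> A \<subseteq> X"
            using o[OF True] AS sS by blast
          then show ?thesis
            by blast
        next
          case False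
          then have "B = S1 \<or> B = S2"
            using AB(2) by (auto simp: \<T>'_def)
          then show ?thesis
            using AS AB(3) disj by blast
        qed
      qed
    qed
    show "verts I - X \<subseteq> \<Union> \<T>'"
    proof
      fix x assume "x \<in> verts I - X"
      then obtain C where "C \<in> \<T>" "x \<in> C"
        using F'(7) by blast
      then show "x \<in> \<Union> \<T>'"
        using sp(6) by (cases "C = S") (auto simp: \<T>'_def)
    qed
    show "\<forall>v\<in>X. depth I v \<le> budget I"
      using F'(5) by blast
  qed (use F' in auto)
  have m1: "S1 \<in> \<T>'" "S2 \<in> \<T>'"
    by (auto simp: \<T>'_def)
  have At: "ancestors t \<subseteq> X"
    using ancestor_closedD[OF F'(4) tX] .
  have Et: "budget I - depth I t = E"
    using g by (simp add: E_def t_def)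
  have X1: "X1 = X \<union> set (dfs_steps I R S1 E t X)"
    unfolding X1_def agent_from_explored[OF At] Et ..
  note r1 = agent_run[OF F1 m1(1) sp(9) sp(7), unfolded Et, folded X1, folded a_def]
  show r1': "forest \<T>' X1" "X \<subseteq> X1" "card X1 \<le> card X + (budget I - g)"
    using r1(1-3) by (auto simp: tdist_sym a_def E_def)
  have o1: "S2 - X1 = S2 - X" "S2 \<inter> X1 = S2 \<inter> X"
    using r1(6)[OF m1(2)] n12 by auto
  have inc2: "\<not> S2 \<subseteq> X1"
    using o1(1) sp(8) by blast
  have "X2 = X1 \<union> set (dfs_steps I L S2 E t X1)"
    unfolding X2_def using agent_from_explored[of t X1 L S2] At r1(2) Et by simp
  note X2 = this
  note r2 = agent_run[OF r1(1) m1(2) searching_cong[OF sp(10) r1(2) o1(2)] inc2,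
      unfolded Et, folded X2, folded b_def]
  show r2': "forest \<T>' X2" "X1 \<subseteq> X2" "card X2 \<le> card X + 2 * (budget I - g)"
    using r2(1-3) r1(3) by (auto simp: E_def)
  have fin: "finite X1" "finite X2"
    using forestD(2)[OF r1(1)] forestD(2)[OF r2(1)] finite_subset finite_verts by blast+
  have le: "card X \<le> card X1" "card X1 \<le> card X2"
    using card_mono fin r1(2) r2(2) by blast+
  define P where "P = (\<Sum>C\<in>\<T> - {S}. cost g (C - X))"
  have P0: "potential g \<T> X = 2 * E + 3 * gap (S - X) + P"
    unfolding potential_def P_def sum.remove[OF F'(1) S] using inc by (auto simp: cost_def E_def)
  then show "6 * card X + 2 * (budget I - g) \<le> 6 * card X1 + potential g \<T> X"
    using le by (simp add: E_def)
  have o2: "C - X2 = C - X" if "C \<in> \<T> - {S}" for C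
  proof -
    have C: "C \<in> \<T>'" "C \<noteq> S1" "C \<noteq> S2"
      using that n1 n2 by (auto simp: \<T>'_def)
    show ?thesis
      using r1(6)[OF C(1,2)] r2(6)[OF C(1,3)] by auto
  qed
  have "potential g \<T>' X2 = cost g (S1 - X2) + cost g (S2 - X2) + (\<Sum>C\<in>\<T> - {S}. cost g (C - X2))"
    using n1 n2 n12 F'(1) by (simp add: \<T>'_def potential_def)
  also have "(\<Sum>C\<in>\<T> - {S}. cost g (C - X2)) = P"
    unfolding P_def using o2 by (intro sum.cong) auto
  also have "S1 - X2 = S1 - X1"
    using r2(6)[OF m1(1) n12] by blast
  finally have P2: "potential g \<T>' X2 = cost g (S1 - X1) + cost g (S2 - X2) + P" .
  have c1: "S1 \<subseteq> X1 \<and> cost g (S1 - X1) = 0 \<and> card X < card X1 \<or>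
      cost g (S1 - X1) = 2 * E + 3 * gap (S1 - X1) \<and> E + gap (S1 - X1) \<le> 2 * (card X1 - card X) + a"
    using r1(4,5) by (cases "S1 \<subseteq> X1") (auto simp: cost_def E_def)
  have c2: "S2 \<subseteq> X2 \<and> cost g (S2 - X2) = 0 \<and> card X1 < card X2 \<or>
      cost g (S2 - X2) = 2 * E + 3 * gap (S2 - X2) \<and> E + gap (S2 - X2) \<le> 2 * (card X2 - card X1) + b"
    using r2(4,5) by (cases "S2 \<subseteq> X2") (auto simp: cost_def E_def)
  \<comment> \<open>If \<open>S1\<close> is finished and \<open>S2\<close> is not, the shortfall
    \<open>E - 3 * a\<close> is at most \<open>2\<close> and is covered by one discovery;
    symmetrically with \<open>b\<close>. If both are finished, \<open>3 * (a + b)\<close> and the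
    discoveries cover the remaining \<open>2 * E\<close>.\<close>
  have "6 * card X + 4 * E + potential g \<T>' X2 \<le> 6 * card X2 + potential g \<T> X"
    unfolding P2 P0 using c1 c2 a b ab le by (elim disjE) linarith+
  then show "6 * card X + 4 * (budget I - g) + potential g \<T>' X2 \<le> 6 * card X2 + potential g \<T> X"
    by (simp add: E_def)
  show "S' \<in> \<T> \<or> depth I (top_of I S') = g" if "S' \<in> \<T>'" for S'
    using that top g t_def by (auto simp: \<T>'_def)
qed

text \<open>The potential depends on the unexplored parts alone, which shrinking preserves.\<close>

lemma shrink_forest:
  assumes F: "forest \<T> X"
  shows "forest (shrink I X ` \<T>) X" "potential g (shrink I X ` \<T>) X = potential g \<T> X"
    "\<And>S. S \<in> shrink I X ` \<T> \<Longrightarrow> \<not> S \<subseteq> X \<Longrightarrow> \<not> descend_cond I X S (top_of I S)"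
    "\<And>S. S \<in> shrink I X ` \<T> \<Longrightarrow> \<not> S \<subseteq> X \<Longrightarrow>
       \<exists>S'\<in>\<T>. \<not> S' \<subseteq> X \<and> depth I (top_of I S') \<le> depth I (top_of I S)"
proof -
  note F' = forestD[OF F]
  have same: "shrink I X S = S" if "S \<subseteq> X" for S
    using that by (simp add: shrink_def)
  have sh: "\<exists>t\<in>X. subtree (shrink I X S) t \<and> ordered (shrink I X S) X \<and> shrink I X S - X = S - X \<and>
      shrink I X S \<subseteq> S \<and> (\<not> S \<subseteq> X \<longrightarrow> \<not> descend_cond I X (shrink I X S) t \<and> depth I (top_of I S) \<le> depth I t)"
    if S: "S \<in> \<T>" for S
  proof (cases "S \<subseteq> X")
    case True
    then show ?thesis
      using forest_subtree[OF F S] same by auto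
  next
    case False
    note sub = forest_subtree[OF F S]
    obtain v where v: "v \<in> X" "subtree (shrink I X S) v" "shrink I X S - X = S - X" "shrink I X S \<subseteq> S"
      "\<not> descend_cond I X (shrink I X S) v"
      using shrink_incomplete[OF sub(1,2) False] .
    have "ordered (shrink I X S) X"
      using sub(3) v(3,4) unfolding ordered_def by (metis Int_iff subsetD)
    moreover have "v \<in> S" "v \<in> verts I"
      using subtreeD(2,5)[OF v(2)] v(4) by auto
    then have "depth I (top_of I S) \<le> depth I v"
      using ancestor_depth(1) subtreeD(3)[OF sub(1)] by blast
    ultimately show ?thesis
      using v by blast
  qed
  then have rest: "shrink I X S - X = S - X" if "S \<in> \<T>" for S
    using that by blast
  have subs: "shrink I X S \<subseteq> S" if "S \<in> \<T>" for S
    using sh[OF that] by blast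
  show "forest (shrink I X ` \<T>) X"
    unfolding forest_def
  proof (intro conjI)
    show "\<forall>S\<in>shrink I X ` \<T>. \<exists>t\<in>X. subtree S t \<and> ordered S X"
      using sh by blast
    show "\<forall>S\<in>shrink I X ` \<T>. \<forall>S'\<in>shrink I X ` \<T>. S \<noteq> S' \<longrightarrow> S \<inter> S' \<subseteq> X"
    proof (intro ballI impI)
      fix A B assume "A \<in> shrink I X ` \<T>" "B \<in> shrink I X ` \<T>" "A \<noteq> B"
      then obtain A' B' where "A' \<in> \<T>" "B' \<in> \<T>" "A = shrink I X A'" "B = shrink I X B'" "A' \<noteq> B'"
        by blast
      then show "A \<inter> B \<subseteq> X"
        using F'(6)[of A' B'] subs[of A'] subs[of B'] by blast
    qed
    show "verts I - X \<subseteq> \<Union> (shrink I X ` \<T>)"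
    proof
      fix x assume x: "x \<in> verts I - X"
      then obtain S where S: "S \<in> \<T>" "x \<in> S"
        using F'(7) by blast
      then have "x \<in> shrink I X S"
        using rest[OF S(1)] x by blast
      then show "x \<in> \<Union> (shrink I X ` \<T>)"
        using S(1) by blast
    qed
    show "\<forall>v\<in>X. depth I v \<le> budget I"
      using F'(5) by blast
  qed (use F' in auto)
  \<comment> \<open>Distinct unfinished subtrees have disjoint nonempty unexplored parts, and
    finished ones are left unchanged, so no summand is lost.\<close>
  have "inj_on (shrink I X) \<T>"
  proof
    fix A B assume AB: "A \<in> \<T>" "B \<in> \<T>" "shrink I X A = shrink I X B"
    then have eq: "A - X = B - X"
      using rest by metis
    show "A = B"
    proof (cases "A \<subseteq> X")
      case True
      then have "B \<subseteq> X"
        using eq by blast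
      then show ?thesis
        using True AB(3) same by simp
    next
      case False
      then show ?thesis
        using F'(6)[OF AB(1,2)] eq by blast
    qed
  qed
  then show "potential g (shrink I X ` \<T>) X = potential g \<T> X"
    unfolding potential_def by (simp add: sum.reindex rest)
  fix S assume S: "S \<in> shrink I X ` \<T>" "\<not> S \<subseteq> X"
  then obtain S' where S': "S' \<in> \<T>" "S = shrink I X S'"
    by blast
  have inc: "\<not> S' \<subseteq> X"
    using S S' subs by blast
  obtain t where t: "subtree S t" "\<not> descend_cond I X S t" "depth I (top_of I S') \<le> depth I t"
    using sh[OF S'(1)] S'(2) inc by blast
  show "\<not> descend_cond I X S (top_of I S)"
    using t subtree_top by simp
  show "\<exists>S'\<in>\<T>. \<not> S' \<subseteq> X \<and> depth I (top_of I S') \<le> depth I (top_of I S)"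
    using S'(1) inc t(3) subtree_top[OF t(1)] by auto
qed

section \<open>Levels passed by the minimum depth of the tops\<close>

text \<open>
  The history of a run: \<open>ds\<close> lists, for each agent used so far, the depth of the top of its
  subtree, \<open>g\<close> is the current minimum depth of a top of an unfinished subtree, \<open>M h\<close> is the set of
  explored vertices at the time when this minimum reached \<open>h\<close>, and \<open>A h\<close> consists of the ancestors
  at depth \<open>h\<close> of the tops of the subtrees that were unfinished at that time.
\<close>

definition history ::
  "nat \<Rightarrow> nat list \<Rightarrow> (nat \<Rightarrow> 'v set) \<Rightarrow> (nat \<Rightarrow> 'v set) \<Rightarrow> 'v set set \<Rightarrow> 'v set \<Rightarrow> bool" where
  "history g ds M A \<T> X \<longleftrightarrow>
     g \<le> budget I \<and> (\<forall>d\<in>set ds. d \<le> g) \<and>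
     (\<forall>h\<in>{1..g}. M h \<subseteq> X \<and> root I \<in> M h \<and> ancestor_closed (M h) \<and> A h \<subseteq> M h \<and>
        (\<forall>a\<in>A h. depth I a = h) \<and> (\<forall>v\<in>verts I - M h. ancestors v \<inter> A h \<noteq> {}) \<and>
        card (M h) \<le> 1 + (\<Sum>d\<leftarrow>filter (\<lambda>d. d < h) ds. budget I - d)) \<and>
     (\<forall>h\<in>{1..g}. \<forall>h'\<in>{h..g}. M h \<subseteq> M h') \<and>
     card X \<le> 1 + (\<Sum>d\<leftarrow>ds. budget I - d) \<and>
     (\<forall>S\<in>\<T>. \<not> S \<subseteq> X \<longrightarrow> g \<le> depth I (top_of I S))"

lemma historyD:
  assumes "history g ds M A \<T> X"
  shows "g \<le> budget I" "\<And>d. d \<in> set ds \<Longrightarrow> d \<le> g"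
    "\<And>h. 1 \<le> h \<Longrightarrow> h \<le> g \<Longrightarrow> M h \<subseteq> X \<and> root I \<in> M h \<and> ancestor_closed (M h) \<and> A h \<subseteq> M h \<and>
        (\<forall>a\<in>A h. depth I a = h) \<and> (\<forall>v\<in>verts I - M h. ancestors v \<inter> A h \<noteq> {}) \<and>
        card (M h) \<le> 1 + (\<Sum>d\<leftarrow>filter (\<lambda>d. d < h) ds. budget I - d)"
    "\<And>h h'. 1 \<le> h \<Longrightarrow> h \<le> h' \<Longrightarrow> h' \<le> g \<Longrightarrow> M h \<subseteq> M h'"
    "card X \<le> 1 + (\<Sum>d\<leftarrow>ds. budget I - d)"
    "\<And>S. S \<in> \<T> \<Longrightarrow> \<not> S \<subseteq> X \<Longrightarrow> g \<le> depth I (top_of I S)"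
  using assms unfolding history_def by (simp_all del: One_nat_def)

text \<open>The new entries equal \<open>g\<close>, so the sums over entries smaller than some
  \<open>h \<le> g\<close> do not change.\<close>

lemma history_extend:
  assumes "history g ds M A \<T> X" "X \<subseteq> X'" "card X' \<le> card X + j * (budget I - g)"
    "\<And>S. S \<in> \<T>' \<Longrightarrow> \<not> S \<subseteq> X' \<Longrightarrow> g \<le> depth I (top_of I S)"
  shows "history g (ds @ replicate j g) M A \<T>' X'"
proof -
  note H = historyD[OF assms(1)]
  have sum: "(\<Sum>d\<leftarrow>ds @ replicate j g. budget I - d) = (\<Sum>d\<leftarrow>ds. budget I - d) + j * (budget I - g)"
    by (simp add: sum_list_replicate)
  have filter: "filter (\<lambda>d. d < h) (ds @ replicate j g) = filter (\<lambda>d. d < h) ds" if "h \<le> g" for h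
    using that by (simp add: filter_empty_conv)
  show ?thesis
    unfolding history_def sum
  proof (intro conjI ballI impI)
    show "g \<le> budget I" "card X' \<le> 1 + ((\<Sum>d\<leftarrow>ds. budget I - d) + j * (budget I - g))"
      using H(1,5) assms(3) by auto
    show "d \<le> g" if "d \<in> set (ds @ replicate j g)" for d
      using that H(2) by auto
    show "g \<le> depth I (top_of I S)" if "S \<in> \<T>'" "\<not> S \<subseteq> X'" for S
      using assms(4) that .
    fix h assume "h \<in> {1..g}"
    then have h: "1 \<le> h" "h \<le> g"
      by auto
    note Hh = H(3)[OF h]
    show "M h \<subseteq> X'"
      using Hh assms(2) by blast
    show "root I \<in> M h" "ancestor_closed (M h)" "A h \<subseteq> M h"
      "card (M h) \<le> 1 + (\<Sum>d\<leftarrow>filter (\<lambda>d. d < h) (ds @ replicate j g). budget I - d)"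
      unfolding filter[OF h(2)] using Hh by simp_all
    show "depth I a = h" if "a \<in> A h" for a
      using Hh that by simp
    show "ancestors v \<inter> A h \<noteq> {}" if "v \<in> verts I - M h" for v
      using Hh that by simp
    show "M h \<subseteq> M h'" if "h' \<in> {h..g}" for h'
      using H(4)[OF h(1)] that by simp
  qed
qed

text \<open>All levels passed are recorded with the present \<open>X\<close>, since no agent is sent
  in between. Per level, each unfinished subtree loses \<open>2\<close> units of cost, and a level
  has at most one recorded ancestor per unfinished subtree.\<close>

lemma history_raise:
  assumes F: "forest \<T> X" and H: "history g ds M A \<T> X"
    and g': "g \<le> g'" "g' \<le> budget I" "\<And>S. S \<in> \<T> \<Longrightarrow> \<not> S \<subseteq> X \<Longrightarrow> g' \<le> depth I (top_of I S)"
  obtains M' A' where "history g' ds M' A' \<T> X"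
    "2 * (\<Sum>h=1..g'. card (A' h)) + potential g' \<T> X \<le> 2 * (\<Sum>h=1..g. card (A h)) + potential g \<T> X"
proof -
  note F' = forestD[OF F] and H' = historyD[OF H]
  define N where "N = {S \<in> \<T>. \<not> S \<subseteq> X}"
  define M' where "M' = (\<lambda>h. if h \<le> g then M h else X)"
  define A' where "A' = (\<lambda>h. if h \<le> g then A h else {a. depth I a = h \<and> (\<exists>S\<in>N. a \<in> ancestors (top_of I S))})"
  have finN: "finite N"
    using F'(1) by (simp add: N_def)
  have top: "top_of I S \<in> X" "top_of I S \<in> verts I" "subtree S (top_of I S)" "g' \<le> depth I (top_of I S)"
    if "S \<in> N" for S
    using that forest_subtree[OF F, of S] F'(2) g'(3) by (auto simp: N_def)
  have A'X: "A' h \<subseteq> X" if "g < h" for h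
    using that top(1) ancestor_closedD[OF F'(4)] by (auto simp: A'_def)
  \<comment> \<open>An unexplored vertex belongs to an unfinished subtree, whose top is at depth at
    least \<open>h\<close>; the ancestor of that top at depth \<open>h\<close> is also above the
    vertex.\<close>
  have cover: "ancestors v \<inter> A' h \<noteq> {}" if h: "g < h" "h \<le> g'" and v: "v \<in> verts I - X" for h v
  proof -
    obtain S where S: "S \<in> \<T>" "v \<in> S"
      using F'(7) v by blast
    then have SN: "S \<in> N"
      using v by (auto simp: N_def)
    obtain a where a: "a \<in> ancestors (top_of I S)" "depth I a = h"
      using ancestor_at_depth[OF top(2)[OF SN], of h] top(4)[OF SN] h(2) by (metis order_trans)
    have "a \<in> ancestors v"
      using subtreeD(3)[OF top(3)[OF SN] S(2)] ancestors_trans[of v] v a(1) by blast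
    moreover have "a \<in> A' h"
      using a SN h by (auto simp: A'_def)
    ultimately show ?thesis
      by blast
  qed
  have card: "card (A' h) \<le> card N" if h: "g < h" "h \<le> g'" for h
  proof -
    define f where "f = (\<lambda>S. THE a. a \<in> ancestors (top_of I S) \<and> depth I a = h)"
    have "A' h \<subseteq> f ` N"
    proof
      fix a assume "a \<in> A' h"
      then obtain S where S: "S \<in> N" "a \<in> ancestors (top_of I S)" "depth I a = h"
        using h by (auto simp: A'_def)
      then have "f S = a"
        unfolding f_def using ancestor_at_depth_unique[OF top(2)[OF S(1)]] by (intro the_equality) auto
      then show "a \<in> f ` N"
        using S(1) by blast
    qed
    then show ?thesis
      using finN surj_card_le by blast
  qed
  have "history g' ds M' A' \<T> X"
    unfolding history_def
  proof (intro conjI ballI impI)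
    show "g' \<le> budget I" "card X \<le> 1 + (\<Sum>d\<leftarrow>ds. budget I - d)"
      using g' H'(5) by auto
    show "d \<le> g'" if "d \<in> set ds" for d
      using H'(2)[OF that] g'(1) by simp
    show "g' \<le> depth I (top_of I S)" if "S \<in> \<T>" "\<not> S \<subseteq> X" for S
      using g'(3) that by blast
    fix h assume h: "h \<in> {1..g'}"
    have ds: "filter (\<lambda>d. d < h) ds = ds" if "g < h"
      using H'(2) that by (auto simp: filter_id_conv intro: le_less_trans)
    have old: "h \<le> g \<Longrightarrow> 1 \<le> h"
      using h by simp
    show "M' h \<subseteq> X" "root I \<in> M' h" "ancestor_closed (M' h)"
      using H'(3)[OF old] F'(3,4) by (simp_all add: M'_def)
    show "A' h \<subseteq> M' h"
      using H'(3)[OF old] A'X[of h] by (cases "h \<le> g") (auto simp: M'_def A'_def)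
    show "card (M' h) \<le> 1 + (\<Sum>d\<leftarrow>filter (\<lambda>d. d < h) ds. budget I - d)"
      using H'(3)[OF old] H'(5) ds by (cases "h \<le> g") (simp_all add: M'_def)
    show "depth I a = h" if "a \<in> A' h" for a
      using H'(3)[OF old] that by (cases "h \<le> g") (auto simp: A'_def)
    show "ancestors v \<inter> A' h \<noteq> {}" if "v \<in> verts I - M' h" for v
      using H'(3)[OF old] cover[of h v] that h by (cases "h \<le> g") (simp_all add: M'_def A'_def)
    fix h' assume "h' \<in> {h..g'}"
    then show "M' h \<subseteq> M' h'"
      using H'(3)[OF old] H'(4)[OF old] by (auto simp: M'_def)
  qed
  moreover have "2 * (\<Sum>h=1..g'. card (A' h)) + potential g' \<T> X \<le> 2 * (\<Sum>h=1..g. card (A h)) + potential g \<T> X"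
  proof -
    have "{1..g'} = {1..g} \<union> {g<..g'}"
      using g'(1) by auto
    then have "(\<Sum>h=1..g'. card (A' h)) = (\<Sum>h=1..g. card (A' h)) + (\<Sum>h\<in>{g<..g'}. card (A' h))"
      by (simp only:) (rule sum.union_disjoint; auto)
    also have "(\<Sum>h=1..g. card (A' h)) = (\<Sum>h=1..g. card (A h))"
      by (intro sum.cong) (auto simp: A'_def)
    also have "(\<Sum>h\<in>{g<..g'}. card (A' h)) \<le> (g' - g) * card N"
      using sum_bounded_above[of "{g<..g'}" "\<lambda>h. card (A' h)" "card N"] card by simp
    finally have 1: "(\<Sum>h=1..g'. card (A' h)) \<le> (\<Sum>h=1..g. card (A h)) + (g' - g) * card N"
      by simp
    have "potential g \<T> X = (\<Sum>S\<in>N. cost g (S - X))" for g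
      unfolding potential_def using F'(1) by (intro sum.mono_neutral_right) (auto simp: N_def cost_def)
    moreover have "(\<Sum>S\<in>N. cost g (S - X)) = (\<Sum>S\<in>N. 2 * (g' - g) + cost g' (S - X))"
      using g' by (intro sum.cong) (auto simp: N_def cost_def)
    ultimately have "potential g \<T> X = 2 * ((g' - g) * card N) + potential g' \<T> X"
      by (simp add: sum.distrib)
    then show ?thesis
      using 1 by linarith
  qed
  ultimately show thesis
    using that by blast
qed

section \<open>One iteration of the loop\<close>

text \<open>Twice the lower bound on three times the number of explored vertices, with
  \<open>p\<close> as the credit still available.\<close>

definition accounted :: "nat \<Rightarrow> nat list \<Rightarrow> (nat \<Rightarrow> 'v set) \<Rightarrow> nat \<Rightarrow> 'v set \<Rightarrow> bool" where
  "accounted g ds A p X \<longleftrightarrow>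
     6 + 2 * (\<Sum>d\<leftarrow>ds. budget I - d) + 2 * (\<Sum>h=1..g. card (A h)) + p \<le> 6 * card X"

lemma send_Suc: "0 < n \<Longrightarrow> send I D S u (n, \<T>, X) = (n - 1, \<T>, X \<union> set (dfs_agent I D S u X))"
  by (cases n) auto

lemma candidates_nonempty:
  assumes F: "forest \<T> X" and inc: "\<not> verts I \<subseteq> X"
  shows "candidates I \<T> X \<noteq> {}"
proof -
  note F' = forestD[OF F]
  define N where "N = {S \<in> \<T>. \<not> S \<subseteq> X}"
  have "finite N" "N \<noteq> {}"
    using F'(1,7) inc by (auto simp: N_def)
  then obtain S where "S \<in> N" "\<forall>S'\<in>N. depth I (top_of I S) \<le> depth I (top_of I S')"
    using ex_min_if_finite[of "(\<lambda>S. depth I (top_of I S)) ` N"] by (force simp: not_less)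
  then show ?thesis
    by (auto simp: candidates_def N_def)
qed

text \<open>The credit is meant for agents still to come and is dropped when none is left. This
  covers a divide step with a single remaining agent, after which one half has not been
  searched.\<close>

lemma explore_step:
  assumes pick: "tie_breaking pick" and F: "forest \<T> X" and inc: "\<not> verts I \<subseteq> X" and n: "0 < n"
    and H: "history g ds M A \<T> X" and acc: "accounted g ds A (potential g \<T> X) X"
  obtains n' \<T>' X' g' ds' M' A' where "explore_step I pick (n, \<T>, X) = (n', \<T>', X')" "n' < n"
    "length ds' = length ds + (n - n')" "forest \<T>' X'" "history g' ds' M' A' \<T>' X'"
    "accounted g' ds' A' (if n' = 0 then 0 else potential g' \<T>' X') X'"
proof -
  note result = that
  define \<T>1 where "\<T>1 = shrink I X ` \<T>"
  note sh = shrink_forest[OF F, folded \<T>1_def]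
  define S where "S = pick (n, \<T>1, X) (candidates I \<T>1 X)"
  have "S \<in> candidates I \<T>1 X"
    using pick candidates_nonempty[OF sh(1) inc] unfolding tie_breaking_def S_def by blast
  then have S: "S \<in> \<T>1" "\<not> S \<subseteq> X"
    and least: "\<And>S'. S' \<in> \<T>1 \<Longrightarrow> \<not> S' \<subseteq> X \<Longrightarrow> depth I (top_of I S) \<le> depth I (top_of I S')"
    by (auto simp: candidates_def)
  \<comment> \<open>The minimum is raised before any agent is sent, so that the levels passed are
    recorded with the current \<open>X\<close> and the new agents are charged at
    \<open>g'\<close>.\<close>
  define g' where "g' = depth I (top_of I S)"
  have H1: "history g ds M A \<T>1 X"
    using H sh(4) historyD(6)[OF H] unfolding history_def by (meson order_trans)
  have "g \<le> g'"
    using historyD(6)[OF H1 S] by (simp add: g'_def)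
  moreover have "g' \<le> budget I"
    using forestD(5)[OF sh(1)] forest_subtree(2)[OF sh(1) S(1)] by (simp add: g'_def)
  ultimately obtain M' A' where H': "history g' ds M' A' \<T>1 X"
    and pot: "2 * (\<Sum>h=1..g'. card (A' h)) + potential g' \<T>1 X \<le> 2 * (\<Sum>h=1..g. card (A h)) + potential g \<T>1 X"
    using history_raise[OF sh(1) H1, of g'] least by (metis g'_def)
  have acc': "6 + 2 * (\<Sum>d\<leftarrow>ds. budget I - d) + 2 * (\<Sum>h=1..g'. card (A' h)) + potential g' \<T>1 X \<le> 6 * card X"
    using acc pot sh(2)[of g] by (simp add: accounted_def)
  note sub = forest_subtree[OF sh(1) S(1)]
  have fr: "outermost_unexplored I D X S = front D (S - X)" for D
    using outermost_unexplored[OF sub(1,2) S(2)] .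
  have search: thesis
    if D: "close_enough I S (front D (S - X))"
      "explore_step I pick (n, \<T>, X) = send I D S (front D (S - X)) (n, \<T>1, X)" for D
  proof -
    define X' where "X' = X \<union> set (dfs_agent I D S (front D (S - X)) X)"
    note st = search_step[OF sh(1) S g'_def[symmetric] D(1), folded X'_def]
    have "explore_step I pick (n, \<T>, X) = (n - 1, \<T>1, X')"
      using D(2) n by (simp add: send_Suc X'_def)
    moreover have "n - 1 < n" "length (ds @ replicate 1 g') = length ds + (n - (n - 1))"
      using n by auto
    moreover have "history g' (ds @ replicate 1 g') M' A' \<T>1 X'"
      by (rule history_extend[OF H' st(2)]) (use st(2,3) least g'_def in auto)
    moreover have "accounted g' (ds @ replicate 1 g') A' (if n - 1 = 0 then 0 else potential g' \<T>1 X') X'"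
      using acc' st(4) by (simp add: accounted_def)
    ultimately show thesis
      using result st(1) by blast
  qed
  show thesis
  proof (cases "close_enough I S (front L (S - X)) \<or> close_enough I S (front R (S - X))")
    case True
    then show thesis
      using search[of L] search[of R]
      by (cases "close_enough I S (front L (S - X))")
        (simp_all add: Let_def fr \<T>1_def[symmetric] S_def[symmetric])
  next
    case False
    then have far: "\<not> close_enough I S (front L (S - X))" "\<not> close_enough I S (front R (S - X))"
      by auto
    define v where "v = (THE c. c \<in> set (children I L S (top_of I S)) \<and> front R (S - X) \<in> below I c)"
    define S1 where "S1 = S - below I v"
    define S2 where "S2 = insert (top_of I S) (S \<inter> below I v)"
    define \<T>2 where "\<T>2 = (\<T>1 - {S}) \<union> {S1, S2}"
    define X1 where "X1 = X \<union> set (dfs_agent I R S1 (top_of I S) X)"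
    define X2 where "X2 = X1 \<union> set (dfs_agent I L S2 (top_of I S) X1)"
    note st = split_step[OF sh(1) S g'_def[symmetric] sh(3)[OF S] far, folded v_def, folded S1_def S2_def,
        folded \<T>2_def X1_def, folded X2_def]
    have step: "explore_step I pick (n, \<T>, X) =
        send I L S2 (top_of I S) (send I R S1 (top_of I S) (n, \<T>2, X))"
      using far by (simp add: Let_def fr \<T>1_def[symmetric] S_def[symmetric] v_def[symmetric]
          S1_def[symmetric] S2_def[symmetric] \<T>2_def)
    have tops: "g' \<le> depth I (top_of I S')" if "S' \<in> \<T>2" "\<not> S' \<subseteq> X" for S'
      using st(9)[OF that(1)] least that(2) g'_def by auto
    show thesis
    proof (cases "n = 1")
      case True
      have "explore_step I pick (n, \<T>, X) = (0, \<T>2, X1)"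
        unfolding step using True by (simp add: send_Suc X1_def)
      moreover have "0 < n" "length (ds @ replicate 1 g') = length ds + (n - 0)"
        using True by auto
      moreover have "history g' (ds @ replicate 1 g') M' A' \<T>2 X1"
        by (rule history_extend[OF H' st(2)]) (use st(2,3) tops in auto)
      moreover have "accounted g' (ds @ replicate 1 g') A' (if (0::nat) = 0 then 0 else potential g' \<T>2 X1) X1"
        using acc' st(4) by (simp add: accounted_def)
      ultimately show thesis
        using result st(1) by blast
    next
      case False
      have "explore_step I pick (n, \<T>, X) = (n - 2, \<T>2, X2)"
        unfolding step using False n by (simp add: send_Suc X1_def X2_def numeral_2_eq_2)
      moreover have "n - 2 < n" "length (ds @ replicate 2 g') = length ds + (n - (n - 2))"
        using False n by auto
      moreover have "history g' (ds @ replicate 2 g') M' A' \<T>2 X2"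
      proof (rule history_extend[OF H'])
        show "X \<subseteq> X2" "card X2 \<le> card X + 2 * (budget I - g')"
          using st(2,6,7) by simp_all
        show "g' \<le> depth I (top_of I S')" if "S' \<in> \<T>2" "\<not> S' \<subseteq> X2" for S'
          using tops[OF that(1)] that(2) st(2,6) by blast
      qed
      moreover have "accounted g' (ds @ replicate 2 g') A' (if n - 2 = 0 then 0 else potential g' \<T>2 X2) X2"
        using acc' st(8) by (simp add: accounted_def sum_list_replicate)
      ultimately show thesis
        using result[of "n - 2" \<T>2 X2 "ds @ replicate 2 g'" g' M' A'] st(5) by blast
    qed
  qed
qed

section \<open>Comparison with the optimum\<close>

text \<open>Each edge of the walk leads to the parent of the previous vertex, which has been visited
  already, or to one of its children.\<close>

lemma walk_ancestor_closed:
  assumes "walk I p" "hd p = root I"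
  shows "ancestor_closed (set p)"
  using assms
proof (induction p rule: rev_induct)
  case (snoc v p)
  show ?case
  proof (cases "p = []")
    case True
    then show ?thesis
      using snoc.prems by (simp add: ancestor_closed_def)
  next
    case False
    then have w: "walk I p" "hd p = root I" and e: "{last p, v} \<in> edges I"
      using snoc.prems by (auto simp: walk_def successively_append_iff)
    have cl: "ancestor_closed (set p)"
      using snoc.IH w by blast
    then have "ancestors (last p) \<subseteq> set p"
      using False by (simp add: ancestor_closed_def)
    then have "ancestors v \<subseteq> insert v (set p)"
      using path_to_edge[OF e] by auto
    then show ?thesis
      using cl by (auto simp: ancestor_closed_def)
  qed
qed (simp add: walk_def)

text \<open>A walk leaving \<open>M0 h0\<close> spends \<open>h0 + 1\<close> of its at most
  \<open>B + 1\<close> vertices inside \<open>M0 h0\<close> and one in \<open>A h\<close> for each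
  higher level \<open>h\<close> that it leaves. The same balance holds with equality for the later
  agents, by \<open>sum_list_tail_depths\<close>. There are at most as many such walks as later
  agents, and by maximality of \<open>h0\<close> every higher level is left by more walks than it
  has later agents, so the remaining vertices \<open>q i\<close> number at most the sum of
  \<open>B - d\<close> over the later agents.\<close>

lemma history_covers_walks:
  assumes H: "history g ds M A \<T> X" and w: "feasible_walks I w" and len: "length ds = agents I"
    and XV: "X \<subseteq> verts I"
  shows "card (\<Union>i<agents I. set (w i)) \<le> 1 + (\<Sum>d\<leftarrow>ds. budget I - d) + (\<Sum>h=1..g. card (A h))"
proof -
  define B where "B = budget I"
  define k where "k = agents I"
  define p where "p = (\<lambda>i. set (w i))"
  note H' = historyD[OF H, folded B_def]
  have gB: "g \<le> B"
    using H'(1) .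
  \<comment> \<open>The history has no level \<open>0\<close>; \<open>{root I}\<close> takes its
    place, with an empty sum in the bound on its size.\<close>
  define M0 where "M0 = (\<lambda>h. if h = 0 then {root I} else M h)"
  define W where "W = (\<lambda>h. {i. i < k \<and> \<not> p i \<subseteq> M0 h})"
  define n where "n = (\<lambda>h. length (filter (\<lambda>d. d < h) ds))"
  have p: "p i \<subseteq> verts I" "root I \<in> p i" "ancestor_closed (p i)" "card (p i) \<le> Suc B" if "i < k" for i
  proof -
    have wi: "walk I (w i)" "hd (w i) = root I" "length (w i) - 1 \<le> B"
      using w that by (auto simp: feasible_walks_def k_def B_def)
    then show "p i \<subseteq> verts I" "root I \<in> p i"
      unfolding p_def walk_def by (auto intro: hd_in_set simp flip: wi(2))
    show "ancestor_closed (p i)"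
      unfolding p_def using walk_ancestor_closed wi by blast
    show "card (p i) \<le> Suc B"
      unfolding p_def using card_length[of "w i"] wi(3) by linarith
  qed
  have fin: "finite (p i)" for i
    by (simp add: p_def)
  have finW: "finite (W h)" for h
    by (simp add: W_def)
  have Wk: "card (W h) \<le> k" for h
    using card_mono[of "{..<k}" "W h"] by (auto simp: W_def)
  \<comment> \<open>Level \<open>0\<close> qualifies because no agent has an entry below
    \<open>0\<close>, so the maximum exists.\<close>
  define C where "C = {h. h \<le> g \<and> card (W h) + n h \<le> k}"
  have C: "finite C" "0 \<in> C"
    using Wk by (auto simp: C_def n_def)
  define h0 where "h0 = Max C"
  have "h0 \<in> C"
    using C Max_in h0_def by blast
  then have h0: "h0 \<le> g" "card (W h0) + n h0 \<le> k"
    by (auto simp: C_def)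
  have above: "k < card (W h) + n h" if "h0 < h" "h \<le> g" for h
  proof (rule ccontr)
    assume "\<not> k < card (W h) + n h"
    then have "h \<in> C"
      using that(2) by (simp add: C_def)
    then show False
      using Max_ge[OF C(1)] that(1) h0_def by fastforce
  qed
  define H where "H = {h0<..g}"
  have M0mono: "M0 h0 \<subseteq> M0 h" if "h \<in> H" for h
    using that H'(3)[of h] H'(4)[of h0 h] by (auto simp: H_def M0_def)
  have WH: "W h \<subseteq> W h0" if "h \<in> H" for h
    using M0mono[OF that] by (auto simp: W_def)
  define LL where "LL = (\<Union>h\<in>H. A h)"
  define q where "q = (\<lambda>i. p i - M0 h0 - LL)"
  have meet: "\<exists>a\<in>p i \<inter> A h. depth I a = h \<and> ancestors a \<subseteq> M0 h \<inter> p i"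
    if i: "i \<in> W h" and h: "1 \<le> h" "h \<le> g" for i h
  proof -
    obtain v where v: "v \<in> p i" "v \<notin> M0 h" "i < k"
      using i by (auto simp: W_def)
    then have "v \<in> verts I - M h"
      using p(1) h by (auto simp: M0_def)
    then obtain a where a: "a \<in> ancestors v" "a \<in> A h"
      using H'(3)[OF h] by blast
    have ap: "a \<in> p i"
      using a(1) ancestor_closedD[OF p(3)[OF v(3)] v(1)] by blast
    have "a \<in> M h"
      using H'(3)[OF h] a(2) by blast
    then have "ancestors a \<subseteq> M0 h"
      using H'(3)[OF h] ancestor_closedD[of "M h" a] h by (auto simp: M0_def)
    moreover have "ancestors a \<subseteq> p i"
      using ancestor_closedD[OF p(3)[OF v(3)] ap] .
    moreover have "depth I a = h"
      using H'(3)[OF h] a(2) by blast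
    ultimately show ?thesis
      using ap a(2) by blast
  qed
  have q: "card (q i) + h0 + card {h \<in> H. i \<in> W h} \<le> B" if i: "i \<in> W h0" for i
  proof -
    have ik: "i < k"
      using i by (simp add: W_def)
    \<comment> \<open>The ancestors of the recorded vertex at depth \<open>h0\<close> which the walk
      passes; for \<open>h0 = 0\<close> just the root.\<close>
    obtain C0 where C0: "C0 \<subseteq> p i" "C0 \<subseteq> M0 h0" "card C0 = Suc h0" "\<forall>a\<in>C0. depth I a \<le> h0"
    proof (cases "h0 = 0")
      case True
      then show thesis
        using that[of "{root I}"] p(2)[OF ik] by (simp add: M0_def)
    next
      case False
      then obtain a where a: "a \<in> p i" "depth I a = h0" "ancestors a \<subseteq> M0 h0 \<inter> p i"
        using meet[OF i] h0(1) by auto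
      have "a \<in> verts I"
        using a(1) p(1)[OF ik] by blast
      then show thesis
        using that[of "ancestors a"] a card_ancestors ancestor_depth(1) by auto
    qed
    define Hi where "Hi = {h \<in> H. i \<in> W h}"
    have "\<exists>f. \<forall>h\<in>Hi. f h \<in> p i \<inter> A h \<and> depth I (f h) = h"
    proof (rule bchoice, rule ballI)
      fix h assume "h \<in> Hi"
      then have "i \<in> W h" "1 \<le> h" "h \<le> g"
        by (auto simp: Hi_def H_def)
      then show "\<exists>a. a \<in> p i \<inter> A h \<and> depth I a = h"
        using meet by blast
    qed
    then obtain f where f: "\<And>h. h \<in> Hi \<Longrightarrow> f h \<in> p i \<inter> A h \<and> depth I (f h) = h"
      by blast
    have inj: "inj_on f Hi"
      using f by (metis inj_onI)
    have finH: "finite Hi"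
      by (simp add: Hi_def H_def)
    have fH: "f ` Hi \<subseteq> p i" "f ` Hi \<subseteq> LL"
      using f by (auto simp: LL_def Hi_def)
    have disj: "C0 \<inter> f ` Hi = {}"
    proof -
      have "depth I a > h0" if "a \<in> f ` Hi" for a
        using that f by (auto simp: Hi_def H_def)
      then show ?thesis
        using C0(4) by (meson disjoint_iff not_le)
    qed
    have finC0: "finite C0"
      using C0(1) fin finite_subset by blast
    \<comment> \<open>The recorded vertices have distinct depths above \<open>h0\<close>, whereas
      \<open>C0\<close> reaches at most depth \<open>h0\<close>; \<open>q i\<close> avoids both by
      definition.\<close>
    have "card (q i) + (card C0 + card (f ` Hi)) = card (q i \<union> (C0 \<union> f ` Hi))"
      using C0(2) fH(2) finC0 finH fin disj
      by (subst card_Un_disjoint; (subst card_Un_disjoint)?) (auto simp: q_def)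
    also have "\<dots> \<le> card (p i)"
      using C0(1) fH(1) fin by (intro card_mono) (auto simp: q_def)
    also have "\<dots> \<le> Suc B"
      using p(4)[OF ik] .
    finally show ?thesis
      using C0(3) card_image[OF inj] by (simp add: Hi_def)
  qed
  have cover: "(\<Union>i<k. p i) \<subseteq> M0 h0 \<union> LL \<union> (\<Union>i\<in>W h0. q i)"
    by (auto simp: q_def W_def)
  have finX: "finite X"
    using XV finite_subset finite_verts by blast
  have finM: "finite (M h)" "finite (A h)" if "1 \<le> h" "h \<le> g" for h
    using H'(3)[OF that] finX finite_subset by metis+
  have finM0: "finite (M0 h0)"
    using finM(1)[of h0] h0(1) by (auto simp: M0_def)
  have finLL: "finite LL"
    using finM(2) by (auto simp: LL_def H_def)
  have "card (\<Union>i<k. p i) \<le> card (M0 h0 \<union> LL \<union> (\<Union>i\<in>W h0. q i))"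
    using cover finM0 finLL finW fin by (intro card_mono) (auto simp: q_def)
  also have "\<dots> \<le> card (M0 h0) + card LL + card (\<Union>i\<in>W h0. q i)"
    using card_Un_le[of "M0 h0 \<union> LL" "\<Union>i\<in>W h0. q i"] card_Un_le[of "M0 h0" LL] by linarith
  finally have 1: "card (\<Union>i<k. p i) \<le> card (M0 h0) + card LL + card (\<Union>i\<in>W h0. q i)" .
  have 2: "card (M0 h0) \<le> 1 + (\<Sum>d\<leftarrow>filter (\<lambda>d. d < h0) ds. B - d)"
    using H'(3)[of h0] h0(1) by (cases "h0 = 0") (auto simp: M0_def)
  have "card LL \<le> (\<Sum>h\<in>H. card (A h))"
    unfolding LL_def by (rule card_UN_le) (simp add: H_def)
  also have "\<dots> \<le> (\<Sum>h=1..g. card (A h))"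
    by (rule sum_mono2) (auto simp: H_def)
  finally have 3: "card LL \<le> (\<Sum>h=1..g. card (A h))" .
  have 4: "card (\<Union>i\<in>W h0. q i) \<le> (\<Sum>i\<in>W h0. card (q i))"
    by (rule card_UN_le[OF finW])
  \<comment> \<open>Double counting of pairs of a walk and a higher level that it leaves.\<close>
  have "(\<Sum>i\<in>W h0. card {h \<in> H. i \<in> W h}) = (\<Sum>h\<in>H. card (W h))"
  proof (rule sum_multicount_gen)
    show "\<forall>h\<in>H. card {i \<in> W h0. i \<in> W h} = card (W h)"
      using WH by (metis Collect_mem_eq Int_def inf.absorb2)
  qed (simp_all add: finW H_def)
  moreover have "(\<Sum>i\<in>W h0. card (q i) + h0 + card {h \<in> H. i \<in> W h}) \<le> card (W h0) * B"
    using sum_bounded_above[of "W h0" "\<lambda>i. card (q i) + h0 + card {h \<in> H. i \<in> W h}" B] q by simp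
  ultimately have 5: "(\<Sum>i\<in>W h0. card (q i)) + card (W h0) * h0 + (\<Sum>h\<in>H. card (W h)) \<le> card (W h0) * B"
    by (simp add: sum.distrib)
  define m where "m = length (filter (\<lambda>d. h0 \<le> d) ds)"
  have compl: "length (filter (\<lambda>d. h \<le> d) ds) + n h = k" for h
    using sum_length_filter_compl[of "\<lambda>d. d < h" ds] len by (simp add: n_def k_def not_less)
  have 6: "(\<Sum>d\<leftarrow>filter (\<lambda>d. h0 \<le> d) ds. B - d) + m * h0 + (\<Sum>h\<in>H. length (filter (\<lambda>d. h \<le> d) ds)) = m * B"
    unfolding m_def H_def by (rule sum_list_tail_depths) (use H'(2) gB in auto)
  have 7: "(\<Sum>h\<in>H. length (filter (\<lambda>d. h \<le> d) ds)) \<le> (\<Sum>h\<in>H. card (W h))"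
  proof (rule sum_mono)
    fix h assume "h \<in> H"
    then show "length (filter (\<lambda>d. h \<le> d) ds) \<le> card (W h)"
      using above[of h] compl[of h] by (auto simp: H_def)
  qed
  have "card (W h0) \<le> m"
    using h0(2) compl[of h0] by (simp add: m_def)
  then have "card (W h0) * (B - h0) \<le> m * (B - h0)"
    by (rule mult_le_mono1)
  moreover have eq: "x * B = x * (B - h0) + x * h0" for x
    using h0(1) gB by (simp flip: distrib_left)
  ultimately have 8: "card (W h0) * B + m * h0 \<le> m * B + card (W h0) * h0"
    unfolding eq[of m] eq[of "card (W h0)"] by linarith
  have "(\<Sum>d\<leftarrow>ds. B - d) = (\<Sum>d\<leftarrow>filter (\<lambda>d. d < h0) ds. B - d) + (\<Sum>d\<leftarrow>filter (\<lambda>d. h0 \<le> d) ds. B - d)"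
    by (induction ds) auto
  then have "card (\<Union>i<k. p i) \<le> 1 + (\<Sum>d\<leftarrow>ds. B - d) + (\<Sum>h=1..g. card (A h))"
    using 1 2 3 4 5 6 7 8 by linarith
  then show ?thesis
    by (simp add: p_def k_def B_def)
qed

section \<open>Simple bounds on the optimum\<close>

lemma opt_le:
  assumes "\<And>w. feasible_walks I w \<Longrightarrow> card (\<Union>i<agents I. set (w i)) \<le> b"
  shows "opt I \<le> b"
proof -
  define C where "C = {card (\<Union>i<agents I. set (w i)) | w. feasible_walks I w}"
  have "C \<subseteq> {..b}"
    using assms by (auto simp: C_def)
  then have fin: "finite C"
    using finite_subset by blast
  have "feasible_walks I (\<lambda>_. [root I])"
    by (simp add: feasible_walks_def walk_def)
  then have "C \<noteq> {}"
    by (auto simp: C_def)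
  then have "Max C \<in> C"
    using fin Max_in by blast
  then show ?thesis
    using \<open>C \<subseteq> {..b}\<close> by (auto simp: opt_def C_def)
qed

lemma opt_le_verts: "opt I \<le> card (verts I)"
  by (rule opt_le, rule card_mono) (auto simp: feasible_walks_def walk_def)

lemma opt_le_single:
  assumes "agents I = 1" shows "opt I \<le> Suc (budget I)"
proof (rule opt_le)
  fix w assume "feasible_walks I w"
  then have "length (w 0) - 1 \<le> budget I"
    using assms by (simp add: feasible_walks_def)
  then show "card (\<Union>i<agents I. set (w i)) \<le> Suc (budget I)"
    using assms card_length[of "w 0"] by (simp add: lessThan_Suc)
qed

section \<open>The first two agents\<close>

lemma dfs_steps_complete: "S \<subseteq> X \<Longrightarrow> dfs_steps I D S e v X = []"
  by (cases e) auto

lemma subtree_verts: "subtree (verts I) (root I)"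
  unfolding subtree_def using root_ancestor ancestor_vertsD by auto

text \<open>At the start only the root is explored, so the root can be the anchor. The distance to
  the root left over at the end is at least that of the parent of the left front; it prepays the way
  of the second agent. The summand \<open>2\<close> counts the root.\<close>

lemma first_agent:
  defines "X \<equiv> set (dfs_agent I L (verts I) (root I) {})"
  shows "root I \<in> X" "X \<subseteq> verts I"
    and "\<not> verts I \<subseteq> X \<Longrightarrow> forest {verts I} X"
    and "\<not> verts I \<subseteq> X \<Longrightarrow> card X \<le> Suc (budget I)"
    and "\<not> verts I \<subseteq> X \<Longrightarrow>
      budget I + tdist (root I) (parent (front L (verts I - X))) + 2 \<le> 2 * card X"
    and "\<And>c u. c \<in> X \<Longrightarrow> u \<in> verts I - X \<Longrightarrow> key L c \<le> key L u"
proof -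
  let ?r = "root I" and ?V = "verts I" and ?B = "budget I"
  have X: "X = {?r} \<union> set (dfs_steps I L ?V ?B ?r {?r})"
    by (simp add: X_def dfs_agent_def Let_def path_to_root)
  have s: "searching L ?V ?r {?r} ?r"
  proof (rule searchingI)
    fix y u assume "y \<in> ancestors ?r" "u \<in> ?V - {?r}"
    then show "y \<in> ancestors (front L (?V - {?r}))"
      using front(1)[of "?V - {?r}" L] root_ancestor by auto
  qed (use root_ancestor in auto)
  note run = searching_run[OF subtree_verts s, where e = ?B, folded X, simplified]
  show "?r \<in> X"
    by (simp add: X)
  show XV: "X \<subseteq> ?V"
    using run(1) by auto
  have fin: "finite X"
    using XV finite_subset finite_verts by blast
  have card: "card (X - {?r}) = card X - 1" "1 \<le> card X"
    using fin \<open>?r \<in> X\<close> by (auto simp: card_gt_0_iff Suc_le_eq)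
  show ord: "key L c \<le> key L u" if "c \<in> X" "u \<in> ?V - X" for c u
    using that run(5)[of c u] by (cases "c = ?r") auto
  have cl: "ancestor_closed X"
    using run(2) \<open>?r \<in> X\<close> unfolding ancestor_closed_def by (metis DiffI ancestors_root empty_iff insert_iff subset_iff)
  assume inc: "\<not> ?V \<subseteq> X"
  show "card X \<le> Suc ?B"
    using run(4) card by simp
  have ordered: "ordered ?V X"
    using ord unfolding ordered_def by blast
  show "forest {?V} X"
    unfolding forest_def
  proof (intro conjI)
    show "\<forall>v\<in>X. depth I v \<le> ?B"
      using run(3) by (metis DiffI depth_root empty_iff insert_iff zero_le)
    show "\<forall>S\<in>{?V}. \<exists>t\<in>X. subtree S t \<and> ordered S X"
      using subtree_verts ordered \<open>?r \<in> X\<close> by blast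
  qed (use XV cl \<open>?r \<in> X\<close> in auto)
  obtain x where x: "searching L ?V ?r X x" "?B + tdist x ?r \<le> 2 * card (X - {?r}) + tdist ?r ?r"
    using run(6) inc by blast
  note pf = parent_front[OF subtree_verts \<open>?r \<in> X\<close> cl inc, where D = L]
  define y where "y = parent (front L (?V - X))"
  have xV: "x \<in> ?V"
    using searchingD(1)[OF x(1)] .
  have "y \<in> ancestors x \<or> y \<in> ancestors ?r"
    using searchingD(5)[OF x(1) pf(4,5,1) parent_ancestor[OF pf(2,3)]] by (simp add: y_def)
  then have "y \<in> ancestors x"
    using root_ancestor[OF xV] by auto
  then have "depth I y \<le> depth I x"
    using ancestor_depth(1)[OF xV] by blast
  then have "tdist ?r y \<le> tdist ?r x"
    using tdist_below[OF _ root_ancestor] xV parent_props(2)[OF pf(2,3)] by (simp add: y_def)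
  moreover have "tdist ?r ?r = 0"
    by (simp add: tdist_def)
  ultimately show "?B + tdist ?r (parent (front L (?V - X))) + 2 \<le> 2 * card X"
    using x(2) card by (simp add: y_def tdist_sym)
qed

text \<open>The second search starts at the root with the parent of the left front as its anchor, at
  exactly the distance saved by the first. Adding both bounds gives
  \<open>2 * B + 2 + gap \<le> 2 * card X2\<close>; three times this covers both agents and the cost
  of the initial subtree.\<close>

lemma first_two_agents:
  defines "X1 \<equiv> set (dfs_agent I L (verts I) (root I) {})"
  defines "X2 \<equiv> X1 \<union> set (dfs_agent I R (verts I) (root I) X1)"
  shows "X2 \<subseteq> verts I"
    and "\<not> verts I \<subseteq> X2 \<Longrightarrow> forest {verts I} X2 \<and> history 0 [0, 0] (\<lambda>_. {}) (\<lambda>_. {}) {verts I} X2 \<and>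
      accounted 0 [0, 0] (\<lambda>_. {}) (potential 0 {verts I} X2) X2"
proof -
  let ?r = "root I" and ?V = "verts I" and ?B = "budget I"
  note one = first_agent[folded X1_def]
  have X2: "X2 = X1 \<union> set (dfs_steps I R ?V ?B ?r X1)"
    unfolding X2_def using agent_from_explored[of ?r X1 R ?V] one(1) by simp
  define z where "z = parent (front L (?V - X1))"
  have main: "X2 \<subseteq> ?V \<and> (\<not> ?V \<subseteq> X2 \<longrightarrow> forest {?V} X2 \<and>
      card X2 \<le> 1 + 2 * ?B \<and> 6 + 4 * ?B + (2 * ?B + 3 * gap (?V - X2)) \<le> 6 * card X2)"
    if inc: "\<not> ?V \<subseteq> X1"
  proof -
    note F = one(3)[OF inc]
    note pf = parent_front[OF subtree_verts one(1) forestD(4)[OF F] inc, where D = L, folded z_def]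
    have U: "?V - X1 \<subseteq> ?V" "?V - X1 \<noteq> {}"
      using inc by auto
    have s: "searching R ?V z X1 ?r"
    proof (rule searchingI)
      show "?r \<in> ?V" "ancestors ?r \<subseteq> X1" "z \<in> ?V"
        using one(1) pf(4) by auto
      show "y \<in> ancestors (front R (?V - X1))" if "y \<in> ancestors ?r" for y
        using that root_ancestor front(1)[OF U] by auto
      show "c \<in> ancestors ?r \<or> c \<in> ancestors z"
        if c: "c \<in> ?V" "c \<in> X1" "u \<in> ?V - X1" "c \<in> ancestors u" for c u
        using parent_front_below[OF subtree_verts one(1) forestD(4)[OF F] c, of L] one(6)[OF c(2)]
        by (simp add: z_def)
      show "z \<in> ancestors y"
        if y: "y \<in> ?V - X1" "\<And>u. u \<in> ?V - X1 \<Longrightarrow> key R u \<le> key R y" for y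
      proof -
        have yV: "y \<in> ?V"
          using y by blast
        have "front L (?V - X1) \<in> ancestors y"
          using key_both_le[OF pf(2) yV, of L] y(2)[OF pf(1)] front(2)[OF U y(1), of L] by simp
        then show ?thesis
          using ancestors_trans[OF yV] parent_ancestor[OF pf(2,3)] by (auto simp: z_def)
      qed
    qed
    have e: "?B - depth I ?r = ?B"
      by simp
    note run = agent_run[OF F _ s inc, unfolded e, folded X2, simplified]
    have V: "X2 \<subseteq> ?V"
      using forestD(2)[OF run(1)] .
    then have "card X1 \<le> card X2"
      using card_mono[OF _ run(2)] finite_subset finite_verts by blast
    then show ?thesis
      using V run(1,3,4) one(4)[OF inc] one(5)[OF inc] by (auto simp: z_def)
  qed
  have complete: "X2 = X1" if "?V \<subseteq> X1"
    unfolding X2 using dfs_steps_complete[OF that] by simp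
  show "X2 \<subseteq> ?V"
    using main complete one(2) by (cases "?V \<subseteq> X1") auto
  assume inc: "\<not> ?V \<subseteq> X2"
  then have "\<not> ?V \<subseteq> X1"
    using complete by auto
  then have F: "forest {?V} X2" and c: "card X2 \<le> 1 + 2 * ?B"
    "6 + 4 * ?B + (2 * ?B + 3 * gap (?V - X2)) \<le> 6 * card X2"
    using main inc by blast+
  have "history 0 [0, 0] (\<lambda>_. {}) (\<lambda>_. {}) {?V} X2"
    using c(1) by (simp add: history_def)
  moreover have "accounted 0 [0, 0] (\<lambda>_. {}) (potential 0 {?V} X2) X2"
    using c(2) inc by (simp add: accounted_def potential_def cost_def)
  ultimately show "forest {?V} X2 \<and> history 0 [0, 0] (\<lambda>_. {}) (\<lambda>_. {}) {?V} X2 \<and>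
      accounted 0 [0, 0] (\<lambda>_. {}) (potential 0 {?V} X2) X2"
    using F by blast
qed

section \<open>The main loop\<close>

text \<open>Once the tree is explored completely, its size bounds the optimum, so the records are
  maintained only until then.\<close>

definition loop_invariant :: "'v state \<Rightarrow> bool" where
  "loop_invariant = (\<lambda>(n, \<T>, X). X \<subseteq> verts I \<and> n \<le> agents I \<and> (verts I \<subseteq> X \<or>
     (\<exists>g ds M A. length ds = agents I - n \<and> forest \<T> X \<and> history g ds M A \<T> X \<and>
        accounted g ds A (if n = 0 then 0 else potential g \<T> X) X)))"

text \<open>The amortization starts with two searches, so fewer agents are treated apart: without
  agents the optimum is \<open>0\<close>, and for one agent \<open>first_agent\<close> bounds the
  budget by twice the number of explored vertices.\<close>

lemma divide_explore_bound:
  assumes pick: "tie_breaking pick"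
  shows "opt I \<le> 3 * card (divide_explore I pick)"
proof -
  let ?r = "root I" and ?V = "verts I" and ?B = "budget I" and ?k = "agents I"
  define X1 where "X1 = set (dfs_agent I L ?V ?r {})"
  define X2 where "X2 = X1 \<union> set (dfs_agent I R ?V ?r X1)"
  define b :: "'v state \<Rightarrow> bool" where "b = (\<lambda>(n, \<T>, X). \<not> ?V \<subseteq> X \<and> n > 0)"
  define s0 where "s0 = send I R ?V ?r (send I L ?V ?r (?k, {?V}, {}))"
  have de: "divide_explore I pick = snd (snd (while b (explore_step I pick) s0))"
    by (simp add: divide_explore_def b_def s0_def case_prod_beta)
  have stop: "while b (explore_step I pick) s0 = s0" if "\<not> b s0"
    using that by (subst while_unfold) simp
  consider "?k = 0" | "?k = 1" | "?k \<ge> 2"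
    by linarith
  then show ?thesis
  proof cases
    case 1
    then have "opt I \<le> 0"
      by (intro opt_le) simp
    then show ?thesis
      by simp
  next
    case 2
    have s0: "s0 = (0, {?V}, X1)"
      using 2 by (simp add: s0_def send_Suc X1_def)
    then have res: "divide_explore I pick = X1"
      using stop by (simp add: de b_def)
    note one = first_agent[folded X1_def]
    show ?thesis
    proof (cases "?V \<subseteq> X1")
      case True
      then have "X1 = ?V"
        using one(2) by blast
      then show ?thesis
        using opt_le_verts res by simp
    next
      case False
      then show ?thesis
        using opt_le_single[OF 2] one(5) res by simp
    qed
  next
    case 3
    have s0: "s0 = (?k - 2, {?V}, X2)"
      using 3 by (simp add: s0_def send_Suc X1_def X2_def)
    note two = first_two_agents[folded X1_def, folded X2_def]
    have init: "loop_invariant s0"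
    proof (cases "?V \<subseteq> X2")
      case True
      then show ?thesis
        using two(1) by (simp add: loop_invariant_def s0)
    next
      case False
      note t = two(2)[OF False]
      have "accounted 0 [0, 0] (\<lambda>_. {}) (if ?k - 2 = 0 then 0 else potential 0 {?V} X2) X2"
        using t by (simp add: accounted_def)
      moreover have "length [0, 0 :: nat] = ?k - (?k - 2)"
        using 3 by simp
      moreover have "?k - 2 \<le> ?k"
        by simp
      ultimately show ?thesis
        unfolding loop_invariant_def s0 prod.case using t two(1) by blast
    qed
    have step: "loop_invariant (explore_step I pick s) \<and> fst (explore_step I pick s) < fst s"
      if "loop_invariant s" "b s" for s
    proof -
      obtain n \<T> X where s: "s = (n, \<T>, X)"
        by (cases s)
      have n: "0 < n" "\<not> ?V \<subseteq> X" "n \<le> ?k"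
        using that by (auto simp: s b_def loop_invariant_def)
      then have "\<exists>g ds M A. length ds = ?k - n \<and> forest \<T> X \<and> history g ds M A \<T> X \<and>
          accounted g ds A (potential g \<T> X) X"
        using that(1) unfolding s loop_invariant_def prod.case by simp
      then obtain g ds M A where H: "length ds = ?k - n" "forest \<T> X" "history g ds M A \<T> X"
        "accounted g ds A (potential g \<T> X) X"
        by blast
      obtain n' \<T>' X' g' ds' M' A' where r: "explore_step I pick (n, \<T>, X) = (n', \<T>', X')" "n' < n"
        "length ds' = length ds + (n - n')" "forest \<T>' X'" "history g' ds' M' A' \<T>' X'"
        "accounted g' ds' A' (if n' = 0 then 0 else potential g' \<T>' X') X'"
        using explore_step[OF pick H(2) n(2,1) H(3,4)] .
      have "length ds' = ?k - n'" "n' \<le> ?k"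
        using r(2,3) H(1) n(3) by auto
      then have "loop_invariant (n', \<T>', X')"
        unfolding loop_invariant_def prod.case using r(4-6) forestD(2)[OF r(4)] by blast
      then show ?thesis
        using r(1,2) s by simp
    qed
    define sf where "sf = while b (explore_step I pick) s0"
    have "loop_invariant sf \<and> \<not> b sf"
      unfolding sf_def
      by (rule while_rule[where P = loop_invariant and r = "measure fst"]) (use init step in auto)
    then obtain \<T> X n where sf: "sf = (n, \<T>, X)" "loop_invariant (n, \<T>, X)" "\<not> b (n, \<T>, X)"
      by (cases sf) auto
    have res: "divide_explore I pick = X"
      using sf(1) by (simp add: de sf_def)
    show ?thesis
    proof (cases "?V \<subseteq> X")
      case True
      then have "X = ?V"
        using sf(2) by (auto simp: loop_invariant_def)
      then show ?thesis
        using opt_le_verts res by simp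
    next
      case False
      then have "n = 0"
        using sf(3) by (simp add: b_def)
      then have "\<exists>g ds M A. length ds = ?k \<and> history g ds M A \<T> X \<and> accounted g ds A 0 X \<and> X \<subseteq> ?V"
        using sf(2) False unfolding loop_invariant_def prod.case by auto
      then obtain g ds M A where H: "length ds = ?k" "history g ds M A \<T> X"
        "accounted g ds A 0 X" "X \<subseteq> ?V"
        by blast
      have "opt I \<le> 1 + (\<Sum>d\<leftarrow>ds. ?B - d) + (\<Sum>h=1..g. card (A h))"
        using history_covers_walks[OF H(2) _ H(1,4)] by (rule opt_le)
      then show ?thesis
        using H(3) res by (simp add: accounted_def)
    qed
  qed
qed

end

theorem theorem1:
  fixes pick :: "'v tie_rule"
  assumes "tie_breaking pick"
  shows "competitive 3 (\<lambda>I. divide_explore I pick)"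
  unfolding competitive_def
proof (intro allI impI)
  fix I :: "'v exploration"
  assume "exploration_instance I"
  then interpret exploration_tree I
    by unfold_locales
  have "real (opt I) \<le> real (3 * card (divide_explore I pick))"
    using divide_explore_bound[OF assms] by (simp only: of_nat_le_iff)
  then show "real (opt I) \<le> 3 * real (card (divide_explore I pick))"
    by simp
qed

end
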